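(* Let $\mathcal{E}$ be a unital qubit channel with Stokes matrix $R=B\,\mathrm{diag}[e_z,e_x,e_y]\,A$ ($A,B\in SO(3)$, $e_j$ real), and for $j\in\{z,x,y\}$ let $|\tilde A_j\rangle$ be the $j$-th column of $\mathrm{diag}[e_z,e_x,e_y]A$. Then $F_2(\mathcal{E})=\tilde F_2(\mathcal{E})$, where the maximum defining $\tilde F_2(\mathcal{E})$ is achieved by $O_A^*=A^{-1}$, $O_B^*=B^{-1}$. Furthermore, $F_1(\mathcal{E})=\tilde F_1(\mathcal{E})$ if and only if $|\tilde A_z\rangle,|\tilde A_x\rangle,|\tilde A_y\rangle$ are pairwise orthogonal; if this condition holds, the maximum defining $\tilde F_1(\mathcal{E})$ is achieved by a rotation $O_B^*$ whose first, second and third rows are scalar multiples of $(R_{zz},R_{xz},R_{yz})$, $(R_{zx},R_{xx},R_{yx})$ and $(R_{zy},R_{xy},R_{yy})$ respectively.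
   Context: A qubit channel is described by its Stokes parameterization $(R,t)$: in Bloch coordinates $(\theta_z,\theta_x,\theta_y)$, $\theta_a=\mathrm{Tr}(\rho\sigma_a)$, it acts as $\theta\mapsto R\theta+t$ (indices ordered $z,x,y$); unital means $t=0$. Unitary channels are identified with the rotations $O\in SO(3)$ they induce on Bloch vectors, so $\mathcal{E}'=\mathcal{U}_B\circ\mathcal{E}\circ\mathcal{U}_A$ has Stokes matrix $R'=O_BRO_A$. For any qubit channel $\mathcal{F}$ with complementary (environment) channel $\mathcal{F}_E$, and $|0_z\rangle,|1_z\rangle$ the $\pm1$ eigenvectors of $\sigma_z$: $H_{\mathcal{F}}(X|E)=H(\rho_{XE})-H(\rho_E)$ (von Neumann, base 2) for $\rho_{XE}=\sum_x\frac12|x_z\rangle\langle x_z|\otimes\mathcal{F}_E(|x_z\rangle\langle x_z|)$, and $H_{\mathcal{F}}(X|Y)$ is the conditional Shannon entropy for $P_{XY}(x,y)=\frac12\langle y_z|\mathcal{F}(|x_z\rangle\langle x_z|)|y_z\rangle$. Let $K(\mathcal{F})=H_{\mathcal{F}}(X|E)-H_{\mathcal{F}}(X|Y)$. Define $F_1(\mathcal{E})=\max_{\mathcal{U}_B}K(\mathcal{U}_B\circ\mathcal{E})$ and $F_2(\mathcal{E})=\max_{\mathcal{U}_A,\mathcal{U}_B}K(\mathcal{U}_B\circ\mathcal{E}\circ\mathcal{U}_A)$. For $\gamma=(\gamma_z,\gamma_x,\gamma_y)$ let $\mathcal{P}_s(\gamma)$ be the set of all qubit channels whose Stokes matrix has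 diagonal $(R_{zz},R_{xx},R_{yy})=\gamma$ (all other Stokes parameters arbitrary). Define $\tilde F_1(\mathcal{E})=\max_{\mathcal{U}_B}\min_{\tilde{\mathcal{E}}\in\mathcal{P}_s(\gamma')}K(\tilde{\mathcal{E}})$ and $\tilde F_2(\mathcal{E})=\max_{\mathcal{U}_A,\mathcal{U}_B}\min_{\tilde{\mathcal{E}}\in\mathcal{P}_s(\gamma')}K(\tilde{\mathcal{E}})$, where $\gamma'=(R'_{zz},R'_{xx},R'_{yy})$ is the diagonal of the compensated channel $\mathcal{E}'$ ($\mathcal{U}_A=\mathrm{id}$ in the one-sided case).
   Formalization: "Rows of O_B* are scalar multiples of the columns of R" is stated as: each column of R is a scalar multiple of the corresponding row of O_B*. This is the same for nonzero columns; for a zero column (e.g. R = 0) the literal wording cannot hold for a rotation. *)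

theory Defs
  imports "Jordan_Normal_Form.Char_Poly" "Jordan_Normal_Form.Determinant"
begin

section \<open>Matrices on qubits (indices 0,1 = |0_z>, |1_z>)\<close>

definition dag :: "complex mat \<Rightarrow> complex mat" where
  "dag M = mat (dim_col M) (dim_row M) (\<lambda>(i,j). cnj (M $$ (j,i)))"

text \<open>Pauli matrices, indexed in the order z, x, y (0, 1, 2).\<close>
definition pauli :: "nat \<Rightarrow> complex mat" where
  "pauli a = (if a = 0 then mat_of_rows_list 2 [[1,0],[0,-1]]
              else if a = 1 then mat_of_rows_list 2 [[0,1],[1,0]]
              else mat_of_rows_list 2 [[0,-\<i>],[\<i>,0]])"

definition proj_z :: "nat \<Rightarrow> complex mat" where
  "proj_z x = mat 2 2 (\<lambda>(i,j). if i = x \<and> j = x then 1 else 0)"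

definition kron :: "complex mat \<Rightarrow> complex mat \<Rightarrow> complex mat" where
  "kron A B = mat (dim_row A * dim_row B) (dim_col A * dim_col B)
     (\<lambda>(i,j). A $$ (i div dim_row B, j div dim_col B) * B $$ (i mod dim_row B, j mod dim_col B))"

text \<open>Partial traces on C^2 (x) C^d (system first, environment second).\<close>
definition ptrace_env :: "nat \<Rightarrow> complex mat \<Rightarrow> complex mat" where
  "ptrace_env d M = mat 2 2 (\<lambda>(i,j). \<Sum>k<d. M $$ (i*d+k, j*d+k))"

definition ptrace_sys :: "nat \<Rightarrow> complex mat \<Rightarrow> complex mat" where
  "ptrace_sys d M = mat d d (\<lambda>(k,l). \<Sum>i<2. M $$ (i*d+k, i*d+l))"

section \<open>Qubit channels (CPTP maps, via Stinespring dilation)\<close>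

definition stinespring :: "(complex mat \<Rightarrow> complex mat) \<Rightarrow> nat \<Rightarrow> complex mat \<Rightarrow> bool" where
  "stinespring F d V \<longleftrightarrow> 0 < d \<and> V \<in> carrier_mat (2*d) 2 \<and> dag V * V = 1\<^sub>m 2 \<and>
     (\<forall>\<rho>\<in>carrier_mat 2 2. F \<rho> = ptrace_env d (V * \<rho> * dag V))"

definition qubit_channel :: "(complex mat \<Rightarrow> complex mat) \<Rightarrow> bool" where
  "qubit_channel F \<longleftrightarrow> (\<exists>d V. stinespring F d V)"

definition env_channel :: "(complex mat \<Rightarrow> complex mat) \<Rightarrow> complex mat \<Rightarrow> complex mat" where
  "env_channel F = (let (d, V) = (SOME (d, V). stinespring F d V)
                    in (\<lambda>\<rho>. ptrace_sys d (V * \<rho> * dag V)))"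

definition unitary2 :: "complex mat \<Rightarrow> bool" where
  "unitary2 U \<longleftrightarrow> U \<in> carrier_mat 2 2 \<and> dag U * U = 1\<^sub>m 2"

definition uchan :: "complex mat \<Rightarrow> complex mat \<Rightarrow> complex mat" where
  "uchan U \<rho> = U * \<rho> * dag U"

definition mtrace :: "complex mat \<Rightarrow> complex" where
  "mtrace M = (\<Sum>i<dim_row M. M $$ (i,i))"

definition bloch :: "complex mat \<Rightarrow> nat \<Rightarrow> real" where
  "bloch \<rho> a = Re (mtrace (\<rho> * pauli a))"

definition stokes_t :: "(complex mat \<Rightarrow> complex mat) \<Rightarrow> nat \<Rightarrow> real" where
  "stokes_t F a = bloch (F ((1/2) \<cdot>\<^sub>m 1\<^sub>m 2)) a"

definition stokes_R :: "(complex mat \<Rightarrow> complex mat) \<Rightarrow> real mat" where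
  "stokes_R F = mat 3 3 (\<lambda>(a,b). bloch (F ((1/2) \<cdot>\<^sub>m (1\<^sub>m 2 + pauli b))) a - stokes_t F a)"

definition unital :: "(complex mat \<Rightarrow> complex mat) \<Rightarrow> bool" where
  "unital F \<longleftrightarrow> (\<forall>a<3. stokes_t F a = 0)"

definition SO3 :: "real mat \<Rightarrow> bool" where
  "SO3 Q \<longleftrightarrow> Q \<in> carrier_mat 3 3 \<and> transpose_mat Q * Q = 1\<^sub>m 3 \<and> det Q = 1"

definition rot :: "complex mat \<Rightarrow> real mat" where
  "rot U = stokes_R (uchan U)"

definition diag3 :: "(nat \<Rightarrow> real) \<Rightarrow> real mat" where
  "diag3 e = mat 3 3 (\<lambda>(i,j). if i = j then e i else 0)"

definition vn_entropy :: "complex mat \<Rightarrow> real" where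
  "vn_entropy M = sum_mset (image_mset (\<lambda>z. - (Re z) * log 2 (Re z)) (proots (char_poly M)))"

definition H_XE :: "(complex mat \<Rightarrow> complex mat) \<Rightarrow> real" where
  "H_XE F = (let FE = env_channel F;
                 \<rho>XE = (1/2) \<cdot>\<^sub>m kron (proj_z 0) (FE (proj_z 0))
                       + (1/2) \<cdot>\<^sub>m kron (proj_z 1) (FE (proj_z 1));
                 \<rho>E = (1/2) \<cdot>\<^sub>m FE (proj_z 0) + (1/2) \<cdot>\<^sub>m FE (proj_z 1)
             in vn_entropy \<rho>XE - vn_entropy \<rho>E)"

definition P_XY :: "(complex mat \<Rightarrow> complex mat) \<Rightarrow> nat \<Rightarrow> nat \<Rightarrow> real" where
  "P_XY F x y = (1/2) * Re (F (proj_z x) $$ (y,y))"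

definition H_XY :: "(complex mat \<Rightarrow> complex mat) \<Rightarrow> real" where
  "H_XY F = (\<Sum>x<2. \<Sum>y<2. - P_XY F x y * log 2 (P_XY F x y / (\<Sum>x'<2. P_XY F x' y)))"

definition Kkey :: "(complex mat \<Rightarrow> complex mat) \<Rightarrow> real" where
  "Kkey F = H_XE F - H_XY F"

definition F1 :: "(complex mat \<Rightarrow> complex mat) \<Rightarrow> real" where
  "F1 E = (SUP UB \<in> {U. unitary2 U}. Kkey (uchan UB \<circ> E))"

definition F2 :: "(complex mat \<Rightarrow> complex mat) \<Rightarrow> real" where
  "F2 E = (SUP (UA, UB) \<in> {U. unitary2 U} \<times> {U. unitary2 U}. Kkey (uchan UB \<circ> E \<circ> uchan UA))"

definition Ps :: "(nat \<Rightarrow> real) \<Rightarrow> (complex mat \<Rightarrow> complex mat) set" where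
  "Ps \<gamma> = {F. qubit_channel F \<and> (\<forall>j<3. stokes_R F $$ (j,j) = \<gamma> j)}"

definition Ktilde_at :: "(complex mat \<Rightarrow> complex mat) \<Rightarrow> real mat \<Rightarrow> real mat \<Rightarrow> real" where
  "Ktilde_at E OA OB = (INF F \<in> Ps (\<lambda>j. (OB * stokes_R E * OA) $$ (j,j)). Kkey F)"

definition F1tilde :: "(complex mat \<Rightarrow> complex mat) \<Rightarrow> real" where
  "F1tilde E = (SUP UB \<in> {U. unitary2 U}. Ktilde_at E (1\<^sub>m 3) (rot UB))"

definition F2tilde :: "(complex mat \<Rightarrow> complex mat) \<Rightarrow> real" where
  "F2tilde E = (SUP (UA, UB) \<in> {U. unitary2 U} \<times> {U. unitary2 U}. Ktilde_at E (rot UA) (rot UB))"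

end

theory Submission
  imports Defs "Jordan_Normal_Form.Schur_Decomposition" "HOL-Analysis.Elementary_Topology" "HOL-Real_Asymp.Real_Asymp"
begin

text \<open>
  Let $S$ be the entropy of the Choi state of $\mathcal{E}$, which is invariant under composition with unitaries on
  either side.  Writing $H(X|E)$ as the entropy gained by pinching the Choi state in the $z$-basis of the input,
  concavity of entropy gives $K(\mathcal{F}) \le 1 - S(\mathcal{F})$ for every channel, with equality for a unital
  $\mathcal{E}$ once $\mathcal{U}_B$ diagonalises $\mathcal{E}(|0_z\rangle\langle 0_z|)$; so $F_1 = F_2 = 1 - S$.
  In the other direction, relative entropy decreases under the Bell measurement, and this yields
  $K(\mathcal{F}) \ge 1 - H(p)$, where $p = \frac14(1 \pm \gamma_z \pm \gamma_x \pm \gamma_y)$ is the Bell diagonal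
  of the Choi state.  The Pauli channel with probabilities $p$ attains this bound, so the inner minimum in
  $\tilde F_i$ is exactly $1 - H(p)$.  Finally $H(p) \ge S$, with equality iff the Choi state is Bell diagonal, that is,
  iff the compensated Stokes matrix is diagonal.  Two-sided compensation always reaches this by the given
  decomposition; one-sided compensation does iff the columns of $R$ are orthogonal.
\<close>

section \<open>Spectral theorem and von Neumann entropy\<close>

text \<open>\<open>H_XE\<close> is built from an arbitrarily chosen dilation, whereas the bounds
  need the fixed 4 by 4 Choi matrix. The bridge is that a product and its reversed product share
  their nonzero spectrum while zero eigenvalues carry no entropy; positivity is therefore carried
  throughout by Gram factorisations, which Kraus operators supply. The obstacle is data processing
  for a pair \<rho>, \<sigma> that need not commute and may be singular. It is proved for projective
  measurements only, by deforming \<sigma> to \<sigma> + t \<rho>: the comparison of derivatives in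
  t is a quadratic optimisation, so no operator logarithm occurs. The Bell basis suits the lower
  bound because dephasing the input permutes the Bell vectors in pairs: after pinching, the Bell
  diagonal depends on \<gamma>_z alone, the very parameter that controls H(X|Y). The converse of the
  one-sided claim needs two further ingredients: the supremum over rotations is attained, by
  compactness of the unit quaternions, and the equality case of Jensen is turned into an equality of
  sums of squares, which the off-diagonal Stokes parameters would violate.\<close>

lemma dag_carrier [simp]: "M \<in> carrier_mat n m \<Longrightarrow> dag M \<in> carrier_mat m n"
  by (auto simp: dag_def)

lemma dag_dims [simp]: "dim_row (dag M) = dim_col M" "dim_col (dag M) = dim_row M"
  by (auto simp: dag_def)

lemma dag_index [simp]: "i < dim_col M \<Longrightarrow> j < dim_row M \<Longrightarrow> dag M $$ (i,j) = cnj (M $$ (j,i))"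
  by (auto simp: dag_def)

lemma dag_dag [simp]: "dag (dag M) = M"
  by (rule eq_matI) auto

lemma dag_one [simp]: "dag (1\<^sub>m n) = 1\<^sub>m n"
  by (rule eq_matI) auto

lemma dag_mult: "dim_col M = dim_row N \<Longrightarrow> dag (M * N) = dag N * dag M"
  by (rule eq_matI) (auto simp: scalar_prod_def cnj_sum mult.commute intro!: sum.cong)

lemma mult_assoc_dim:
  "dim_col L = dim_row M \<Longrightarrow> dim_col M = dim_row N \<Longrightarrow> L * M * N = L * (M * (N :: 'a :: semiring_0 mat))"
  by (rule assoc_mult_mat) auto

definition unitary_mat :: "nat \<Rightarrow> complex mat \<Rightarrow> bool" where
  "unitary_mat n U \<longleftrightarrow> U \<in> carrier_mat n n \<and> dag U * U = 1\<^sub>m n"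

lemma unitary_mat_carrier: "unitary_mat n U \<Longrightarrow> U \<in> carrier_mat n n"
  by (simp add: unitary_mat_def)

lemma unitary_mat_left: "unitary_mat n U \<Longrightarrow> dag U * U = 1\<^sub>m n"
  by (simp add: unitary_mat_def)

lemma unitary_mat_right: "unitary_mat n U \<Longrightarrow> U * dag U = 1\<^sub>m n"
  using mat_mult_left_right_inverse[of "dag U" n U] by (simp add: unitary_mat_def)

lemma unitary_mat_dag: "unitary_mat n U \<Longrightarrow> unitary_mat n (dag U)"
  using unitary_mat_right[of n U] by (simp add: unitary_mat_def)

lemma unitary_mat_mult:
  assumes "unitary_mat n U" "unitary_mat n V" shows "unitary_mat n (U * V)"
proof -
  have U: "U \<in> carrier_mat n n" and V: "V \<in> carrier_mat n n"
    using assms by (auto simp: unitary_mat_def)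
  have "dag (U * V) * (U * V) = dag V * (dag U * U) * V"
    using U V by (simp add: dag_mult mult_assoc_dim)
  then show ?thesis using assms U V by (simp add: unitary_mat_def)
qed

definition diag_real :: "nat \<Rightarrow> (nat \<Rightarrow> real) \<Rightarrow> complex mat" where
  "diag_real n r = mat n n (\<lambda>(i,j). if i = j then complex_of_real (r i) else 0)"

lemma diag_real_carrier [simp]: "diag_real n r \<in> carrier_mat n n"
  by (simp add: diag_real_def)

lemma diag_real_dims [simp]: "dim_row (diag_real n r) = n" "dim_col (diag_real n r) = n"
  by (simp_all add: diag_real_def)

text \<open>Gram-Schmidt on a basis that starts with \<open>v\<close> keeps \<open>v\<close> as its
  head and returns orthogonal vectors of arbitrary length; dividing by the norms \<open>nn\<close>
  makes the columns orthonormal, hence the factor \<open>c\<close>.\<close>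

lemma unitary_mat_extension:
  assumes v: "v \<in> carrier_vec n" and v0: "v \<noteq> 0\<^sub>v n"
  obtains W c where "unitary_mat n W" "col W 0 = c \<cdot>\<^sub>v v" "c \<noteq> 0"
proof -
  interpret cof_vec_space n "TYPE(complex)" .
  define b where "b = basis_completion v"
  define ws where "ws = gram_schmidt n b"
  have n: "n \<noteq> 0" using v v0 by (metis carrier_vecD eq_vecI index_zero_vec(2) not_less_zero)
  from basis_completion[OF v v0, folded b_def]
  have span_b: "span (set b) = carrier_vec n" and dist_b: "distinct b" 
    and indep: "\<not> lin_dep (set b)" and b: "set b \<subseteq> carrier_vec n" and hdb: "hd b = v" 
    and len_b: "length b = n" by auto
  from hdb len_b n obtain vs where bv: "b = v # vs" by (cases b, auto)
  from gram_schmidt_result[OF b dist_b indep refl, folded ws_def]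
  have ws: "set ws \<subseteq> carrier_vec n" "corthogonal ws" "length ws = n" 
    by (auto simp: len_b)
  from gram_schmidt_hd[OF v, of vs, folded bv] have hdws: "hd ws = v" unfolding ws_def .
  have wsi: "ws ! i \<in> carrier_vec n" if "i < n" for i using ws that by auto
  define nn where "nn i = sqrt (\<Sum>k<n. (cmod (ws ! i $ k))\<^sup>2)" for i
  have sp: "ws ! i \<bullet>c ws ! j = (\<Sum>k<n. ws ! i $ k * cnj (ws ! j $ k))" if "i < n" "j < n" for i j
    using wsi[OF that(1)] wsi[OF that(2)] by (auto simp: scalar_prod_def atLeast0LessThan)
  have self: "(\<Sum>k<n. ws ! i $ k * cnj (ws ! i $ k)) = complex_of_real ((nn i)\<^sup>2)" if "i < n" for i
    by (simp add: nn_def sum_nonneg complex_norm_square[symmetric])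
  have nn0: "nn i \<noteq> 0" if "i < n" for i
  proof
    assume "nn i = 0"
    then have "ws ! i \<bullet>c ws ! i = 0" using sp[OF that that] self[OF that] by simp
    then show False using corthogonalD[OF ws(2), of i i] that ws(3) by simp
  qed
  define W where "W = mat n n (\<lambda>(k,i). ws ! i $ k / complex_of_real (nn i))"
  have "dag W * W = 1\<^sub>m n"
  proof (rule eq_matI)
    fix i j assume "i < dim_row (1\<^sub>m n)" "j < dim_col (1\<^sub>m n)"
    then have i: "i < n" and j: "j < n" by auto
    have "(dag W * W) $$ (i,j) = (\<Sum>k<n. cnj (ws ! i $ k / complex_of_real (nn i)) * (ws ! j $ k / complex_of_real (nn j)))"
      using i j by (simp add: W_def scalar_prod_def atLeast0LessThan)
    also have "\<dots> = (\<Sum>k<n. ws ! j $ k * cnj (ws ! i $ k)) / (complex_of_real (nn i) * complex_of_real (nn j))"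
      by (simp add: sum_divide_distrib mult.commute)
    also have "\<dots> = (1\<^sub>m n) $$ (i,j)"
    proof (cases "i = j")
      case True
      then show ?thesis using i nn0[OF i] self[OF i] by (simp add: power2_eq_square)
    next
      case False
      then show ?thesis using corthogonalD[OF ws(2), of j i] i j ws(3) sp[OF j i] by simp
    qed
    finally show "(dag W * W) $$ (i,j) = (1\<^sub>m n) $$ (i,j)" .
  qed (auto simp: W_def)
  then have 1: "unitary_mat n W" by (simp add: unitary_mat_def W_def)
  have ws0: "ws ! 0 = v" using hdws ws(3) n by (metis hd_conv_nth length_0_conv)
  have "col W 0 = (1 / complex_of_real (nn 0)) \<cdot>\<^sub>v v"
    using n v by (intro eq_vecI) (auto simp: W_def ws0)
  moreover have "1 / complex_of_real (nn 0) \<noteq> 0" using nn0[of 0] n by simp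
  ultimately show ?thesis using that 1 by blast
qed

lemma dag_four_block:
  assumes "A \<in> carrier_mat a b" "B \<in> carrier_mat a c" "C \<in> carrier_mat d b" "D \<in> carrier_mat d c"
  shows "dag (four_block_mat A B C D) = four_block_mat (dag A) (dag C) (dag B) (dag D)"
  using assms by (intro eq_matI) auto

lemma complex_eigenvalue_exists:
  assumes A: "(A :: complex mat) \<in> carrier_mat n n" and n: "n \<noteq> 0"
  obtains v e where "v \<in> carrier_vec n" "v \<noteq> 0\<^sub>v n" "A *\<^sub>v v = e \<cdot>\<^sub>v v"
proof -
  have "degree (char_poly A) \<noteq> 0" using degree_monic_char_poly[OF A] n by simp
  then obtain e where "poly (char_poly A) e = 0"
    using fundamental_theorem_of_algebra constant_degree by metis
  then have "eigenvalue A e" using eigenvalue_root_char_poly[OF A] by simp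
  then show ?thesis using that A unfolding eigenvalue_def eigenvector_def by auto
qed

text \<open>Deflation: in an orthonormal basis starting with an eigenvector, the first column is a
  multiple of the first basis vector. Hermiticity clears the first row as well and makes the
  eigenvalue real, and the remaining block is hermitian of size one less.\<close>

theorem hermitian_diagonalization:
  assumes "A \<in> carrier_mat n n" and "dag A = A"
  shows "\<exists>U r. unitary_mat n U \<and> A = U * diag_real n r * dag U"
  using assms
proof (induction n arbitrary: A)
  case 0
  then show ?case by (intro exI[of _ "1\<^sub>m 0"]) (auto simp: unitary_mat_def intro!: eq_matI)
next
  case (Suc n)
  note A = Suc.prems(1)
  obtain v e where v: "v \<in> carrier_vec (Suc n)" "v \<noteq> 0\<^sub>v (Suc n)" and ev: "A *\<^sub>v v = e \<cdot>\<^sub>v v"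
    using complex_eigenvalue_exists[OF A] by blast
  obtain W c where W: "unitary_mat (Suc n) W" and c: "col W 0 = c \<cdot>\<^sub>v v" "c \<noteq> 0"
    using unitary_mat_extension[OF v] by blast
  have Wc: "W \<in> carrier_mat (Suc n) (Suc n)" using W by (rule unitary_mat_carrier)
  define M where "M = dag W * A * W"
  have Mc: "M \<in> carrier_mat (Suc n) (Suc n)" using A Wc by (auto simp: M_def)
  have Mh: "dag M = M" using A Wc Suc.prems(2)
    by (simp add: M_def dag_mult mult_assoc_dim)
  have "col (A * W) 0 = A *\<^sub>v col W 0" using A Wc by auto
  also have "\<dots> = c \<cdot>\<^sub>v (A *\<^sub>v v)" unfolding c using A v by (metis mult_mat_vec)
  also have "\<dots> = e \<cdot>\<^sub>v col W 0" unfolding ev c using v by (simp add: smult_smult_assoc mult.commute)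
  finally have AW: "col (A * W) 0 = e \<cdot>\<^sub>v col W 0" .
  have M0: "M $$ (i,0) = (if i = 0 then e else 0)" if i: "i < Suc n" for i
  proof -
    have "M = dag W * (A * W)" using A Wc by (simp add: M_def mult_assoc_dim carrier_matD)
    then have "M $$ (i,0) = row (dag W) i \<bullet> (e \<cdot>\<^sub>v col W 0)" using i A Wc AW by simp
    also have "\<dots> = e * (row (dag W) i \<bullet> col W 0)" using Wc i by (intro scalar_prod_smult_distrib[of _ "Suc n"]) (auto intro: col_carrier_vec[of 0 "Suc n"])
    also have "row (dag W) i \<bullet> col W 0 = (dag W * W) $$ (i,0)" using Wc i by simp
    also have "\<dots> = (1\<^sub>m (Suc n)) $$ (i,0)" using W by (simp add: unitary_mat_def)
    finally show ?thesis using i by simp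
  qed
  have M0': "M $$ (0,j) = (if j = 0 then e else 0)" if j: "j < Suc n" for j
  proof -
    have "M $$ (0,j) = cnj (M $$ (j,0))" using Mh j Mc by (metis carrier_matD dag_index zero_less_Suc)
    moreover have "e = cnj e" using M0[of 0] Mh Mc by (metis carrier_matD dag_index zero_less_Suc)
    ultimately show ?thesis using M0[OF j] by auto
  qed
  have ereal: "e = complex_of_real (Re e)"
    using M0[of 0] Mh Mc by (metis carrier_matD dag_index zero_less_Suc complex_cnj_cancel_iff Reals_cnj_iff of_real_Re)
  define A3 where "A3 = mat n n (\<lambda>(i,j). M $$ (Suc i, Suc j))"
  have A3: "A3 \<in> carrier_mat n n" by (simp add: A3_def)
  have "dag A3 = A3"
  proof (rule eq_matI)
    fix i j assume "i < dim_row A3" "j < dim_col A3"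
    then have "i < n" "j < n" by (auto simp: A3_def)
    then show "dag A3 $$ (i,j) = A3 $$ (i,j)" using Mh Mc
      by (simp add: A3_def) (metis carrier_matD dag_index Suc_less_eq)
  qed (auto simp: A3_def)
  then obtain U r where U: "unitary_mat n U" and A3e: "A3 = U * diag_real n r * dag U"
    using Suc.IH[OF A3] by blast
  have Uc: "U \<in> carrier_mat n n" using U by (rule unitary_mat_carrier)
  define Z where "Z = four_block_mat (1\<^sub>m 1) (0\<^sub>m 1 n) (0\<^sub>m n 1) U"
  define s where "s i = (case i of 0 \<Rightarrow> Re e | Suc k \<Rightarrow> r k)" for i
  have Zc: "Z \<in> carrier_mat (Suc n) (Suc n)" using Uc by (auto simp: Z_def intro!: carrier_matI)
  have dagZ: "dag Z = four_block_mat (1\<^sub>m 1) (0\<^sub>m 1 n) (0\<^sub>m n 1) (dag U)"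
  proof -
    have "dag (0\<^sub>m n 1) = 0\<^sub>m 1 n" "dag (0\<^sub>m 1 n) = 0\<^sub>m n 1" by (auto intro!: eq_matI)
    then show ?thesis unfolding Z_def by (subst dag_four_block[of _ 1 1 _ n _ n]) (use Uc in auto)
  qed
  have "dag Z * Z = four_block_mat (1\<^sub>m 1) (0\<^sub>m 1 n) (0\<^sub>m n 1) (1\<^sub>m n)"
    unfolding dagZ unfolding Z_def
    by (subst mult_four_block_mat[of _ 1 1 _ n _ n _ _ 1 _ n]) (use Uc unitary_mat_left[OF U] in \<open>auto\<close>)
  also have "\<dots> = 1\<^sub>m (Suc n)" by (rule eq_matI) auto
  finally have Zu: "unitary_mat (Suc n) Z" using Zc by (simp add: unitary_mat_def)
  have D: "diag_real (Suc n) s = four_block_mat (mat 1 1 (\<lambda>_. e)) (0\<^sub>m 1 n) (0\<^sub>m n 1) (diag_real n r)"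
    by (rule eq_matI) (auto simp: diag_real_def s_def ereal[symmetric] split: nat.splits)
  have "Z * diag_real (Suc n) s * dag Z = four_block_mat (mat 1 1 (\<lambda>_. e)) (0\<^sub>m 1 n) (0\<^sub>m n 1) A3"
  proof -
    have "Z * diag_real (Suc n) s = four_block_mat (mat 1 1 (\<lambda>_. e)) (0\<^sub>m 1 n) (0\<^sub>m n 1) (U * diag_real n r)"
      unfolding Z_def D
      by (subst mult_four_block_mat[of _ 1 1 _ n _ n _ _ 1 _ n]) (use Uc in \<open>auto simp: left_mult_one_mat[of _ 1 1] left_mult_zero_mat[of _ n n]\<close>)
    then show ?thesis unfolding dagZ A3e
      by (simp, subst mult_four_block_mat[of _ 1 1 _ n _ n _ _ 1 _ n])
        (use Uc in \<open>auto simp: right_mult_one_mat[of _ 1 1] right_mult_zero_mat[of _ n n] left_mult_zero_mat[of _ n n]\<close>)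
  qed
  also have "\<dots> = M"
  proof (rule eq_matI)
    fix i j assume ij: "i < dim_row M" "j < dim_col M"
    then have "i < Suc n" "j < Suc n" using Mc by auto
    then show "four_block_mat (mat 1 1 (\<lambda>_. e)) (0\<^sub>m 1 n) (0\<^sub>m n 1) A3 $$ (i, j) = M $$ (i,j)"
      using M0 M0' by (cases i; cases j) (auto simp: A3_def)
  qed (use Mc A3 in auto)
  finally have ZM: "Z * diag_real (Suc n) s * dag Z = M" .
  have "(W * Z) * diag_real (Suc n) s * dag (W * Z) = W * (Z * diag_real (Suc n) s * dag Z) * dag W"
    using Wc Zc by (simp add: dag_mult mult_assoc_dim)
  also have "\<dots> = (W * dag W) * A * (W * dag W)" unfolding ZM M_def
    using Wc A by (simp add: mult_assoc_dim)
  also have "\<dots> = A" using unitary_mat_right[OF W] A by simp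
  finally show ?case using unitary_mat_mult[OF W Zu] by metis
qed


section \<open>Spectrum and entropy of a product under exchange of its factors\<close>

text \<open>Sylvester's identity. Over the polynomial ring, \<open>M\<close> becomes block
  triangular in two ways: multiplying by \<open>L\<close> on the right exposes the characteristic
  matrix of \<open>X * Y\<close>, multiplying by \<open>L2\<close> on the left that of
  \<open>Y * X\<close>. The determinants of the two products are then compared.\<close>

lemma char_poly_mult_swap:
  fixes X Y :: "complex mat"
  assumes X: "X \<in> carrier_mat n m" and Y: "Y \<in> carrier_mat m n"
  shows "[:0,1:] ^ m * char_poly (X * Y) = [:0,1:] ^ n * char_poly (Y * X)"
proof -
  let ?x = "[:0,1:] :: complex poly"
  define X' where "X' = map_mat (\<lambda>a. [:a:]) X"
  define Y' where "Y' = map_mat (\<lambda>a. [:a:]) Y"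
  have X': "X' \<in> carrier_mat n m" and Y': "Y' \<in> carrier_mat m n"
    using X Y by (auto simp: X'_def Y'_def)
  have cXY: "char_poly_matrix (X * Y) = ?x \<cdot>\<^sub>m 1\<^sub>m n + X' * (- Y')"
  proof -
    have "map_mat (\<lambda>a. [:a:]) (X * Y) = X' * Y'"
      unfolding X'_def Y'_def by (rule map_poly_mult(1)[OF X Y])
    then have "map_mat (\<lambda>a. [:- a:]) (X * Y) = - (X' * Y')"
      using X Y X' Y' by (simp add: mat_eq_iff) (metis minus_pCons minus_zero)
    also have "\<dots> = X' * (- Y')" using X' Y' by (simp add: mat_eq_iff scalar_prod_def sum_negf)
    finally show ?thesis using X by (simp add: char_poly_matrix_def)
  qed
  have cYX: "char_poly_matrix (Y * X) = - Y' * X' + ?x \<cdot>\<^sub>m 1\<^sub>m m"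
  proof -
    have "map_mat (\<lambda>a. [:a:]) (Y * X) = Y' * X'"
      unfolding X'_def Y'_def by (rule map_poly_mult(1)[OF Y X])
    then have "map_mat (\<lambda>a. [:- a:]) (Y * X) = - (Y' * X')"
      using X Y X' Y' by (simp add: mat_eq_iff) (metis minus_pCons minus_zero)
    also have "\<dots> = - Y' * X'" using X' Y' by (simp add: mat_eq_iff scalar_prod_def sum_negf)
    finally show ?thesis using Y X' Y'
      by (simp add: char_poly_matrix_def) (intro comm_add_mat[of _ m m], auto)
  qed
  define M where "M = four_block_mat (?x \<cdot>\<^sub>m 1\<^sub>m n) X' Y' (1\<^sub>m m)"
  define L where "L = four_block_mat (1\<^sub>m n) (0\<^sub>m n m) (- Y') (1\<^sub>m m)"
  define L2 where "L2 = four_block_mat (1\<^sub>m n) (0\<^sub>m n m) (- Y') (?x \<cdot>\<^sub>m 1\<^sub>m m)"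
  have Mc: "M \<in> carrier_mat (n+m) (n+m)" and Lc: "L \<in> carrier_mat (n+m) (n+m)"
    and L2c: "L2 \<in> carrier_mat (n+m) (n+m)"
    using X' Y' by (auto simp: M_def L_def L2_def)
  have z: "Y' + - Y' = 0\<^sub>m m n" using Y' by (auto simp: mat_eq_iff)
  have z2: "- Y' * (?x \<cdot>\<^sub>m 1\<^sub>m n) + ?x \<cdot>\<^sub>m 1\<^sub>m m * Y' = 0\<^sub>m m n"
  proof -
    have "- Y' * (?x \<cdot>\<^sub>m 1\<^sub>m n) = ?x \<cdot>\<^sub>m (- Y')" using Y' by (subst mult_smult_distrib[of _ m n]) auto
    moreover have "?x \<cdot>\<^sub>m 1\<^sub>m m * Y' = ?x \<cdot>\<^sub>m Y'" using Y' by (subst mult_smult_assoc_mat[of _ m m]) auto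
    ultimately show ?thesis using Y' by (auto simp: mat_eq_iff)
  qed
  have prod1: "M * L = four_block_mat (char_poly_matrix (X * Y)) X' (0\<^sub>m m n) (1\<^sub>m m)"
    unfolding M_def L_def cXY
    by (subst mult_four_block_mat[of _ n n _ m _ m _ _ n _ m]) (use X' Y' z in auto)
  have prod2: "L2 * M = four_block_mat (?x \<cdot>\<^sub>m 1\<^sub>m n) X' (0\<^sub>m m n) (char_poly_matrix (Y * X))"
    unfolding M_def L2_def cYX
    by (subst mult_four_block_mat[of _ n n _ m _ m _ _ n _ m]) (use X' Y' z2 in auto)
  have dL: "det L = 1" unfolding L_def
    by (subst det_four_block_mat_upper_right_zero[of _ n _ m]) (use Y' in auto)
  have dL2: "det L2 = ?x ^ m" unfolding L2_def
    by (subst det_four_block_mat_upper_right_zero[of _ n _ m]) (use Y' in \<open>auto simp: det_smult\<close>)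
  have "det (M * L) = char_poly (X * Y)" unfolding prod1 char_poly_def
    by (subst det_four_block_mat_lower_left_zero[of _ n _ m]) (use X Y X' in auto)
  moreover have "det (L2 * M) = ?x ^ n * char_poly (Y * X)" unfolding prod2 char_poly_def
    by (subst det_four_block_mat_lower_left_zero[of _ n _ m]) (use X Y X' in \<open>auto simp: det_smult\<close>)
  ultimately show ?thesis
    using det_mult[OF Mc Lc] det_mult[OF L2c Mc] dL dL2 by simp
qed

lemma char_poly_nonzero: "A \<in> carrier_mat n n \<Longrightarrow> char_poly (A :: complex mat) \<noteq> 0"
  using degree_monic_char_poly[of A n] by auto

text \<open>The two spectra differ only in the multiplicity of 0, and a zero eigenvalue contributes
  \<open>0 * log 2 0 = 0\<close>. This is what carries entropies from the environment to the Choi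
  matrix.\<close>

lemma vn_entropy_mult_swap:
  assumes X: "X \<in> carrier_mat n m" and Y: "Y \<in> carrier_mat m n"
  shows "vn_entropy (X * Y) = vn_entropy (Y * X)"
proof -
  let ?f = "\<lambda>p. sum_mset (image_mset (\<lambda>z. - (Re z) * log 2 (Re z)) (proots p))"
  have pr: "?f ([:0,1:] ^ k * p) = ?f p" if "p \<noteq> 0" for k and p :: "complex poly"
  proof -
    have "proots ([:0,1:] ^ k * p) = repeat_mset k {#0#} + proots p"
      using that by (subst proots_mult) (auto simp: proots_power)
    moreover have "sum_mset (image_mset (\<lambda>z. - (Re z) * log 2 (Re z)) (repeat_mset k {#0#})) = 0"
      by (induction k) auto
    ultimately show ?thesis by simp
  qed
  have "X * Y \<in> carrier_mat n n" "Y * X \<in> carrier_mat m m" using X Y by auto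
  then show ?thesis
    using pr[OF char_poly_nonzero, of "X * Y" n m] pr[OF char_poly_nonzero, of "Y * X" m n]
      char_poly_mult_swap[OF X Y] by (simp add: vn_entropy_def)
qed

lemma vn_entropy_transpose: "M \<in> carrier_mat n n \<Longrightarrow> vn_entropy (transpose_mat M) = vn_entropy M"
  by (simp add: vn_entropy_def)

definition eta :: "real \<Rightarrow> real" where "eta x = - x * log 2 x"

lemma vn_entropy_diag_real: "vn_entropy (diag_real n r) = (\<Sum>i<n. eta (r i))"
proof -
  have "char_poly (diag_real n r) = (\<Prod>a\<leftarrow>diag_mat (diag_real n r). [:- a, 1:])"
    by (rule char_poly_upper_triangular[of _ n]) (auto simp: diag_real_def upper_triangular_def)
  also have "diag_mat (diag_real n r) = map (\<lambda>i. complex_of_real (r i)) [0..<n]"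
    by (auto simp: diag_mat_def diag_real_def)
  finally have "char_poly (diag_real n r) = (\<Prod>i\<leftarrow>[0..<n]. [:- complex_of_real (r i), 1:])"
    by (simp add: o_def)
  also have "\<dots> = (\<Prod>i<n. [:- complex_of_real (r i), 1:])"
    by (induction n) (simp_all add: lessThan_Suc mult.commute)
  finally have "proots (char_poly (diag_real n r)) = (\<Sum>i<n. {# complex_of_real (r i) #})"
    by (simp add: proots_prod)
  then have "vn_entropy (diag_real n r) = sum_mset (image_mset (\<lambda>z. - (Re z) * log 2 (Re z)) (\<Sum>i<n. {# complex_of_real (r i) #}))"
    by (simp add: vn_entropy_def)
  also have "\<dots> = (\<Sum>i<n. eta (r i))"
    by (induction n) (auto simp: eta_def)
  finally show ?thesis .
qed

lemma vn_entropy_unitary_conj: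
  assumes U: "unitary_mat n U" and M: "M \<in> carrier_mat n n"
  shows "vn_entropy (U * M * dag U) = vn_entropy M"
proof -
  have "similar_mat_wit (U * M * dag U) M U (dag U)"
    using U M unitary_mat_right[OF U] by (intro similar_mat_witI[of _ _ n]) (auto simp: unitary_mat_def)
  then have "char_poly (U * M * dag U) = char_poly M"
    by (intro char_poly_similar) (auto simp: similar_mat_def)
  then show ?thesis by (simp add: vn_entropy_def)
qed

section \<open>Concavity and relative entropy\<close>

text \<open>The right-hand side is the tangent at \<open>m\<close> of the concave function
  \<open>eta\<close>; the estimate is \<open>ln y \<le> y - 1\<close> at y = m/x. The strict form
  feeds the equality case of Jensen.\<close>

lemma eta_tangent:
  assumes "0 \<le> x" "0 < m"
  shows "eta x \<le> - x * log 2 m + (m - x) / ln 2"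
    and "x \<noteq> m \<Longrightarrow> eta x < - x * log 2 m + (m - x) / ln 2"
proof -
  have *: "- x * ln x \<le> - x * ln m + (m - x)" "x \<noteq> m \<Longrightarrow> - x * ln x < - x * ln m + (m - x)"
  proof -
    consider "x = 0" | "x > 0" using assms(1) by linarith
    then have "- x * ln x \<le> - x * ln m + (m - x) \<and> (x \<noteq> m \<longrightarrow> - x * ln x < - x * ln m + (m - x))"
    proof cases
      case 2
      have l: "x * ln (m / x) = x * ln m - x * ln x" using 2 assms by (simp add: ln_div algebra_simps)
      have "ln (m / x) \<le> m / x - 1" using 2 assms by (intro ln_le_minus_one) auto
      then have "x * ln (m / x) \<le> x * (m / x - 1)" using 2 by (intro mult_left_mono) auto
      then have 1: "x * ln (m / x) \<le> m - x" using 2 by (simp add: right_diff_distrib)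
      have "x * ln (m / x) < m - x" if "x \<noteq> m"
      proof -
        have "ln (m / x) \<noteq> m / x - 1"
        proof
          assume "ln (m / x) = m / x - 1"
          moreover have "0 < m / x" using 2 assms by simp
          ultimately have "m / x = 1" by (rule ln_eq_minus_one[rotated])
          then show False using that 2 by simp
        qed
        with \<open>ln (m / x) \<le> m / x - 1\<close> have "x * ln (m / x) < x * (m / x - 1)"
          using 2 by (intro mult_strict_left_mono) linarith+
        then show ?thesis using 2 by (simp add: right_diff_distrib)
      qed
      with 1 l show ?thesis by auto
    qed (simp add: assms less_imp_le)
    then show "- x * ln x \<le> - x * ln m + (m - x)" "x \<noteq> m \<Longrightarrow> - x * ln x < - x * ln m + (m - x)" by auto
  qed
  have e: "eta x = (- x * ln x) / ln 2" "- x * log 2 m + (m - x) / ln 2 = (- x * ln m + (m - x)) / ln 2"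
    by (simp_all add: eta_def log_def add_divide_distrib diff_divide_distrib)
  show "eta x \<le> - x * log 2 m + (m - x) / ln 2" unfolding e by (intro divide_right_mono *) auto
  show "x \<noteq> m \<Longrightarrow> eta x < - x * log 2 m + (m - x) / ln 2" unfolding e
    by (intro divide_strict_right_mono *) auto
qed

lemma eta_0 [simp]: "eta 0 = 0" by (simp add: eta_def)

text \<open>Average the tangent bounds at the mean \<open>m\<close>: their linear parts sum to
  exactly \<open>eta m\<close>. A mean of 0 is treated apart, the slope of \<open>eta\<close> being
  infinite there, but then every point of positive weight is 0.\<close>

lemma eta_jensen:
  assumes "finite A" and w: "\<And>k. k \<in> A \<Longrightarrow> 0 \<le> w k" and x: "\<And>k. k \<in> A \<Longrightarrow> 0 \<le> x k"
    and w1: "(\<Sum>k\<in>A. w k) = 1" and m: "m = (\<Sum>k\<in>A. w k * x k)"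
  shows "(\<Sum>k\<in>A. w k * eta (x k)) \<le> eta m"
    and "(\<Sum>k\<in>A. w k * eta (x k)) = eta m \<Longrightarrow> k \<in> A \<Longrightarrow> w k \<noteq> 0 \<Longrightarrow> x k = m"
proof -
  have m0: "0 \<le> m" using w x by (auto simp: m intro!: sum_nonneg)
  have "(\<Sum>k\<in>A. w k * eta (x k)) \<le> eta m \<and> ((\<Sum>k\<in>A. w k * eta (x k)) = eta m \<longrightarrow> (\<forall>k\<in>A. w k \<noteq> 0 \<longrightarrow> x k = m))"
  proof (cases "m = 0")
    case True
    then have z: "\<forall>k\<in>A. w k * x k = 0"
      using sum_nonneg_eq_0_iff[OF assms(1), of "\<lambda>k. w k * x k"] w x m by auto
    then have "(\<Sum>k\<in>A. w k * eta (x k)) = 0" by (intro sum.neutral) (auto simp: eta_def)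
    with z True show ?thesis by auto
  next
    case False
    with m0 have mp: "0 < m" by simp
    let ?b = "\<lambda>k. w k * (- x k * log 2 m + (m - x k) / ln 2)"
    have le: "w k * eta (x k) \<le> ?b k" if "k \<in> A" for k
      using w x that mp by (intro mult_left_mono eta_tangent(1)) auto
    have "(\<Sum>k\<in>A. ?b k) = - (\<Sum>k\<in>A. w k * x k) * log 2 m + ((\<Sum>k\<in>A. w k) * m - (\<Sum>k\<in>A. w k * x k)) / ln 2"
    proof -
      have "?b k = - log 2 m * (w k * x k) + (m / ln 2) * w k - (1 / ln 2) * (w k * x k)" for k
        by (simp add: algebra_simps diff_divide_distrib)
      then have "(\<Sum>k\<in>A. ?b k) = - log 2 m * (\<Sum>k\<in>A. w k * x k) + (m / ln 2) * (\<Sum>k\<in>A. w k)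
          - (1 / ln 2) * (\<Sum>k\<in>A. w k * x k)"
        by (simp only: sum.distrib sum_subtractf sum_distrib_left)
      then show ?thesis by (simp add: algebra_simps diff_divide_distrib)
    qed
    then have b: "(\<Sum>k\<in>A. ?b k) = eta m" using w1 m by (simp add: eta_def)
    have 1: "(\<Sum>k\<in>A. w k * eta (x k)) \<le> eta m" using sum_mono[of A "\<lambda>k. w k * eta (x k)" ?b] le b by simp
    have "x k = m" if eq: "(\<Sum>k\<in>A. w k * eta (x k)) = eta m" and k: "k \<in> A" "w k \<noteq> 0" for k
    proof (rule ccontr)
      assume "x k \<noteq> m"
      then have "w k * eta (x k) < ?b k"
        using w[OF k(1)] k(2) x[OF k(1)] mp by (intro mult_strict_left_mono eta_tangent(2)) auto
      then have "(\<Sum>k\<in>A. w k * eta (x k)) < (\<Sum>k\<in>A. ?b k)"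
        using le k assms(1) by (intro sum_strict_mono_ex1) auto
      then show False using b eq by simp
    qed
    with 1 show ?thesis by blast
  qed
  then show "(\<Sum>k\<in>A. w k * eta (x k)) \<le> eta m"
    "(\<Sum>k\<in>A. w k * eta (x k)) = eta m \<Longrightarrow> k \<in> A \<Longrightarrow> w k \<noteq> 0 \<Longrightarrow> x k = m" by blast+
qed

text \<open>Jensen is applied in each row, and the column sums reassemble the entropy of
  \<open>r\<close>. In the equality case \<open>r k = p i\<close> wherever \<open>S i k\<close> is
  nonzero, so second moments are preserved too; this is the form in which equality is used
  later.\<close>

lemma doubly_stochastic_entropy:
  fixes S :: "nat \<Rightarrow> nat \<Rightarrow> real"
  assumes S: "\<And>i k. i < n \<Longrightarrow> k < n \<Longrightarrow> 0 \<le> S i k"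
    and row: "\<And>i. i < n \<Longrightarrow> (\<Sum>k<n. S i k) = 1" and col: "\<And>k. k < n \<Longrightarrow> (\<Sum>i<n. S i k) = 1"
    and r: "\<And>k. k < n \<Longrightarrow> 0 \<le> r k" and p: "\<And>i. i < n \<Longrightarrow> p i = (\<Sum>k<n. S i k * r k)"
  shows "(\<Sum>k<n. eta (r k)) \<le> (\<Sum>i<n. eta (p i))"
    and "(\<Sum>k<n. eta (r k)) = (\<Sum>i<n. eta (p i)) \<Longrightarrow> (\<Sum>i<n. (p i)\<^sup>2) = (\<Sum>k<n. (r k)\<^sup>2)"
proof -
  have swap: "(\<Sum>i<n. \<Sum>k<n. S i k * f k) = (\<Sum>k<n. f k)" for f :: "nat \<Rightarrow> real"
  proof -
    have "(\<Sum>i<n. \<Sum>k<n. S i k * f k) = (\<Sum>k<n. (\<Sum>i<n. S i k) * f k)"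
      by (subst sum.swap) (simp add: sum_distrib_right)
    also have "\<dots> = (\<Sum>k<n. f k)" using col by (intro sum.cong) auto
    finally show ?thesis .
  qed
  have le: "(\<Sum>k<n. S i k * eta (r k)) \<le> eta (p i)" if "i < n" for i
    using that S row r p by (intro eta_jensen(1)) auto
  show "(\<Sum>k<n. eta (r k)) \<le> (\<Sum>i<n. eta (p i))"
    using sum_mono[of "{..<n}" "\<lambda>i. \<Sum>k<n. S i k * eta (r k)" "\<lambda>i. eta (p i)"] le swap[of "\<lambda>k. eta (r k)"] by simp
  assume eq: "(\<Sum>k<n. eta (r k)) = (\<Sum>i<n. eta (p i))"
  have each: "(\<Sum>k<n. S i k * eta (r k)) = eta (p i)" if "i < n" for i
  proof (rule ccontr)
    assume "(\<Sum>k<n. S i k * eta (r k)) \<noteq> eta (p i)"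
    then have "(\<Sum>i<n. \<Sum>k<n. S i k * eta (r k)) < (\<Sum>i<n. eta (p i))"
      using le that by (intro sum_strict_mono_ex1) (auto simp: less_le)
    then show False using eq swap[of "\<lambda>k. eta (r k)"] by simp
  qed
  have same: "S i k * r k = S i k * p i" if "i < n" "k < n" for i k
    using eta_jensen(2)[of "{..<n}" "S i" r "p i" k] each[OF that(1)] that S row r p
    by (cases "S i k = 0") auto
  have "(\<Sum>k<n. (r k)\<^sup>2) = (\<Sum>i<n. \<Sum>k<n. S i k * r k * r k)"
    using swap[of "\<lambda>k. (r k)\<^sup>2"] by (simp add: power2_eq_square mult.assoc)
  also have "\<dots> = (\<Sum>i<n. \<Sum>k<n. p i * (S i k * r k))"
    using same by (intro sum.cong refl) (simp add: algebra_simps)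
  also have "\<dots> = (\<Sum>i<n. (p i)\<^sup>2)"
    using p by (intro sum.cong refl) (simp add: sum_distrib_left[symmetric] power2_eq_square)
  finally show "(\<Sum>i<n. (p i)\<^sup>2) = (\<Sum>k<n. (r k)\<^sup>2)" by simp
qed

section \<open>Relative entropy under a projective measurement\<close>

lemma unitary_cols:
  assumes "unitary_mat n U" "i < n" "j < n"
  shows "(\<Sum>k<n. cnj (U $$ (k,i)) * U $$ (k,j)) = (if i = j then 1 else 0)"
proof -
  have "(dag U * U) $$ (i,j) = (\<Sum>k<n. cnj (U $$ (k,i)) * U $$ (k,j))"
    using unitary_mat_carrier[OF assms(1)] assms(2,3) by (auto simp: scalar_prod_def atLeast0LessThan intro!: sum.cong)
  then show ?thesis using unitary_mat_left[OF assms(1)] assms by simp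
qed

lemma unitary_rows:
  assumes "unitary_mat n U" "i < n" "j < n"
  shows "(\<Sum>k<n. U $$ (i,k) * cnj (U $$ (j,k))) = (if i = j then 1 else 0)"
  using unitary_cols[OF unitary_mat_dag[OF assms(1)] assms(2,3)] assms
  by (auto simp: unitary_mat_def)

lemma mult_cnj_cmod: "z * cnj z = (complex_of_real (cmod z))\<^sup>2"
  by (simp add: complex_norm_square[symmetric])

lemma sum_rotate:
  "(\<Sum>j\<in>C. \<Sum>i\<in>A. \<Sum>l\<in>B. f i l j) = (\<Sum>i\<in>A. \<Sum>l\<in>B. \<Sum>j\<in>C. f i l j)"
proof -
  have "(\<Sum>j\<in>C. \<Sum>i\<in>A. \<Sum>l\<in>B. f i l j) = (\<Sum>i\<in>A. \<Sum>j\<in>C. \<Sum>l\<in>B. f i l j)" by (rule sum.swap)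
  also have "\<dots> = (\<Sum>i\<in>A. \<Sum>l\<in>B. \<Sum>j\<in>C. f i l j)" by (intro sum.cong refl sum.swap)
  finally show ?thesis .
qed

text \<open>Parseval's identity for row vectors multiplied by \<open>U\<close> on the right.\<close>

lemma unitary_rows_inner:
  assumes U: "unitary_mat n U"
  shows "(\<Sum>j<n. cnj (\<Sum>i<n. f i * U $$ (i,j)) * (\<Sum>i<n. g i * U $$ (i,j))) = (\<Sum>i<n. cnj (f i) * g i)"
proof -
  have "(\<Sum>j<n. cnj (\<Sum>i<n. f i * U $$ (i,j)) * (\<Sum>i<n. g i * U $$ (i,j)))
      = (\<Sum>j<n. \<Sum>i<n. \<Sum>l<n. cnj (f i) * g l * (U $$ (l,j) * cnj (U $$ (i,j))))"
    by (simp only: cnj_sum sum_product) (simp add: mult_ac)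
  also have "\<dots> = (\<Sum>i<n. \<Sum>l<n. \<Sum>j<n. cnj (f i) * g l * (U $$ (l,j) * cnj (U $$ (i,j))))"
    by (rule sum_rotate)
  also have "\<dots> = (\<Sum>i<n. \<Sum>l<n. cnj (f i) * g l * (if l = i then 1 else 0))"
    by (intro sum.cong refl) (simp only: sum_distrib_left[symmetric] unitary_rows[OF U] lessThan_iff)
  also have "\<dots> = (\<Sum>i<n. cnj (f i) * g i)"
    by (intro sum.cong refl) (simp add: if_distrib[where f="\<lambda>z. _ * z"] cong: if_cong)
  finally show ?thesis .
qed

lemma unitary_rows_norm:
  assumes U: "unitary_mat n U"
  shows "(\<Sum>j<n. (cmod (\<Sum>i<n. f i * U $$ (i,j)))\<^sup>2) = (\<Sum>i<n. (cmod (f i))\<^sup>2)"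
proof -
  have "complex_of_real (\<Sum>j<n. (cmod (\<Sum>i<n. f i * U $$ (i,j)))\<^sup>2) = complex_of_real (\<Sum>i<n. (cmod (f i))\<^sup>2)"
    using unitary_rows_inner[OF U, of f f]
    by (simp only: of_real_sum complex_norm_square) (simp only: mult.commute[of _ "cnj _"])
  then show ?thesis using of_real_eq_iff by blast
qed

text \<open>
  The right-hand side is $\sup_X \, 2\,\mathrm{Re}\,\mathrm{tr}\,\rho X - \mathrm{tr}\,\sigma X X^* - t\,\mathrm{tr}\,\rho X^* X$;
  the left-hand side restricts $X$ to real diagonal matrices in the measured basis.
\<close>

lemma quadratic_form_resolvent:
  fixes \<alpha> \<beta> :: "complex mat" and r s x :: "nat \<Rightarrow> real"
  assumes \<alpha>: "unitary_mat n \<alpha>" and \<beta>: "unitary_mat n \<beta>"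
    and r: "\<And>k. k < n \<Longrightarrow> 0 \<le> r k" and s: "\<And>j. j < n \<Longrightarrow> 0 \<le> s j" and t: "0 \<le> t"
  defines "p \<equiv> \<lambda>i. \<Sum>k<n. r k * (cmod (\<alpha> $$ (k,i)))\<^sup>2"
  defines "q \<equiv> \<lambda>i. \<Sum>j<n. s j * (cmod (\<beta> $$ (i,j)))\<^sup>2"
  defines "w \<equiv> \<lambda>k j. (cmod ((\<alpha> * \<beta>) $$ (k,j)))\<^sup>2"
  assumes supp: "\<And>k j. k < n \<Longrightarrow> j < n \<Longrightarrow> s j + t * r k = 0 \<Longrightarrow> w k j * r k = 0"
  shows "(\<Sum>i<n. 2 * p i * x i - q i * (x i)\<^sup>2 - t * p i * (x i)\<^sup>2)
    \<le> (\<Sum>k<n. \<Sum>j<n. w k j * (r k)\<^sup>2 / (s j + t * r k))"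
proof -
  have ac: "\<alpha> \<in> carrier_mat n n" and bc: "\<beta> \<in> carrier_mat n n"
    using \<alpha> \<beta> by (auto simp: unitary_mat_def)
  \<comment> \<open>\<open>W\<close> represents \<open>\<alpha> * \<beta>\<close>. \<open>X\<close>
    is the observable that is diagonal with values \<open>x\<close> in the measured basis, with its
    rows read in the eigenbasis of \<rho> and its columns in that of \<sigma>.\<close>
  define W where "W k j = (\<Sum>i<n. \<alpha> $$ (k,i) * \<beta> $$ (i,j))" for k j
  define X where "X k j = (\<Sum>i<n. complex_of_real (x i) * \<alpha> $$ (k,i) * \<beta> $$ (i,j))" for k j
  have w: "w k j = (cmod (W k j))\<^sup>2" if "k < n" "j < n" for k j
    using that ac bc by (simp add: w_def W_def scalar_prod_def atLeast0LessThan)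
  \<comment> \<open>Complete the square in \<open>X k j\<close>. When the denominator vanishes the
    quotient is 0 by convention, and \<open>supp\<close> makes the left side vanish as well.\<close>
  have pointwise: "2 * r k * Re (cnj (W k j) * X k j) - (cmod (X k j))\<^sup>2 * (s j + t * r k)
      \<le> w k j * (r k)\<^sup>2 / (s j + t * r k)" if "k < n" "j < n" for k j
  proof (cases "s j + t * r k = 0")
    case True
    then have "w k j * r k = 0" using supp that by blast
    then have "W k j = 0 \<or> r k = 0" using w[OF that] by auto
    with True show ?thesis by auto
  next
    case False
    define c where "c = s j + t * r k"
    have c: "c > 0" using False r[OF that(1)] s[OF that(2)] t by (simp add: c_def less_le)
    have "0 \<le> (cmod (of_real (r k) * W k j - of_real c * X k j))\<^sup>2" by simp
    also have "\<dots> = (r k)\<^sup>2 * w k j - 2 * c * r k * Re (cnj (W k j) * X k j) + c\<^sup>2 * (cmod (X k j))\<^sup>2"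
      unfolding w[OF that] cmod_power2 by (simp add: power2_eq_square algebra_simps)
    finally have "c * (2 * r k * Re (cnj (W k j) * X k j) - (cmod (X k j))\<^sup>2 * c) \<le> w k j * (r k)\<^sup>2"
      by (simp add: algebra_simps power2_eq_square)
    then show ?thesis using c unfolding c_def[symmetric] by (simp add: field_simps)
  qed
  have WX: "(\<Sum>j<n. cnj (W k j) * X k j) = (\<Sum>i<n. complex_of_real (x i * (cmod (\<alpha> $$ (k,i)))\<^sup>2))" for k
    unfolding W_def X_def unitary_rows_inner[OF \<beta>]
    by (intro sum.cong refl) (simp add: mult_cnj_cmod mult_ac)
  have XXj: "(\<Sum>j<n. (cmod (X k j))\<^sup>2) = (\<Sum>i<n. (x i)\<^sup>2 * (cmod (\<alpha> $$ (k,i)))\<^sup>2)" for k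
    unfolding X_def unitary_rows_norm[OF \<beta>] by (simp add: norm_mult power_mult_distrib)
  have XXk: "(\<Sum>k<n. (cmod (X k j))\<^sup>2) = (\<Sum>i<n. (x i)\<^sup>2 * (cmod (\<beta> $$ (i,j)))\<^sup>2)" if "j < n" for j
  proof -
    have "cmod (X k j) = cmod (\<Sum>i<n. (complex_of_real (x i) * cnj (\<beta> $$ (i,j))) * dag \<alpha> $$ (i,k))" if "k < n" for k
    proof -
      have "cnj (X k j) = (\<Sum>i<n. (complex_of_real (x i) * cnj (\<beta> $$ (i,j))) * dag \<alpha> $$ (i,k))"
        using that ac by (auto simp: X_def cnj_sum intro!: sum.cong)
      then show ?thesis by (metis complex_mod_cnj)
    qed
    then have "(\<Sum>k<n. (cmod (X k j))\<^sup>2)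
        = (\<Sum>k<n. (cmod (\<Sum>i<n. (complex_of_real (x i) * cnj (\<beta> $$ (i,j))) * dag \<alpha> $$ (i,k)))\<^sup>2)" by simp
    also have "\<dots> = (\<Sum>i<n. (x i)\<^sup>2 * (cmod (\<beta> $$ (i,j)))\<^sup>2)"
      unfolding unitary_rows_norm[OF unitary_mat_dag[OF \<alpha>]] by (simp add: norm_mult power_mult_distrib)
    finally show ?thesis .
  qed
  have "(\<Sum>k<n. \<Sum>j<n. 2 * r k * Re (cnj (W k j) * X k j) - (cmod (X k j))\<^sup>2 * (s j + t * r k))
      \<le> (\<Sum>k<n. \<Sum>j<n. w k j * (r k)\<^sup>2 / (s j + t * r k))"
    using pointwise by (intro sum_mono) auto
  moreover have "(\<Sum>k<n. \<Sum>j<n. 2 * r k * Re (cnj (W k j) * X k j) - (cmod (X k j))\<^sup>2 * (s j + t * r k))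
    = (\<Sum>i<n. 2 * p i * x i - q i * (x i)\<^sup>2 - t * p i * (x i)\<^sup>2)"
  proof -
    have "(\<Sum>k<n. \<Sum>j<n. 2 * r k * Re (cnj (W k j) * X k j) - (cmod (X k j))\<^sup>2 * (s j + t * r k))
      = (\<Sum>k<n. 2 * r k * Re (\<Sum>j<n. cnj (W k j) * X k j)) - (\<Sum>j<n. s j * (\<Sum>k<n. (cmod (X k j))\<^sup>2))
        - (\<Sum>k<n. t * r k * (\<Sum>j<n. (cmod (X k j))\<^sup>2))"
    proof -
      have "(\<Sum>j<n. s j * (\<Sum>k<n. (cmod (X k j))\<^sup>2)) = (\<Sum>k<n. \<Sum>j<n. s j * (cmod (X k j))\<^sup>2)"
        by (simp only: sum_distrib_left, rule sum.swap)
      then show ?thesis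
        by (simp only: sum_subtractf[symmetric] Re_sum sum_distrib_left)
          (intro sum.cong refl, simp add: sum_subtractf[symmetric] algebra_simps)
    qed
    also have "\<dots> = (\<Sum>k<n. 2 * r k * (\<Sum>i<n. x i * (cmod (\<alpha> $$ (k,i)))\<^sup>2)) - (\<Sum>j<n. s j * (\<Sum>i<n. (x i)\<^sup>2 * (cmod (\<beta> $$ (i,j)))\<^sup>2))
        - (\<Sum>k<n. t * r k * (\<Sum>i<n. (x i)\<^sup>2 * (cmod (\<alpha> $$ (k,i)))\<^sup>2))"
      using WX XXj XXk by simp
    also have "\<dots> = (\<Sum>i<n. 2 * p i * x i) - (\<Sum>i<n. q i * (x i)\<^sup>2) - (\<Sum>i<n. t * p i * (x i)\<^sup>2)"
    proof -
      have "(\<Sum>k<n. 2 * r k * (\<Sum>i<n. x i * (cmod (\<alpha> $$ (k,i)))\<^sup>2)) = (\<Sum>i<n. 2 * p i * x i)"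
        unfolding p_def by (simp only: sum_distrib_left sum_distrib_right, subst sum.swap) (simp add: mult_ac)
      moreover have "(\<Sum>j<n. s j * (\<Sum>i<n. (x i)\<^sup>2 * (cmod (\<beta> $$ (i,j)))\<^sup>2)) = (\<Sum>i<n. q i * (x i)\<^sup>2)"
        unfolding q_def by (simp only: sum_distrib_left sum_distrib_right, subst sum.swap) (simp add: mult_ac)
      moreover have "(\<Sum>k<n. t * r k * (\<Sum>i<n. (x i)\<^sup>2 * (cmod (\<alpha> $$ (k,i)))\<^sup>2)) = (\<Sum>i<n. t * p i * (x i)\<^sup>2)"
        unfolding p_def by (simp only: sum_distrib_left sum_distrib_right, subst sum.swap) (simp add: mult_ac)
      ultimately show ?thesis by simp
    qed
    finally show ?thesis by (simp add: sum_subtractf)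
  qed
  ultimately show ?thesis by simp
qed

lemma sum_cmod_unitary:
  assumes "unitary_mat n U"
  shows "i < n \<Longrightarrow> (\<Sum>k<n. (cmod (U $$ (i,k)))\<^sup>2) = 1" "j < n \<Longrightarrow> (\<Sum>k<n. (cmod (U $$ (k,j)))\<^sup>2) = 1"
proof -
  assume i: "i < n"
  have "complex_of_real (\<Sum>k<n. (cmod (U $$ (i,k)))\<^sup>2) = 1"
    using unitary_rows[OF assms i i] by (simp add: complex_norm_square[symmetric])
  then show "(\<Sum>k<n. (cmod (U $$ (i,k)))\<^sup>2) = 1" using of_real_eq_1_iff by blast
next
  assume j: "j < n"
  have "complex_of_real (\<Sum>k<n. (cmod (U $$ (k,j)))\<^sup>2) = 1"
    using unitary_cols[OF assms j j] by (simp add: complex_norm_square[symmetric] mult.commute)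
  then show "(\<Sum>k<n. (cmod (U $$ (k,j)))\<^sup>2) = 1" using of_real_eq_1_iff by blast
qed

text \<open>
  Here $\alpha$, $\beta$ are the basis changes from the eigenbasis of $\rho$ to the measured basis and on to the
  eigenbasis of $\sigma$.  The function
  $\varphi(t) = \mathrm{tr}\,\rho \log(\sigma + t\rho) - \sum_i p_i \log(q_i + t p_i)$, with left and right
  multiplication treated as commuting, is nondecreasing; the claim compares its value at $0$ with its limit at infinity.
\<close>

lemma measured_relative_entropy:
  fixes \<alpha> \<beta> :: "complex mat" and r s :: "nat \<Rightarrow> real"
  assumes \<alpha>: "unitary_mat n \<alpha>" and \<beta>: "unitary_mat n \<beta>"
    and r: "\<And>k. k < n \<Longrightarrow> 0 \<le> r k" and s: "\<And>j. j < n \<Longrightarrow> 0 \<le> s j"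
  defines "p \<equiv> \<lambda>i. \<Sum>k<n. r k * (cmod (\<alpha> $$ (k,i)))\<^sup>2"
  defines "q \<equiv> \<lambda>i. \<Sum>j<n. s j * (cmod (\<beta> $$ (i,j)))\<^sup>2"
  defines "w \<equiv> \<lambda>k j. (cmod ((\<alpha> * \<beta>) $$ (k,j)))\<^sup>2"
  assumes supp: "\<And>k j. k < n \<Longrightarrow> j < n \<Longrightarrow> s j = 0 \<Longrightarrow> w k j * r k = 0"
    and supq: "\<And>i. i < n \<Longrightarrow> q i = 0 \<Longrightarrow> p i = 0"
  shows "(\<Sum>k<n. \<Sum>j<n. w k j * r k * ln (s j)) - (\<Sum>i<n. p i * ln (q i))
    \<le> (\<Sum>k<n. r k * ln (r k)) - (\<Sum>i<n. p i * ln (p i))"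
proof -
  have p0: "0 \<le> p i" if "i < n" for i using r by (auto simp: p_def intro!: sum_nonneg)
  have q0: "0 \<le> q i" if "i < n" for i using s by (auto simp: q_def intro!: sum_nonneg)
  define \<phi> where "\<phi> t = (\<Sum>k<n. \<Sum>j<n. w k j * r k * ln (s j + t * r k)) - (\<Sum>i<n. p i * ln (q i + t * p i))" for t
  define \<phi>' where "\<phi>' t = (\<Sum>k<n. \<Sum>j<n. w k j * r k * (r k / (s j + t * r k))) - (\<Sum>i<n. p i * (p i / (q i + t * p i)))" for t
  \<comment> \<open>By the support hypotheses a term of nonzero weight has a positive argument under
    \<open>ln\<close>; any other term is identically zero, whatever the value of \<open>ln\<close>
    at 0.\<close>
  have der: "(\<phi> has_real_derivative \<phi>' t) (at t)" if t: "0 \<le> t" for t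
    unfolding \<phi>_def \<phi>'_def
  proof (intro DERIV_diff DERIV_sum)
    fix k j assume kj: "k \<in> {..<n}" "j \<in> {..<n}"
    show "((\<lambda>t. w k j * r k * ln (s j + t * r k)) has_real_derivative w k j * r k * (r k / (s j + t * r k))) (at t)"
    proof (cases "w k j * r k = 0")
      case False
      then have "0 < s j + t * r k" using supp[of k j] s[of j] r[of k] kj t
        by (metis add_pos_nonneg lessThan_iff less_le mult_nonneg_nonneg)
      then show ?thesis by (auto intro!: derivative_eq_intros)
    qed auto
  next
    fix i assume i: "i \<in> {..<n}"
    show "((\<lambda>t. p i * ln (q i + t * p i)) has_real_derivative p i * (p i / (q i + t * p i))) (at t)"
    proof (cases "p i = 0")
      case False
      then have "0 < q i + t * p i" using supq[of i] q0[of i] p0[of i] i t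
        by (metis add_pos_nonneg lessThan_iff less_le mult_nonneg_nonneg)
      then show ?thesis by (auto intro!: derivative_eq_intros)
    qed simp
  qed
  \<comment> \<open>The subtracted sum in \<open>\<phi>'\<close> is the value of the quadratic form
    at its maximiser x_i = p_i / (q_i + t p_i), so \<open>quadratic_form_resolvent\<close> is
    invoked at this point.\<close>
  have pos: "0 \<le> \<phi>' t" if t: "0 \<le> t" for t
  proof -
    have "(\<Sum>i<n. p i * (p i / (q i + t * p i)))
        = (\<Sum>i<n. 2 * p i * (p i / (q i + t * p i)) - q i * (p i / (q i + t * p i))\<^sup>2 - t * p i * (p i / (q i + t * p i))\<^sup>2)"
    proof (intro sum.cong refl)
      fix i assume "i \<in> {..<n}"
      show "p i * (p i / (q i + t * p i)) = 2 * p i * (p i / (q i + t * p i)) - q i * (p i / (q i + t * p i))\<^sup>2 - t * p i * (p i / (q i + t * p i))\<^sup>2"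
      proof (cases "q i + t * p i = 0")
        case False
        have "q i * (p i / (q i + t * p i))\<^sup>2 + t * p i * (p i / (q i + t * p i))\<^sup>2 = (q i + t * p i) * (p i / (q i + t * p i))\<^sup>2"
          by (simp add: distrib_right)
        also have "\<dots> = p i * (p i / (q i + t * p i))" using False by (simp add: power2_eq_square)
        finally show ?thesis by simp
      qed simp
    qed
    also have "\<dots> \<le> (\<Sum>k<n. \<Sum>j<n. w k j * (r k)\<^sup>2 / (s j + t * r k))"
      unfolding p_def q_def w_def
    proof (rule quadratic_form_resolvent[OF \<alpha> \<beta> r s t])
      fix k j assume kj: "k < n" "j < n" and z: "s j + t * r k = 0"
      then have "s j = 0" using s[of j] r[of k] t by (metis add_nonneg_eq_0_iff mult_nonneg_nonneg)
      then show "(cmod ((\<alpha> * \<beta>) $$ (k, j)))\<^sup>2 * r k = 0" using supp[OF kj] by (simp add: w_def)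
    qed
    finally show ?thesis by (simp add: \<phi>'_def power2_eq_square mult.assoc)
  qed
  have mono: "\<phi> 0 \<le> \<phi> T" if "0 \<le> T" for T
    using that der pos by (intro DERIV_nonneg_imp_nondecreasing[of 0 T \<phi>]) blast+
  have ab: "unitary_mat n (\<alpha> * \<beta>)" using \<alpha> \<beta> by (rule unitary_mat_mult)
  have wr: "(\<Sum>k<n. \<Sum>j<n. w k j * r k) = (\<Sum>k<n. r k)"
    using sum_cmod_unitary(1)[OF ab] by (simp add: sum_distrib_right[symmetric] w_def)
  have pr: "(\<Sum>i<n. p i) = (\<Sum>k<n. r k)"
  proof -
    have "(\<Sum>i<n. p i) = (\<Sum>k<n. \<Sum>i<n. r k * (cmod (\<alpha> $$ (k,i)))\<^sup>2)" unfolding p_def by (rule sum.swap)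
    also have "\<dots> = (\<Sum>k<n. r k)" using sum_cmod_unitary(1)[OF \<alpha>] by (simp add: sum_distrib_left[symmetric])
    finally show ?thesis .
  qed
  \<comment> \<open>\<open>\<psi>\<close> is \<open>\<phi>\<close> in the variable u = 1/T once
    \<open>ln T\<close> has been split off. The split terms cancel because both sums have total
    weight tr \<rho>, which makes the limit at infinity finite.\<close>
  define \<psi> where "\<psi> u = (\<Sum>k<n. \<Sum>j<n. w k j * (r k * ln (r k + s j * u))) - (\<Sum>i<n. p i * ln (p i + q i * u))" for u
  have scale: "a * ln (b + T * a) = a * ln T + a * ln (a + b * (1 / T))" if "0 \<le> a" "0 \<le> b" "0 < T" for a b T :: real
  proof (cases "a = 0")
    case False
    then have a: "0 < a" using that by simp
    have pos: "0 < a + b * (1 / T)" using a that by (intro add_pos_nonneg) auto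
    have "b + T * a = T * (a + b * (1 / T))" using that by (simp add: algebra_simps)
    then have "ln (b + T * a) = ln T + ln (a + b * (1 / T))" using pos that by (simp add: ln_mult)
    then show ?thesis by (simp add: distrib_left)
  qed simp
  have \<phi>\<psi>: "\<phi> T = \<psi> (1 / T)" if T: "0 < T" for T
  proof -
    have "(\<Sum>k<n. \<Sum>j<n. w k j * r k * ln (s j + T * r k))
        = (\<Sum>k<n. \<Sum>j<n. w k j * r k * ln T + w k j * (r k * ln (r k + s j * (1 / T))))"
      using r s T by (intro sum.cong refl) (simp only: scale lessThan_iff mult.assoc distrib_left)
    also have "\<dots> = (\<Sum>k<n. r k) * ln T + (\<Sum>k<n. \<Sum>j<n. w k j * (r k * ln (r k + s j * (1 / T))))"
      by (simp only: sum.distrib wr[symmetric] sum_distrib_right)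
    finally have 1: "(\<Sum>k<n. \<Sum>j<n. w k j * r k * ln (s j + T * r k)) = \<dots>" .
    have "(\<Sum>i<n. p i * ln (q i + T * p i)) = (\<Sum>i<n. p i * ln T + p i * ln (p i + q i * (1 / T)))"
      using p0 q0 T by (intro sum.cong refl) (simp only: scale lessThan_iff)
    also have "\<dots> = (\<Sum>k<n. r k) * ln T + (\<Sum>i<n. p i * ln (p i + q i * (1 / T)))"
      by (simp only: sum.distrib sum_distrib_right[symmetric] pr)
    finally show ?thesis using 1 by (simp add: \<phi>_def \<psi>_def)
  qed
  have lim1: "((\<lambda>u. a * ln (a + b * u)) \<longlongrightarrow> a * ln a) (at_right 0)" for a b :: real
  proof (cases "a = 0")
    case False
    have "((\<lambda>u. a * ln (a + b * u)) \<longlongrightarrow> a * ln (a + b * 0)) (at_right 0)"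
      using False by (intro tendsto_intros) auto
    then show ?thesis by simp
  qed simp
  have "(\<psi> \<longlongrightarrow> (\<Sum>k<n. \<Sum>j<n. w k j * (r k * ln (r k))) - (\<Sum>i<n. p i * ln (p i))) (at_right 0)"
    unfolding \<psi>_def by (intro tendsto_diff tendsto_sum tendsto_mult_left lim1)
  moreover have "(\<Sum>k<n. \<Sum>j<n. w k j * (r k * ln (r k))) = (\<Sum>k<n. r k * ln (r k))"
    using sum_cmod_unitary(1)[OF ab] by (simp add: sum_distrib_right[symmetric] w_def)
  ultimately have lim: "(\<psi> \<longlongrightarrow> (\<Sum>k<n. r k * ln (r k)) - (\<Sum>i<n. p i * ln (p i))) (at_right 0)" by simp
  have "eventually (\<lambda>u. \<phi> 0 \<le> \<psi> u) (at_right 0)"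
    using eventually_at_right_less[of 0]
  proof eventually_elim
    case (elim u)
    then show ?case using mono[of "1 / u"] \<phi>\<psi>[of "1 / u"] by simp
  qed
  then have "\<phi> 0 \<le> (\<Sum>k<n. r k * ln (r k)) - (\<Sum>i<n. p i * ln (p i))"
    by (intro tendsto_lowerbound[OF lim]) auto
  then show ?thesis by (simp add: \<phi>_def)
qed

section \<open>Eigenvalues and diagonal entries of positive matrices\<close>

lemma gram_entry:
  "i < dim_row B \<Longrightarrow> (B * dag B) $$ (i,i) = complex_of_real (\<Sum>j<dim_col B. (cmod (B $$ (i,j)))\<^sup>2)"
  by (simp add: scalar_prod_def atLeast0LessThan mult_cnj_cmod)

lemma diag_conj_entry:
  assumes a: "\<alpha> \<in> carrier_mat n n" and i: "i < n"
  shows "(dag \<alpha> * diag_real n r * \<alpha>) $$ (i,i) = complex_of_real (\<Sum>k<n. r k * (cmod (\<alpha> $$ (k,i)))\<^sup>2)"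
proof -
  have e: "(dag \<alpha> * diag_real n r) $$ (i,k) = cnj (\<alpha> $$ (k,i)) * complex_of_real (r k)" if "k < n" for k
  proof -
    have "(dag \<alpha> * diag_real n r) $$ (i,k) = (\<Sum>l<n. cnj (\<alpha> $$ (l,i)) * (if l = k then complex_of_real (r l) else 0))"
      using a i that by (simp add: scalar_prod_def atLeast0LessThan diag_real_def)
    then show ?thesis using that by (simp add: if_distrib[where f="\<lambda>z. _ * z"] cong: if_cong)
  qed
  have "(dag \<alpha> * diag_real n r * \<alpha>) $$ (i,i) = (\<Sum>k<n. (dag \<alpha> * diag_real n r) $$ (i,k) * \<alpha> $$ (k,i))"
    using a i by (simp add: scalar_prod_def[of "row _ _"] atLeast0LessThan)
  also have "\<dots> = (\<Sum>k<n. complex_of_real (r k) * (\<alpha> $$ (k,i) * cnj (\<alpha> $$ (k,i))))"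
    by (intro sum.cong refl) (simp add: e)
  also have "\<dots> = complex_of_real (\<Sum>k<n. r k * (cmod (\<alpha> $$ (k,i)))\<^sup>2)" by (simp add: mult_cnj_cmod)
  finally show ?thesis .
qed

text \<open>Positivity is encoded by the factor \<open>X\<close>: in the eigenbasis the diagonal
  entries are squared row norms of \<open>dag U * X\<close>, hence nonnegative.\<close>

lemma psd_diagonalization:
  assumes X: "X \<in> carrier_mat n m" and A: "A = X * dag X"
  obtains U r where "unitary_mat n U" "A = U * diag_real n r * dag U" "\<And>k. k < n \<Longrightarrow> 0 \<le> r k"
    "vn_entropy A = (\<Sum>k<n. eta (r k))"
proof -
  have Ac: "A \<in> carrier_mat n n" and "dag A = A" using X by (auto simp: A dag_mult)
  then obtain U r where U: "unitary_mat n U" and AU: "A = U * diag_real n r * dag U"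
    using hermitian_diagonalization by blast
  have Uc: "U \<in> carrier_mat n n" using U by (rule unitary_mat_carrier)
  have "0 \<le> r k" if k: "k < n" for k
  proof -
    have "dag U * A * U = (dag U * U) * diag_real n r * (dag U * U)"
      unfolding AU using Uc by (simp add: mult_assoc_dim)
    also have "\<dots> = diag_real n r" using unitary_mat_left[OF U] by simp
    finally have 1: "dag U * A * U = diag_real n r" .
    have "dag U * A * U = (dag U * X) * dag (dag U * X)" using Uc X by (simp add: A dag_mult mult_assoc_dim)
    then have "diag_real n r $$ (k,k) = complex_of_real (\<Sum>j<dim_col (dag U * X). (cmod ((dag U * X) $$ (k,j)))\<^sup>2)"
      using 1 Uc X k by (simp only: gram_entry index_mult_mat(2) dag_dims carrier_matD)
    then have "complex_of_real (r k) = complex_of_real (\<Sum>j<dim_col (dag U * X). (cmod ((dag U * X) $$ (k,j)))\<^sup>2)"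
      using k by (simp add: diag_real_def)
    then have "r k = (\<Sum>j<dim_col (dag U * X). (cmod ((dag U * X) $$ (k,j)))\<^sup>2)" using of_real_eq_iff by blast
    then show ?thesis by (simp add: sum_nonneg)
  qed
  moreover have "vn_entropy A = (\<Sum>k<n. eta (r k))"
    unfolding AU by (simp add: vn_entropy_unitary_conj[OF U] vn_entropy_diag_real)
  ultimately show ?thesis using that U AU by blast
qed

lemma conj_diag_entry:
  assumes U: "unitary_mat n U" and M: "unitary_mat n M" and i: "i < n"
  shows "Re ((dag M * (U * diag_real n r * dag U) * M) $$ (i,i)) = (\<Sum>k<n. r k * (cmod ((dag U * M) $$ (k,i)))\<^sup>2)"
proof -
  have c: "U \<in> carrier_mat n n" "M \<in> carrier_mat n n" using U M by (auto simp: unitary_mat_def)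
  have "dag M * (U * diag_real n r * dag U) * M = dag (dag U * M) * diag_real n r * (dag U * M)"
    using c by (simp add: dag_mult mult_assoc_dim)
  moreover have "dag U * M \<in> carrier_mat n n" using c by (intro carrier_matI) auto
  ultimately show ?thesis using i by (simp only: diag_conj_entry Re_complex_of_real)
qed

text \<open>The diagonal in the basis \<open>M\<close> is the image of the spectrum under the doubly
  stochastic matrix of squared moduli of \<open>dag U * M\<close>. Equality of entropies leaves no
  Frobenius weight outside that diagonal.\<close>

lemma vn_entropy_le_diagonal:
  assumes X: "X \<in> carrier_mat n m" and A: "A = X * dag X" and M: "unitary_mat n M"
  shows "vn_entropy A \<le> (\<Sum>i<n. eta (Re ((dag M * A * M) $$ (i,i))))"
    and "vn_entropy A = (\<Sum>i<n. eta (Re ((dag M * A * M) $$ (i,i)))) \<Longrightarrow>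
      (\<Sum>i<n. (Re ((dag M * A * M) $$ (i,i)))\<^sup>2) = (\<Sum>i<n. \<Sum>j<n. (cmod (A $$ (i,j)))\<^sup>2)"
proof -
  obtain U r where U: "unitary_mat n U" and AU: "A = U * diag_real n r * dag U"
    and r: "\<And>k. k < n \<Longrightarrow> 0 \<le> r k" and vn: "vn_entropy A = (\<Sum>k<n. eta (r k))"
    using psd_diagonalization[OF X A] by metis
  have Uc: "U \<in> carrier_mat n n" using U by (rule unitary_mat_carrier)
  have UM: "unitary_mat n (dag U * M)" using unitary_mat_mult[OF unitary_mat_dag[OF U] M] .
  have p: "Re ((dag M * A * M) $$ (i,i)) = (\<Sum>k<n. (cmod ((dag U * M) $$ (k,i)))\<^sup>2 * r k)" if "i < n" for i
    unfolding AU conj_diag_entry[OF U M that] by (simp add: mult.commute)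
  note ds = doubly_stochastic_entropy[of n "\<lambda>i k. (cmod ((dag U * M) $$ (k,i)))\<^sup>2" r "\<lambda>i. Re ((dag M * A * M) $$ (i,i))",
      OF zero_le_power2 sum_cmod_unitary(2)[OF UM] sum_cmod_unitary(1)[OF UM] r p]
  show "vn_entropy A \<le> (\<Sum>i<n. eta (Re ((dag M * A * M) $$ (i,i))))" unfolding vn by (rule ds(1))
  \<comment> \<open>The squared Frobenius norm is the trace of \<open>A * dag A\<close>. This
    product equals \<open>Y * dag Y\<close>, since the inner unitaries cancel, and the entries of
    \<open>Y\<close> are explicit.\<close>
  have fro: "(\<Sum>i<n. \<Sum>j<n. (cmod (A $$ (i,j)))\<^sup>2) = (\<Sum>k<n. (r k)\<^sup>2)"
  proof -
    define Y where "Y = U * diag_real n r"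
    have Yc: "Y \<in> carrier_mat n n" using Uc by (simp add: Y_def)
    have Y: "Y $$ (i,k) = U $$ (i,k) * complex_of_real (r k)" if "i < n" "k < n" for i k
    proof -
      have "Y $$ (i,k) = (\<Sum>l<n. U $$ (i,l) * (if l = k then complex_of_real (r l) else 0))"
        using Uc that by (simp add: Y_def scalar_prod_def atLeast0LessThan diag_real_def)
      then show ?thesis using that by (simp add: if_distrib[where f="\<lambda>z. _ * z"] cong: if_cong)
    qed
    have Ac: "A \<in> carrier_mat n n" unfolding AU using Uc by (intro carrier_matI) auto
    have "A * dag A = Y * (dag U * U) * dag Y"
      unfolding AU Y_def using Uc by (simp add: dag_mult mult_assoc_dim)
    also have "\<dots> = Y * dag Y" using unitary_mat_left[OF U] Yc by simp
    finally have AY: "A * dag A = Y * dag Y" .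
    have "(\<Sum>j<n. (cmod (A $$ (i,j)))\<^sup>2) = (\<Sum>k<n. (cmod (U $$ (i,k)))\<^sup>2 * (r k)\<^sup>2)" if i: "i < n" for i
    proof -
      have "complex_of_real (\<Sum>j<n. (cmod (A $$ (i,j)))\<^sup>2) = complex_of_real (\<Sum>j<n. (cmod (Y $$ (i,j)))\<^sup>2)"
        using gram_entry[of i A] gram_entry[of i Y] AY Ac Yc i by simp
      then have "(\<Sum>j<n. (cmod (A $$ (i,j)))\<^sup>2) = (\<Sum>j<n. (cmod (Y $$ (i,j)))\<^sup>2)" using of_real_eq_iff by blast
      also have "\<dots> = (\<Sum>k<n. (cmod (U $$ (i,k)))\<^sup>2 * (r k)\<^sup>2)"
        using i by (intro sum.cong refl) (simp add: Y norm_mult power_mult_distrib)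
      finally show ?thesis .
    qed
    then have "(\<Sum>i<n. \<Sum>j<n. (cmod (A $$ (i,j)))\<^sup>2) = (\<Sum>i<n. \<Sum>k<n. (cmod (U $$ (i,k)))\<^sup>2 * (r k)\<^sup>2)" by simp
    also have "\<dots> = (\<Sum>k<n. (\<Sum>i<n. (cmod (U $$ (i,k)))\<^sup>2) * (r k)\<^sup>2)"
      by (simp only: sum_distrib_right, rule sum.swap)
    also have "\<dots> = (\<Sum>k<n. (r k)\<^sup>2)" using sum_cmod_unitary(2)[OF U] by simp
    finally show ?thesis .
  qed
  assume eq: "vn_entropy A = (\<Sum>i<n. eta (Re ((dag M * A * M) $$ (i,i))))"
  show "(\<Sum>i<n. (Re ((dag M * A * M) $$ (i,i)))\<^sup>2) = (\<Sum>i<n. \<Sum>j<n. (cmod (A $$ (i,j)))\<^sup>2)"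
    unfolding fro by (intro ds(2)) (simp_all only: eq[unfolded vn])
qed

text \<open>
  Adding the relative entropies of $\rho$ and $Z \rho Z^*$ with respect to their average $\sigma$ avoids having to
  choose an eigenbasis of $\sigma$ compatible with $Z$.
\<close>

lemma pinching_entropy_gain:
  assumes X: "X \<in> carrier_mat n m" and \<rho>: "\<rho> = X * dag X" and Z: "unitary_mat n Z"
    and Y: "Y \<in> carrier_mat n m'" and \<sigma>: "\<sigma> = Y * dag Y"
    and \<sigma>\<rho>: "\<sigma> = (1/2) \<cdot>\<^sub>m (\<rho> + Z * \<rho> * dag Z)" and M: "unitary_mat n M"
  defines "p \<equiv> \<lambda>i. Re ((dag M * \<rho> * M) $$ (i,i))"
  defines "p' \<equiv> \<lambda>i. Re ((dag M * (Z * \<rho> * dag Z) * M) $$ (i,i))"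
  shows "(\<Sum>i<n. eta ((p i + p' i) / 2)) - (\<Sum>i<n. eta (p i) + eta (p' i)) / 2 \<le> vn_entropy \<sigma> - vn_entropy \<rho>"
proof -
  obtain U r where U: "unitary_mat n U" and rU: "\<rho> = U * diag_real n r * dag U"
    and r: "\<And>k. k < n \<Longrightarrow> 0 \<le> r k" and vr: "vn_entropy \<rho> = (\<Sum>k<n. eta (r k))"
    using psd_diagonalization[OF X \<rho>] by metis
  obtain V s where V: "unitary_mat n V" and sV: "\<sigma> = V * diag_real n s * dag V"
    and s: "\<And>k. k < n \<Longrightarrow> 0 \<le> s k" and vs: "vn_entropy \<sigma> = (\<Sum>k<n. eta (s k))"
    using psd_diagonalization[OF Y \<sigma>] by metis
  have c: "U \<in> carrier_mat n n" "V \<in> carrier_mat n n" "M \<in> carrier_mat n n" "Z \<in> carrier_mat n n" "\<rho> \<in> carrier_mat n n"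
    using U V M Z X by (auto simp: unitary_mat_def \<rho>)
  \<comment> \<open>Conjugation by \<open>Z\<close> keeps the spectrum \<open>r\<close> and turns
    the eigenbasis \<open>U\<close> into \<open>Z * U\<close>, so both states are handled by the
    same inequality.\<close>
  have zr: "Z * \<rho> * dag Z = (Z * U) * diag_real n r * dag (Z * U)"
    unfolding rU using c by (simp add: dag_mult mult_assoc_dim)
  have ZU: "unitary_mat n (Z * U)" using unitary_mat_mult[OF Z U] .
  have half: "Re ((dag N * \<sigma> * N) $$ (i,i)) = (Re ((dag N * \<rho> * N) $$ (i,i)) + Re ((dag N * (Z * \<rho> * dag Z) * N) $$ (i,i))) / 2"
    if N: "unitary_mat n N" and i: "i < n" for N i
  proof -
    have Nc: "N \<in> carrier_mat n n" using N by (rule unitary_mat_carrier)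
    let ?R = "Z * \<rho> * dag Z"
    have Rc: "?R \<in> carrier_mat n n" using c by (intro carrier_matI) auto
    have "dag N * \<sigma> * N = (1/2) \<cdot>\<^sub>m (dag N * \<rho> * N + dag N * ?R * N)"
    proof -
      have "dag N * \<sigma> = (1/2) \<cdot>\<^sub>m (dag N * (\<rho> + ?R))"
        unfolding \<sigma>\<rho> using Nc Rc c by (intro mult_smult_distrib[of _ n n _ n]) auto
      also have "dag N * (\<rho> + ?R) = dag N * \<rho> + dag N * ?R"
        using Nc Rc c by (intro mult_add_distrib_mat[of _ n n _ n]) auto
      finally have e: "dag N * \<sigma> = (1/2) \<cdot>\<^sub>m (dag N * \<rho> + dag N * ?R)" .
      have S: "dag N * \<rho> + dag N * ?R \<in> carrier_mat n n" using Nc Rc by (intro carrier_matI) auto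
      have "dag N * \<sigma> * N = (1/2) \<cdot>\<^sub>m ((dag N * \<rho> + dag N * ?R) * N)"
        unfolding e by (rule mult_smult_assoc_mat[OF S Nc])
      also have "(dag N * \<rho> + dag N * ?R) * N = dag N * \<rho> * N + dag N * ?R * N"
        by (rule add_mult_distrib_mat[OF _ _ Nc]; intro carrier_matI; use Nc Rc c in simp)
      finally show ?thesis .
    qed
    then show ?thesis using Nc Rc c i by simp
  qed
  \<comment> \<open>\<open>a\<close> and \<open>a'\<close> are the diagonals of \<rho> and of its
    conjugate in the eigenbasis of \<sigma>; their mean is the spectrum \<open>s\<close>, although
    neither state need be diagonal there.\<close>
  define a where "a j = (\<Sum>k<n. r k * (cmod ((dag U * V) $$ (k,j)))\<^sup>2)" for j
  define a' where "a' j = (\<Sum>k<n. r k * (cmod ((dag (Z * U) * V) $$ (k,j)))\<^sup>2)" for j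
  have sj: "s j = (a j + a' j) / 2" if j: "j < n" for j
  proof -
    have "dag V * \<sigma> * V = (dag V * V) * diag_real n s * (dag V * V)"
      unfolding sV using c by (simp add: mult_assoc_dim)
    then have "dag V * \<sigma> * V = diag_real n s" using unitary_mat_left[OF V] by simp
    then have "s j = Re ((dag V * \<sigma> * V) $$ (j,j))" using j by (simp add: diag_real_def)
    also have "\<dots> = (a j + a' j) / 2"
      unfolding half[OF V j] zr unfolding rU conj_diag_entry[OF U V j] conj_diag_entry[OF ZU V j] a_def a'_def ..
    finally show ?thesis .
  qed
  have a0: "0 \<le> a j" "0 \<le> a' j" for j using r by (auto simp: a_def a'_def intro!: sum_nonneg)
  have pe: "p i = (\<Sum>k<n. r k * (cmod ((dag U * M) $$ (k,i)))\<^sup>2)" if "i < n" for i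
    unfolding p_def rU using conj_diag_entry[OF U M that] .
  have p'e: "p' i = (\<Sum>k<n. r k * (cmod ((dag (Z * U) * M) $$ (k,i)))\<^sup>2)" if "i < n" for i
    unfolding p'_def zr using conj_diag_entry[OF ZU M that] .
  define q where "q i = (p i + p' i) / 2" for i
  have MVc: "dag M * V \<in> carrier_mat n n" using c by (intro carrier_matI) auto
  have qe: "q i = (\<Sum>j<n. s j * (cmod ((dag M * V) $$ (i,j)))\<^sup>2)" if i: "i < n" for i
  proof -
    have "q i = Re ((dag M * \<sigma> * M) $$ (i,i))" using half[OF M i] by (simp add: q_def p_def p'_def)
    also have "\<dots> = (\<Sum>k<n. s k * (cmod ((dag V * M) $$ (k,i)))\<^sup>2)" unfolding sV by (rule conj_diag_entry[OF V M i])
    also have "\<dots> = (\<Sum>j<n. s j * (cmod ((dag M * V) $$ (i,j)))\<^sup>2)"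
    proof (intro sum.cong refl)
      fix k assume k: "k \<in> {..<n}"
      have "dag V * M = dag (dag M * V)" using c by (simp add: dag_mult)
      then have "(dag V * M) $$ (k,i) = cnj ((dag M * V) $$ (i,k))" using MVc k i by (simp only: dag_index carrier_matD lessThan_iff)
      then show "s k * (cmod ((dag V * M) $$ (k,i)))\<^sup>2 = s k * (cmod ((dag M * V) $$ (i,k)))\<^sup>2" by simp
    qed
    finally show ?thesis .
  qed
  have p0: "0 \<le> p i" "0 \<le> p' i" if "i < n" for i using r that by (auto simp: pe p'e intro!: sum_nonneg)
  \<comment> \<open>Data processing relative to \<sigma> for the state with eigenbasis
    \<open>T\<close>, taken as \<open>U\<close> and as \<open>Z * U\<close>. Both states are at most
    twice their average, which yields the support conditions.\<close>
  have core: "(\<Sum>j<n. (\<Sum>k<n. r k * (cmod ((dag T * V) $$ (k,j)))\<^sup>2) * ln (s j)) - (\<Sum>i<n. P i * ln (q i))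
    \<le> (\<Sum>k<n. r k * ln (r k)) - (\<Sum>i<n. P i * ln (P i))"
    if T: "unitary_mat n T" and P: "\<And>i. i < n \<Longrightarrow> P i = (\<Sum>k<n. r k * (cmod ((dag T * M) $$ (k,i)))\<^sup>2)"
      and sb: "\<And>j. j < n \<Longrightarrow> (\<Sum>k<n. r k * (cmod ((dag T * V) $$ (k,j)))\<^sup>2) \<le> 2 * s j"
      and qb: "\<And>i. i < n \<Longrightarrow> P i \<le> 2 * q i" for T P
  proof -
    have Tc: "T \<in> carrier_mat n n" using T by (rule unitary_mat_carrier)
    have TM: "unitary_mat n (dag T * M)" and MV: "unitary_mat n (dag M * V)"
      using unitary_mat_mult unitary_mat_dag T M V by blast+
    have "dag T * M * (dag M * V) = dag T * (M * dag M) * V" using Tc c by (simp add: mult_assoc_dim)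
    then have pr: "dag T * M * (dag M * V) = dag T * V" using unitary_mat_right[OF M] Tc c by simp
    have P0: "0 \<le> P i" if "i < n" for i using r that by (auto simp: P intro!: sum_nonneg)
    have "(\<Sum>k<n. \<Sum>j<n. (cmod ((dag T * M * (dag M * V)) $$ (k,j)))\<^sup>2 * r k * ln (s j))
        - (\<Sum>i<n. (\<Sum>k<n. r k * (cmod ((dag T * M) $$ (k,i)))\<^sup>2) * ln (\<Sum>j<n. s j * (cmod ((dag M * V) $$ (i,j)))\<^sup>2))
      \<le> (\<Sum>k<n. r k * ln (r k)) - (\<Sum>i<n. (\<Sum>k<n. r k * (cmod ((dag T * M) $$ (k,i)))\<^sup>2) * ln (\<Sum>k<n. r k * (cmod ((dag T * M) $$ (k,i)))\<^sup>2))"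
    proof (rule measured_relative_entropy[OF TM MV r s])
      fix k j assume kj: "k < n" "j < n" and z: "s j = 0"
      have "(\<Sum>k<n. r k * (cmod ((dag T * V) $$ (k,j)))\<^sup>2) = 0"
        using sb[OF kj(2)] z r by (intro antisym sum_nonneg) auto
      then have "r k * (cmod ((dag T * V) $$ (k,j)))\<^sup>2 = 0"
        using r kj by (subst (asm) sum_nonneg_eq_0_iff) auto
      then show "(cmod ((dag T * M * (dag M * V)) $$ (k, j)))\<^sup>2 * r k = 0" unfolding pr by (simp add: mult.commute)
    next
      fix i assume i: "i < n" and z: "(\<Sum>j<n. s j * (cmod ((dag M * V) $$ (i,j)))\<^sup>2) = 0"
      then have "q i = 0" using qe by simp
      then have "P i = 0" using qb[OF i] P0[OF i] by simp
      then show "(\<Sum>k<n. r k * (cmod ((dag T * M) $$ (k,i)))\<^sup>2) = 0" using P[OF i] by simp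
    qed
    moreover have "(\<Sum>k<n. \<Sum>j<n. (cmod ((dag T * V) $$ (k,j)))\<^sup>2 * r k * ln (s j))
      = (\<Sum>j<n. (\<Sum>k<n. r k * (cmod ((dag T * V) $$ (k,j)))\<^sup>2) * ln (s j))"
      by (subst sum.swap) (simp add: sum_distrib_left sum_distrib_right mult_ac)
    ultimately show ?thesis unfolding pr using P qe by simp
  qed
  have sa: "a j \<le> 2 * s j" "a' j \<le> 2 * s j" if "j < n" for j using sj[OF that] a0[of j] by simp_all
  have qa: "p i \<le> 2 * q i" "p' i \<le> 2 * q i" if "i < n" for i using p0[OF that] by (simp_all add: q_def)
  have 1: "(\<Sum>j<n. a j * ln (s j)) - (\<Sum>i<n. p i * ln (q i)) \<le> (\<Sum>k<n. r k * ln (r k)) - (\<Sum>i<n. p i * ln (p i))"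
    unfolding a_def
    by (rule core[OF U pe]) (simp_all add: a_def[symmetric] sa qa)
  have 2: "(\<Sum>j<n. a' j * ln (s j)) - (\<Sum>i<n. p' i * ln (q i)) \<le> (\<Sum>k<n. r k * ln (r k)) - (\<Sum>i<n. p' i * ln (p' i))"
    unfolding a'_def
    by (rule core[OF ZU p'e]) (simp_all add: a'_def[symmetric] sa qa)
  have "(\<Sum>j<n. a j * ln (s j)) + (\<Sum>j<n. a' j * ln (s j)) = 2 * (\<Sum>j<n. s j * ln (s j))"
  proof -
    have "(a j + a' j) * ln (s j) = 2 * (s j * ln (s j))" if "j < n" for j
    proof -
      have "a j + a' j = 2 * s j" using sj[OF that] by simp
      then show ?thesis by (simp only: mult.assoc)
    qed
    then have "(\<Sum>j<n. (a j + a' j) * ln (s j)) = (\<Sum>j<n. 2 * (s j * ln (s j)))" by (intro sum.cong) auto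
    then show ?thesis by (simp only: distrib_right sum.distrib sum_distrib_left)
  qed
  moreover have "(\<Sum>i<n. p i * ln (q i)) + (\<Sum>i<n. p' i * ln (q i)) = 2 * (\<Sum>i<n. q i * ln (q i))"
  proof -
    have "(p i + p' i) * ln (q i) = 2 * (q i * ln (q i))" for i
    proof -
      have "p i + p' i = 2 * q i" by (simp add: q_def)
      then show ?thesis by (simp only: mult.assoc)
    qed
    then have "(\<Sum>i<n. (p i + p' i) * ln (q i)) = (\<Sum>i<n. 2 * (q i * ln (q i)))" by (intro sum.cong refl)
    then show ?thesis by (simp only: distrib_right sum.distrib sum_distrib_left)
  qed
  \<comment> \<open>On adding the two inequalities, \<open>a + a' = 2 s\<close> and
    \<open>p + p' = 2 q\<close> turn the cross terms into the entropies of \<sigma> and of its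
    measured distribution.\<close>
  ultimately have 3: "2 * (\<Sum>j<n. s j * ln (s j)) - 2 * (\<Sum>i<n. q i * ln (q i))
    \<le> 2 * (\<Sum>k<n. r k * ln (r k)) - (\<Sum>i<n. p i * ln (p i)) - (\<Sum>i<n. p' i * ln (p' i))"
    using 1 2 by linarith
  have et: "(\<Sum>i<n. x i * ln (x i)) = - ln 2 * (\<Sum>i<n. eta (x i))" for x :: "nat \<Rightarrow> real"
    by (simp add: eta_def log_def sum_distrib_left sum_negf)
  have gen: "L * (q - (a + b) / 2) \<le> L * (s - r)" if "2 * (- L * s) - 2 * (- L * q) \<le> 2 * (- L * r) - - L * a - - L * b"
    for L a b q r s :: real using that by (simp add: field_simps)
  have "ln 2 * ((\<Sum>i<n. eta (q i)) - (\<Sum>i<n. eta (p i) + eta (p' i)) / 2) \<le> ln 2 * ((\<Sum>k<n. eta (s k)) - (\<Sum>k<n. eta (r k)))"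
    using gen[OF 3[unfolded et]] by (simp only: sum.distrib)
  then show ?thesis unfolding vr vs q_def by (simp add: mult_le_cancel_left)
qed

section \<open>Kraus operators and the Choi state\<close>

lemma sum_lessThan_2: "(\<Sum>i<2. f i) = f 0 + f (Suc 0)"
  by (simp add: numeral_2_eq_2)

lemma sum_lessThan_4: "(\<Sum>i<4. f i) = f 0 + f (Suc 0) + f 2 + f 3"
proof -
  have "{..<4::nat} = {0, Suc 0, 2, 3}" by auto
  then show ?thesis by (simp add: add.assoc)
qed

lemma mult_mat_entry_2:
  assumes "dim_col A = 2" "dim_row B = 2" "i < dim_row A" "j < dim_col B"
  shows "(A * B) $$ (i,j) = A $$ (i,0) * B $$ (0,j) + A $$ (i,Suc 0) * B $$ (Suc 0,j)"
proof -
  have "(A * B) $$ (i,j) = (\<Sum>k<2. A $$ (i,k) * B $$ (k,j))"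
    using assms by (simp add: scalar_prod_def atLeast0LessThan)
  then show ?thesis by (simp only: sum_lessThan_2)
qed

lemma mtrace_2: "M \<in> carrier_mat 2 2 \<Longrightarrow> mtrace M = M $$ (0,0) + M $$ (Suc 0,Suc 0)"
  by (simp add: mtrace_def sum_lessThan_2)

definition matrix_unit :: "nat \<Rightarrow> nat \<Rightarrow> complex mat" where
  "matrix_unit x y = mat 2 2 (\<lambda>(i,j). if i = x \<and> j = y then 1 else 0)"

lemma matrix_unit_carrier [simp]: "matrix_unit x y \<in> carrier_mat 2 2"
  by (simp add: matrix_unit_def)

lemma proj_z_matrix_unit: "proj_z x = matrix_unit x x"
  by (simp add: proj_z_def matrix_unit_def)

text \<open>Trace preservation is imposed on \<open>F\<close> rather than as a completeness relation
  on the operators, and the operator sum is stated entrywise to avoid indexed sums of matrices. As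
  in \<open>stinespring\<close>, values of \<open>F\<close> outside the 2 by 2 matrices are left
  free.\<close>

definition kraus :: "(complex mat \<Rightarrow> complex mat) \<Rightarrow> nat \<Rightarrow> (nat \<Rightarrow> complex mat) \<Rightarrow> bool" where
  "kraus F d K \<longleftrightarrow> 0 < d \<and> (\<forall>k<d. K k \<in> carrier_mat 2 2) \<and>
     (\<forall>\<rho>\<in>carrier_mat 2 2. F \<rho> \<in> carrier_mat 2 2 \<and> mtrace (F \<rho>) = mtrace \<rho> \<and>
        (\<forall>i<2. \<forall>j<2. F \<rho> $$ (i,j) = (\<Sum>k<d. (K k * \<rho> * dag (K k)) $$ (i,j))))"

lemma conj_entry_2:
  assumes "A \<in> carrier_mat n 2" "R \<in> carrier_mat 2 2" "B \<in> carrier_mat m 2" "i < n" "j < m"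
  shows "(A * R * dag B) $$ (i,j) = (\<Sum>x<2. \<Sum>y<2. A $$ (i,x) * R $$ (x,y) * cnj (B $$ (j,y)))"
proof -
  have "(A * R * dag B) $$ (i,j) = (A * R) $$ (i,0) * dag B $$ (0,j) + (A * R) $$ (i,Suc 0) * dag B $$ (Suc 0,j)"
    using assms by (intro mult_mat_entry_2) auto
  also have "(A * R) $$ (i,0) = A $$ (i,0) * R $$ (0,0) + A $$ (i,Suc 0) * R $$ (Suc 0,0)"
    using assms by (intro mult_mat_entry_2) auto
  also have "(A * R) $$ (i,Suc 0) = A $$ (i,0) * R $$ (0,Suc 0) + A $$ (i,Suc 0) * R $$ (Suc 0,Suc 0)"
    using assms by (intro mult_mat_entry_2) auto
  finally show ?thesis using assms by (simp add: sum_lessThan_2 algebra_simps)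
qed

lemma block_index: "(i::nat) < 2 \<Longrightarrow> k < d \<Longrightarrow> i * d + k < 2 * d"
  by (auto simp: less_2_cases_iff)

lemma dilation_entry:
  assumes V: "V \<in> carrier_mat (2*d) 2" and K: "K k \<in> carrier_mat 2 2" and \<rho>: "\<rho> \<in> carrier_mat 2 2"
    and VK: "\<And>i x. i < 2 \<Longrightarrow> x < 2 \<Longrightarrow> V $$ (i*d+k,x) = K k $$ (i,x)" and ij: "i < 2" "j < 2" and k: "k < d"
  shows "(V * \<rho> * dag V) $$ (i*d+k, j*d+k) = (K k * \<rho> * dag (K k)) $$ (i,j)"
  unfolding conj_entry_2[OF V \<rho> V block_index[OF ij(1) k] block_index[OF ij(2) k]] conj_entry_2[OF K \<rho> K ij]
  using ij by (intro sum.cong refl) (simp add: VK)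

lemma sum_blocks: "(\<Sum>a<2*d. f a) = (\<Sum>i<2. \<Sum>k<d. f (i*d+k))" for d :: nat
proof -
  have "(\<Sum>a\<in>{i*d..<i*d+d}. f a) = (\<Sum>k<d. f (i*d+k))" for i
    using sum.shift_bounds_nat_ivl[of f 0 "i*d" d] by (simp add: atLeast0LessThan add.commute)
  then show ?thesis using sum.nat_group[of f d 2] by simp
qed

text \<open>Row \<open>i * d + k\<close> of \<open>V\<close> carries output \<open>i\<close> and
  environment state \<open>k\<close>, so fixing \<open>k\<close> cuts out one Kraus operator. The
  isometry property gives trace preservation.\<close>

lemma stinespring_kraus:
  assumes "stinespring F d V"
  shows "kraus F d (\<lambda>k. mat 2 2 (\<lambda>(i,x). V $$ (i * d + k, x)))"
proof -
  have d: "0 < d" and V: "V \<in> carrier_mat (2*d) 2" and iso: "dag V * V = 1\<^sub>m 2"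
    and F: "\<And>\<rho>. \<rho> \<in> carrier_mat 2 2 \<Longrightarrow> F \<rho> = ptrace_env d (V * \<rho> * dag V)"
    using assms by (auto simp: stinespring_def)
  define K where "K k = mat 2 2 (\<lambda>(i,x). V $$ (i * d + k, x))" for k
  have e: "F \<rho> $$ (i,j) = (\<Sum>k<d. (K k * \<rho> * dag (K k)) $$ (i,j))"
    if \<rho>: "\<rho> \<in> carrier_mat 2 2" and ij: "i < 2" "j < 2" for \<rho> i j
  proof -
    have "F \<rho> $$ (i,j) = (\<Sum>k<d. (V * \<rho> * dag V) $$ (i*d+k, j*d+k))"
      using ij F[OF \<rho>] by (simp add: ptrace_env_def)
    also have "\<dots> = (\<Sum>k<d. (K k * \<rho> * dag (K k)) $$ (i,j))"
      using V \<rho> ij by (intro sum.cong refl dilation_entry) (auto simp: K_def)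
    finally show ?thesis .
  qed
  have Fc: "F \<rho> \<in> carrier_mat 2 2" if "\<rho> \<in> carrier_mat 2 2" for \<rho>
    using F[OF that] by (simp add: ptrace_env_def)
  have isoe: "(\<Sum>i<2. \<Sum>k<d. cnj (V $$ (i*d+k,x)) * V $$ (i*d+k,y)) = (if x = y then 1 else 0)"
    if xy: "x < 2" "y < 2" for x y
  proof -
    have "(dag V * V) $$ (x,y) = (\<Sum>a<2*d. cnj (V $$ (a,x)) * V $$ (a,y))"
      using V xy by (simp add: scalar_prod_def atLeast0LessThan)
    also have "\<dots> = (\<Sum>i<2. \<Sum>k<d. cnj (V $$ (i*d+k,x)) * V $$ (i*d+k,y))" by (rule sum_blocks)
    finally show ?thesis using iso xy by simp
  qed
  have tr: "mtrace (F \<rho>) = mtrace \<rho>" if \<rho>: "\<rho> \<in> carrier_mat 2 2" for \<rho>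
  proof -
    have "mtrace (F \<rho>) = (\<Sum>i<2. F \<rho> $$ (i,i))" using Fc[OF \<rho>] by (simp add: mtrace_def)
    also have "\<dots> = (\<Sum>i<2. \<Sum>k<d. \<Sum>x<2. \<Sum>y<2. K k $$ (i,x) * \<rho> $$ (x,y) * cnj (K k $$ (i,y)))"
    proof (rule sum.cong[OF refl])
      fix i assume i: "i \<in> {..<(2::nat)}"
      then have "F \<rho> $$ (i,i) = (\<Sum>k<d. (K k * \<rho> * dag (K k)) $$ (i,i))" using e[OF \<rho>] by simp
      also have "\<dots> = (\<Sum>k<d. \<Sum>x<2. \<Sum>y<2. K k $$ (i,x) * \<rho> $$ (x,y) * cnj (K k $$ (i,y)))"
        using i \<rho> by (intro sum.cong refl conj_entry_2[of _ 2 _ _ 2]) (auto simp: K_def)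
      finally show "F \<rho> $$ (i,i) = \<dots>" .
    qed
    also have "\<dots> = (\<Sum>x<2. \<Sum>y<2. \<rho> $$ (x,y) * (\<Sum>i<2. \<Sum>k<d. cnj (V $$ (i*d+k,y)) * V $$ (i*d+k,x)))"
      by (simp add: sum_lessThan_2 K_def sum.distrib sum_distrib_left algebra_simps)
    also have "\<dots> = (\<Sum>x<2. \<Sum>y<2. \<rho> $$ (x,y) * (if y = x then 1 else 0))"
      by (intro sum.cong refl) (simp only: isoe lessThan_iff)
    also have "\<dots> = mtrace \<rho>" using \<rho> by (simp add: sum_lessThan_2 mtrace_2)
    finally show ?thesis .
  qed
  show ?thesis using d e Fc tr unfolding kraus_def K_def[symmetric] by (auto simp: K_def)
qed

text \<open>The slices are stacked back into \<open>V\<close>. The isometry is recovered by testing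
  trace preservation on matrix units: entry (x,y) of \<open>dag V * V\<close> is the trace of
  \<open>F (matrix_unit y x)\<close>.\<close>

lemma kraus_stinespring:
  assumes k: "kraus F d K"
  shows "stinespring F d (mat (2*d) 2 (\<lambda>(a,x). K (a mod d) $$ (a div d, x)))"
proof -
  define V where "V = mat (2*d) 2 (\<lambda>(a,x). K (a mod d) $$ (a div d, x))"
  have d: "0 < d" and K: "\<And>k. k < d \<Longrightarrow> K k \<in> carrier_mat 2 2"
    and Fc: "\<And>\<rho>. \<rho> \<in> carrier_mat 2 2 \<Longrightarrow> F \<rho> \<in> carrier_mat 2 2"
    and tr: "\<And>\<rho>. \<rho> \<in> carrier_mat 2 2 \<Longrightarrow> mtrace (F \<rho>) = mtrace \<rho>"
    and e: "\<And>\<rho> i j. \<rho> \<in> carrier_mat 2 2 \<Longrightarrow> i < 2 \<Longrightarrow> j < 2 \<Longrightarrow> F \<rho> $$ (i,j) = (\<Sum>k<d. (K k * \<rho> * dag (K k)) $$ (i,j))"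
    using k by (auto simp: kraus_def)
  have V: "V \<in> carrier_mat (2*d) 2" by (simp add: V_def)
  have Ve: "V $$ (i*d+k,x) = K k $$ (i,x)" if "i < 2" "k < d" "x < 2" for i k x
    using that block_index[of i k d] by (simp add: V_def)
  have F: "F \<rho> = ptrace_env d (V * \<rho> * dag V)" if \<rho>: "\<rho> \<in> carrier_mat 2 2" for \<rho>
  proof (rule eq_matI)
    fix i j assume "i < dim_row (ptrace_env d (V * \<rho> * dag V))" "j < dim_col (ptrace_env d (V * \<rho> * dag V))"
    then have ij: "i < 2" "j < 2" by (auto simp: ptrace_env_def)
    have "F \<rho> $$ (i,j) = (\<Sum>k<d. (V * \<rho> * dag V) $$ (i*d+k, j*d+k))"
      unfolding e[OF \<rho> ij] using V K \<rho> ij Ve by (intro sum.cong refl dilation_entry[symmetric]) auto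
    then show "F \<rho> $$ (i,j) = ptrace_env d (V * \<rho> * dag V) $$ (i,j)" using ij by (simp add: ptrace_env_def)
  qed (use Fc[OF \<rho>] in \<open>auto simp: ptrace_env_def\<close>)
  have "dag V * V = 1\<^sub>m 2"
  proof (rule eq_matI)
    fix x y assume "x < dim_row (1\<^sub>m 2)" "y < dim_col (1\<^sub>m 2)"
    then have xy: "x < 2" "y < 2" by auto
    have "(dag V * V) $$ (x,y) = (\<Sum>a<2*d. cnj (V $$ (a,x)) * V $$ (a,y))"
      using V xy by (simp add: scalar_prod_def atLeast0LessThan)
    also have "\<dots> = (\<Sum>i<2. \<Sum>k<d. cnj (V $$ (i*d+k,x)) * V $$ (i*d+k,y))" by (rule sum_blocks)
    also have "\<dots> = (\<Sum>i<2. \<Sum>k<d. cnj (K k $$ (i,x)) * K k $$ (i,y))"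
      using xy by (intro sum.cong refl) (simp add: Ve)
    also have "\<dots> = (\<Sum>i<2. F (matrix_unit y x) $$ (i,i))"
    proof (rule sum.cong[OF refl])
      fix i assume i: "i \<in> {..<(2::nat)}"
      have "F (matrix_unit y x) $$ (i,i) = (\<Sum>k<d. \<Sum>x'<2. \<Sum>y'<2. K k $$ (i,x') * matrix_unit y x $$ (x',y') * cnj (K k $$ (i,y')))"
        unfolding e[OF matrix_unit_carrier i[unfolded lessThan_iff] i[unfolded lessThan_iff]]
        using i K by (intro sum.cong refl conj_entry_2[of _ 2 _ _ 2]) auto
      also have "\<dots> = (\<Sum>k<d. cnj (K k $$ (i,x)) * K k $$ (i,y))"
        using xy by (intro sum.cong refl) (auto simp: sum_lessThan_2 matrix_unit_def less_2_cases_iff)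
      finally show "(\<Sum>k<d. cnj (K k $$ (i,x)) * K k $$ (i,y)) = F (matrix_unit y x) $$ (i,i)" by simp
    qed
    also have "\<dots> = mtrace (F (matrix_unit y x))" using Fc[of "matrix_unit y x"] by (simp add: mtrace_def)
    also have "\<dots> = (1\<^sub>m 2) $$ (x,y)" using xy by (auto simp: tr mtrace_2 matrix_unit_def less_2_cases_iff)
    finally show "(dag V * V) $$ (x,y) = (1\<^sub>m 2) $$ (x,y)" .
  qed (use V in auto)
  then show ?thesis using d V F unfolding V_def[symmetric] stinespring_def by auto
qed

lemma qubit_channel_iff_kraus: "qubit_channel F \<longleftrightarrow> (\<exists>d K. kraus F d K)"
  unfolding qubit_channel_def using stinespring_kraus kraus_stinespring by blast

text \<open>Row and column index $2x + i$ stands for input $x$ and output $i$.\<close>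

definition choi :: "(complex mat \<Rightarrow> complex mat) \<Rightarrow> complex mat" where
  "choi F = mat 4 4 (\<lambda>(a,b). F (matrix_unit (a div 2) (b div 2)) $$ (a mod 2, b mod 2) / 2)"

definition pinched_choi :: "(complex mat \<Rightarrow> complex mat) \<Rightarrow> complex mat" where
  "pinched_choi F = mat 4 4 (\<lambda>(a,b). if a div 2 = b div 2 then choi F $$ (a,b) else 0)"

lemma kraus_tensor:
  assumes "kraus F d K" "x < 2" "y < 2" "i < 2" "j < 2"
  shows "F (matrix_unit x y) $$ (i,j) = (\<Sum>k<d. K k $$ (i,x) * cnj (K k $$ (j,y)))"
proof -
  have K: "\<And>k. k < d \<Longrightarrow> K k \<in> carrier_mat 2 2" using assms(1) by (auto simp: kraus_def)
  have "F (matrix_unit x y) $$ (i,j) = (\<Sum>k<d. (K k * matrix_unit x y * dag (K k)) $$ (i,j))"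
    using assms by (simp add: kraus_def)
  also have "\<dots> = (\<Sum>k<d. \<Sum>x'<2. \<Sum>y'<2. K k $$ (i,x') * matrix_unit x y $$ (x',y') * cnj (K k $$ (j,y')))"
    using assms K by (intro sum.cong refl conj_entry_2[of _ 2 _ _ 2]) auto
  also have "\<dots> = (\<Sum>k<d. K k $$ (i,x) * cnj (K k $$ (j,y)))"
    using assms(2,3) by (intro sum.cong refl) (auto simp: sum_lessThan_2 matrix_unit_def less_2_cases_iff)
  finally show ?thesis .
qed

text \<open>The columns are the vectorised Kraus operators; the factor 1/sqrt 2 comes from the
  normalised maximally entangled input.\<close>

definition kraus_cols :: "nat \<Rightarrow> (nat \<Rightarrow> complex mat) \<Rightarrow> complex mat" where
  "kraus_cols d K = mat 4 d (\<lambda>(a,k). K k $$ (a mod 2, a div 2) / complex_of_real (sqrt 2))"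

lemma sqrt2_sqrt2: "complex_of_real (sqrt 2) * complex_of_real (sqrt 2) = 2"
  by (metis of_real_mult of_real_numeral real_sqrt_mult_self abs_numeral)

lemma choi_gram:
  assumes "kraus F d K"
  shows "choi F = kraus_cols d K * dag (kraus_cols d K)"
proof (rule eq_matI)
  fix a b assume "a < dim_row (kraus_cols d K * dag (kraus_cols d K))" "b < dim_col (kraus_cols d K * dag (kraus_cols d K))"
  then have ab: "a < 4" "b < 4" by (auto simp: kraus_cols_def)
  then have "a div 2 < 2" "b div 2 < 2" by auto
  then show "choi F $$ (a,b) = (kraus_cols d K * dag (kraus_cols d K)) $$ (a,b)"
    using ab kraus_tensor[OF assms, of "a div 2" "b div 2" "a mod 2" "b mod 2"]
    by (simp add: choi_def kraus_cols_def scalar_prod_def atLeast0LessThan sqrt2_sqrt2 sum_divide_distrib)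
qed (auto simp: choi_def kraus_cols_def)

text \<open>The matrix on the right is the environment state for the maximally mixed input. It is
  the transpose of \<open>dag X * X\<close> for the same \<open>X\<close> whose
  \<open>X * dag X\<close> is the Choi matrix, so the choice of dilation does not affect its
  entropy.\<close>

lemma vn_entropy_choi:
  assumes "kraus F d K"
  shows "vn_entropy (choi F) = vn_entropy (mat d d (\<lambda>(k,l). mtrace (K k * dag (K l)) / 2))"
proof -
  have K: "\<And>k. k < d \<Longrightarrow> K k \<in> carrier_mat 2 2" using assms by (auto simp: kraus_def)
  let ?X = "kraus_cols d K"
  have X: "?X \<in> carrier_mat 4 d" by (simp add: kraus_cols_def)
  have "mat d d (\<lambda>(k,l). mtrace (K k * dag (K l)) / 2) = transpose_mat (dag ?X * ?X)"
  proof (rule eq_matI)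
    fix k l assume "k < dim_row (transpose_mat (dag ?X * ?X))" "l < dim_col (transpose_mat (dag ?X * ?X))"
    then have kl: "k < d" "l < d" by (auto simp: kraus_cols_def)
    have c: "K k * dag (K l) \<in> carrier_mat 2 2" using K[OF kl(1)] K[OF kl(2)] by (intro carrier_matI) auto
    have "transpose_mat (dag ?X * ?X) $$ (k,l) = (\<Sum>a<4. cnj (?X $$ (a,l)) * ?X $$ (a,k))"
      using kl X by (simp add: scalar_prod_def atLeast0LessThan)
    also have "\<dots> = (\<Sum>a<4. cnj (K l $$ (a mod 2, a div 2)) * K k $$ (a mod 2, a div 2)) / 2"
      using kl by (simp add: kraus_cols_def sqrt2_sqrt2 sum_divide_distrib)
    also have "\<dots> = mtrace (K k * dag (K l)) / 2"
      using K[OF kl(1)] K[OF kl(2)] by (simp add: mtrace_2[OF c] mult_mat_entry_2 sum_lessThan_4 algebra_simps del: index_mult_mat)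
    finally show "mat d d (\<lambda>(k,l). mtrace (K k * dag (K l)) / 2) $$ (k,l) = transpose_mat (dag ?X * ?X) $$ (k,l)"
      using kl by simp
  qed (auto simp: kraus_cols_def)
  moreover have "vn_entropy (transpose_mat (dag ?X * ?X)) = vn_entropy (dag ?X * ?X)"
    using X by (intro vn_entropy_transpose[of _ d]) (auto intro: carrier_matI)
  ultimately show ?thesis
    using vn_entropy_mult_swap[of ?X 4 d "dag ?X"] X choi_gram[OF assms] by simp
qed

text \<open>Vectorisations of the Kraus operators restricted to one input basis state. The column
  index is \<open>x * d + k\<close>, matching the block structure of the classical-quantum state of
  X and E.\<close>

definition kraus_blocks :: "nat \<Rightarrow> (nat \<Rightarrow> complex mat) \<Rightarrow> complex mat" where
  "kraus_blocks d K = mat 4 (2*d) (\<lambda>(a,l). if l div d = a div 2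
     then K (l mod d) $$ (a mod 2, a div 2) / complex_of_real (sqrt 2) else 0)"

lemma pinched_choi_gram:
  assumes k: "kraus F d K"
  shows "pinched_choi F = kraus_blocks d K * dag (kraus_blocks d K)"
proof (rule eq_matI)
  have d: "0 < d" using k by (simp add: kraus_def)
  let ?Y = "kraus_blocks d K"
  fix a b assume "a < dim_row (?Y * dag ?Y)" "b < dim_col (?Y * dag ?Y)"
  then have ab: "a < 4" "b < 4" by (auto simp: kraus_blocks_def)
  then have ab2: "a div 2 < 2" "b div 2 < 2" by auto
  have "(?Y * dag ?Y) $$ (a,b) = (\<Sum>l<2*d. ?Y $$ (a,l) * cnj (?Y $$ (b,l)))"
    using ab by (simp add: kraus_blocks_def scalar_prod_def atLeast0LessThan)
  also have "\<dots> = (\<Sum>x<2. \<Sum>k<d. ?Y $$ (a,x*d+k) * cnj (?Y $$ (b,x*d+k)))" by (rule sum_blocks)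
  also have "\<dots> = (\<Sum>x<2. \<Sum>k<d. if x = a div 2 \<and> x = b div 2 then K k $$ (a mod 2, x) * cnj (K k $$ (b mod 2, x)) / 2 else 0)"
  proof (intro sum.cong refl)
    fix x k assume "x \<in> {..<(2::nat)}" "k \<in> {..<d}"
    then show "?Y $$ (a,x*d+k) * cnj (?Y $$ (b,x*d+k)) = (if x = a div 2 \<and> x = b div 2 then K k $$ (a mod 2, x) * cnj (K k $$ (b mod 2, x)) / 2 else 0)"
      using ab block_index[of x k d] by (auto simp: kraus_blocks_def sqrt2_sqrt2)
  qed
  also have "\<dots> = (if a div 2 = b div 2 then (\<Sum>k<d. K k $$ (a mod 2, a div 2) * cnj (K k $$ (b mod 2, b div 2))) / 2 else 0)"
    using ab2 by (auto simp: sum_lessThan_2 less_2_cases_iff sum_divide_distrib)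
  also have "\<dots> = pinched_choi F $$ (a,b)"
    using ab ab2 kraus_tensor[OF k, of "a div 2" "b div 2" "a mod 2" "b mod 2"]
    by (cases "a div 2 = b div 2") (simp_all add: pinched_choi_def choi_def)
  finally show "pinched_choi F $$ (a,b) = (?Y * dag ?Y) $$ (a,b)" by simp
qed (auto simp: pinched_choi_def kraus_blocks_def)

text \<open>\<open>SOME\<close> picks an unspecified dilation, but \<rho>_E and \<rho>_XE are
  transposes of the reversed Gram products of \<open>kraus_cols\<close> and
  \<open>kraus_blocks\<close>, so both entropies are fixed by \<open>F\<close>.\<close>

lemma H_XE_eq:
  assumes "qubit_channel F"
  shows "H_XE F = vn_entropy (pinched_choi F) - vn_entropy (choi F)"
proof -
  obtain d V where dV: "(SOME (d, V). stinespring F d V) = (d, V)" by (cases "SOME (d, V). stinespring F d V") auto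
  have "\<exists>p. case p of (d, V) \<Rightarrow> stinespring F d V" using assms by (auto simp: qubit_channel_def)
  from someI_ex[OF this] have st: "stinespring F d V" using dV by simp
  have V: "V \<in> carrier_mat (2*d) 2" and d: "0 < d" using st by (auto simp: stinespring_def)
  define K where "K k = mat 2 2 (\<lambda>(i,x). V $$ (i * d + k, x))" for k
  have k: "kraus F d K" unfolding K_def by (rule stinespring_kraus[OF st])
  have env: "env_channel F = (\<lambda>\<rho>. ptrace_sys d (V * \<rho> * dag V))" by (simp add: env_channel_def dV)
  define FE where "FE x = env_channel F (proj_z x)" for x
  have FEc: "FE x \<in> carrier_mat d d" for x by (simp add: FE_def env ptrace_sys_def)
  have FEe: "FE x $$ (k,l) = K k $$ (0,x) * cnj (K l $$ (0,x)) + K k $$ (Suc 0,x) * cnj (K l $$ (Suc 0,x))"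
    if "k < d" "l < d" "x < 2" for x k l
  proof -
    have "(V * proj_z x * dag V) $$ (i*d+k, i*d+l) = K k $$ (i,x) * cnj (K l $$ (i,x))" if i: "i < 2" for i
    proof -
      have "(V * proj_z x * dag V) $$ (i*d+k, i*d+l) = (\<Sum>x'<2. \<Sum>y'<2. V $$ (i*d+k,x') * proj_z x $$ (x',y') * cnj (V $$ (i*d+l,y')))"
        using V i \<open>k < d\<close> \<open>l < d\<close> by (intro conj_entry_2[of _ "2*d" _ _ "2*d"] block_index) (auto simp: proj_z_def)
      also have "\<dots> = K k $$ (i,x) * cnj (K l $$ (i,x))"
        using i \<open>x < 2\<close> by (auto simp: sum_lessThan_2 proj_z_def K_def less_2_cases_iff)
      finally show ?thesis .
    qed
    from this[of 0] this[of "Suc 0"] show ?thesis using that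
      by (simp add: FE_def env ptrace_sys_def sum_lessThan_2)
  qed
  have Kc: "K k \<in> carrier_mat 2 2" for k by (simp add: K_def)
  define \<rho>E where "\<rho>E = (1/2) \<cdot>\<^sub>m FE 0 + (1/2) \<cdot>\<^sub>m FE 1"
  define \<rho>XE where "\<rho>XE = (1/2) \<cdot>\<^sub>m kron (proj_z 0) (FE 0) + (1/2) \<cdot>\<^sub>m kron (proj_z 1) (FE 1)"
  have "\<rho>E = mat d d (\<lambda>(k,l). mtrace (K k * dag (K l)) / 2)"
  proof (rule eq_matI)
    fix k l assume "k < dim_row (mat d d (\<lambda>(k,l). mtrace (K k * dag (K l)) / 2))" "l < dim_col (mat d d (\<lambda>(k,l). mtrace (K k * dag (K l)) / 2))"
    then have kl: "k < d" "l < d" by auto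
    have c: "K k * dag (K l) \<in> carrier_mat 2 2" using Kc[of k] Kc[of l] by (intro carrier_matI) auto
    have "mtrace (K k * dag (K l)) = K k $$ (0,0) * cnj (K l $$ (0,0)) + K k $$ (0,Suc 0) * cnj (K l $$ (0,Suc 0))
       + (K k $$ (Suc 0,0) * cnj (K l $$ (Suc 0,0)) + K k $$ (Suc 0,Suc 0) * cnj (K l $$ (Suc 0,Suc 0)))"
      using Kc[of k] Kc[of l] by (simp add: mtrace_2[OF c] mult_mat_entry_2 del: index_mult_mat)
    then show "\<rho>E $$ (k,l) = mat d d (\<lambda>(k,l). mtrace (K k * dag (K l)) / 2) $$ (k,l)"
      using kl FEc[of 0] FEc[of "Suc 0"] by (simp add: \<rho>E_def FEe algebra_simps add_divide_distrib)
  qed (use FEc[of 0] FEc[of "Suc 0"] in \<open>auto simp: \<rho>E_def\<close>)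
  then have 1: "vn_entropy \<rho>E = vn_entropy (choi F)" using vn_entropy_choi[OF k] by simp
  let ?Y = "kraus_blocks d K"
  have Y: "?Y \<in> carrier_mat 4 (2*d)" by (simp add: kraus_blocks_def)
  have dims: "dim_row (FE x) = d" "dim_col (FE x) = d" for x using FEc[of x] by auto
  have pdims: "dim_row (proj_z x) = 2" "dim_col (proj_z x) = 2" for x by (auto simp: proj_z_def)
  have "\<rho>XE = transpose_mat (dag ?Y * ?Y)"
  proof (rule eq_matI)
    fix l m assume "l < dim_row (transpose_mat (dag ?Y * ?Y))" "m < dim_col (transpose_mat (dag ?Y * ?Y))"
    then have lm: "l < 2*d" "m < 2*d" by (auto simp: kraus_blocks_def)
    have ld: "l div d < 2" "m div d < 2" using lm d by (auto simp: less_mult_imp_div_less)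
    have lmod: "l mod d < d" "m mod d < d" using d by auto
    have "transpose_mat (dag ?Y * ?Y) $$ (l,m) = (\<Sum>a<4. cnj (?Y $$ (a,m)) * ?Y $$ (a,l))"
      using lm Y by (simp add: scalar_prod_def atLeast0LessThan)
    also have "\<dots> = \<rho>XE $$ (l,m)"
      using ld lm lmod
      by (auto simp: sum_lessThan_4 kraus_blocks_def \<rho>XE_def kron_def dims pdims proj_z_def FEe sqrt2_sqrt2
          less_2_cases_iff algebra_simps add_divide_distrib)
    finally show "\<rho>XE $$ (l,m) = transpose_mat (dag ?Y * ?Y) $$ (l,m)" by simp
  qed (auto simp: \<rho>XE_def kron_def dims pdims kraus_blocks_def)
  moreover have "vn_entropy (transpose_mat (dag ?Y * ?Y)) = vn_entropy (dag ?Y * ?Y)"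
    using Y by (intro vn_entropy_transpose[of _ "2*d"] carrier_matI) auto
  ultimately have 2: "vn_entropy \<rho>XE = vn_entropy (pinched_choi F)"
    using vn_entropy_mult_swap[of ?Y 4 "2*d" "dag ?Y"] Y pinched_choi_gram[OF k] by simp
  show ?thesis using 1 2 unfolding H_XE_def Let_def \<rho>E_def \<rho>XE_def FE_def by simp
qed

section \<open>Channels in Stokes coordinates\<close>

lemma pauli_carrier [simp]: "pauli a \<in> carrier_mat 2 2"
  by (auto simp: pauli_def mat_of_rows_list_def)

lemma pauli_entries [simp]:
  "pauli 0 $$ (0,0) = 1" "pauli 0 $$ (0,Suc 0) = 0" "pauli 0 $$ (Suc 0,0) = 0" "pauli 0 $$ (Suc 0,Suc 0) = -1"
  "pauli (Suc 0) $$ (0,0) = 0" "pauli (Suc 0) $$ (0,Suc 0) = 1" "pauli (Suc 0) $$ (Suc 0,0) = 1" "pauli (Suc 0) $$ (Suc 0,Suc 0) = 0"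
  "pauli 2 $$ (0,0) = 0" "pauli 2 $$ (0,Suc 0) = -\<i>" "pauli 2 $$ (Suc 0,0) = \<i>" "pauli 2 $$ (Suc 0,Suc 0) = 0"
  by (simp_all add: pauli_def mat_of_rows_list_def)

lemma pauli_dims [simp]: "dim_row (pauli a) = 2" "dim_col (pauli a) = 2"
  using pauli_carrier[of a] by blast+

lemma bloch_eqs:
  assumes "M \<in> carrier_mat 2 2"
  shows "bloch M 0 = Re (M $$ (0,0)) - Re (M $$ (Suc 0,Suc 0))" (is ?p1)
    "bloch M (Suc 0) = Re (M $$ (0,Suc 0)) + Re (M $$ (Suc 0,0))" (is ?p2)
    "bloch M 2 = Im (M $$ (Suc 0,0)) - Im (M $$ (0,Suc 0))" (is ?p3)
proof -
  have c: "M * pauli a \<in> carrier_mat 2 2" for a using assms by (intro carrier_matI) auto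
  show ?p1 ?p2 ?p3
    using assms by (simp_all add: bloch_def mtrace_2[OF c] mult_mat_entry_2 del: index_mult_mat)
qed

lemma channel_carrier: "qubit_channel F \<Longrightarrow> \<rho> \<in> carrier_mat 2 2 \<Longrightarrow> F \<rho> \<in> carrier_mat 2 2"
  by (auto simp: qubit_channel_iff_kraus kraus_def)

lemma channel_mtrace: "qubit_channel F \<Longrightarrow> \<rho> \<in> carrier_mat 2 2 \<Longrightarrow> mtrace (F \<rho>) = mtrace \<rho>"
  by (auto simp: qubit_channel_iff_kraus kraus_def)

text \<open>Linearity: the type of \<open>F\<close> does not provide it, so it is recovered from the
  Kraus form.\<close>

lemma channel_entry:
  assumes F: "qubit_channel F" and \<rho>: "\<rho> \<in> carrier_mat 2 2" and ij: "i < 2" "j < 2"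
  shows "F \<rho> $$ (i,j) = \<rho> $$ (0,0) * F (matrix_unit 0 0) $$ (i,j) + \<rho> $$ (0,Suc 0) * F (matrix_unit 0 (Suc 0)) $$ (i,j)
    + \<rho> $$ (Suc 0,0) * F (matrix_unit (Suc 0) 0) $$ (i,j) + \<rho> $$ (Suc 0,Suc 0) * F (matrix_unit (Suc 0) (Suc 0)) $$ (i,j)"
proof -
  obtain d K where k: "kraus F d K" using F qubit_channel_iff_kraus by blast
  have K: "\<And>k. k < d \<Longrightarrow> K k \<in> carrier_mat 2 2" using k by (auto simp: kraus_def)
  have "F \<rho> $$ (i,j) = (\<Sum>k<d. (K k * \<rho> * dag (K k)) $$ (i,j))" using k \<rho> ij by (simp add: kraus_def)
  also have "\<dots> = (\<Sum>k<d. \<Sum>x<2. \<Sum>y<2. K k $$ (i,x) * \<rho> $$ (x,y) * cnj (K k $$ (j,y)))"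
    using \<rho> ij K by (intro sum.cong refl conj_entry_2[of _ 2 _ _ 2]) auto
  also have "\<dots> = (\<Sum>x<2. \<Sum>y<2. \<rho> $$ (x,y) * (\<Sum>k<d. K k $$ (i,x) * cnj (K k $$ (j,y))))"
    by (simp add: sum_lessThan_2 sum.distrib sum_distrib_left algebra_simps)
  also have "\<dots> = (\<Sum>x<2. \<Sum>y<2. \<rho> $$ (x,y) * F (matrix_unit x y) $$ (i,j))"
    using ij by (intro sum.cong refl) (simp add: kraus_tensor[OF k])
  finally show ?thesis by (simp add: sum_lessThan_2)
qed

lemma channel_hermitian:
  assumes F: "qubit_channel F" and "x < 2" "y < 2" "i < 2" "j < 2"
  shows "F (matrix_unit x y) $$ (i,j) = cnj (F (matrix_unit y x) $$ (j,i))"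
proof -
  obtain d K where k: "kraus F d K" using F qubit_channel_iff_kraus by blast
  show ?thesis using assms by (simp add: kraus_tensor[OF k] cnj_sum mult.commute)
qed

text \<open>Hermiticity, trace preservation and the definitions of the Bloch coordinates form a
  linear system that determines all sixteen entries. Claims about Choi matrices thereby become
  computations in Stokes parameters.\<close>

lemma channel_tensor:
  assumes F: "qubit_channel F"
  defines "t \<equiv> stokes_t F" and "R \<equiv> \<lambda>a b. stokes_R F $$ (a,b)"
  shows
    "F (matrix_unit 0 0) $$ (0,0) = Complex ((1 + t 0 + R 0 0) / 2) 0" (is ?p1)
    "F (matrix_unit 0 0) $$ (0,Suc 0) = Complex ((t (Suc 0) + R (Suc 0) 0) / 2) (- (t 2 + R 2 0) / 2)" (is ?p2)
    "F (matrix_unit 0 0) $$ (Suc 0,0) = Complex ((t (Suc 0) + R (Suc 0) 0) / 2) ((t 2 + R 2 0) / 2)" (is ?p3)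
    "F (matrix_unit 0 0) $$ (Suc 0,Suc 0) = Complex ((1 - t 0 - R 0 0) / 2) 0" (is ?p4)
    "F (matrix_unit (Suc 0) (Suc 0)) $$ (0,0) = Complex ((1 + t 0 - R 0 0) / 2) 0" (is ?p5)
    "F (matrix_unit (Suc 0) (Suc 0)) $$ (0,Suc 0) = Complex ((t (Suc 0) - R (Suc 0) 0) / 2) (- (t 2 - R 2 0) / 2)" (is ?p6)
    "F (matrix_unit (Suc 0) (Suc 0)) $$ (Suc 0,0) = Complex ((t (Suc 0) - R (Suc 0) 0) / 2) ((t 2 - R 2 0) / 2)" (is ?p7)
    "F (matrix_unit (Suc 0) (Suc 0)) $$ (Suc 0,Suc 0) = Complex ((1 - t 0 + R 0 0) / 2) 0" (is ?p8)
    "F (matrix_unit 0 (Suc 0)) $$ (0,0) = Complex (R 0 (Suc 0) / 2) (R 0 2 / 2)" (is ?p9)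
    "F (matrix_unit 0 (Suc 0)) $$ (0,Suc 0) = Complex ((R (Suc 0) (Suc 0) + R 2 2) / 2) ((R (Suc 0) 2 - R 2 (Suc 0)) / 2)" (is ?p10)
    "F (matrix_unit 0 (Suc 0)) $$ (Suc 0,0) = Complex ((R (Suc 0) (Suc 0) - R 2 2) / 2) ((R (Suc 0) 2 + R 2 (Suc 0)) / 2)" (is ?p11)
    "F (matrix_unit 0 (Suc 0)) $$ (Suc 0,Suc 0) = Complex (- R 0 (Suc 0) / 2) (- R 0 2 / 2)" (is ?p12)
    "F (matrix_unit (Suc 0) 0) $$ (0,0) = Complex (R 0 (Suc 0) / 2) (- R 0 2 / 2)" (is ?p13)
    "F (matrix_unit (Suc 0) 0) $$ (0,Suc 0) = Complex ((R (Suc 0) (Suc 0) - R 2 2) / 2) (- (R (Suc 0) 2 + R 2 (Suc 0)) / 2)" (is ?p14)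
    "F (matrix_unit (Suc 0) 0) $$ (Suc 0,0) = Complex ((R (Suc 0) (Suc 0) + R 2 2) / 2) (- (R (Suc 0) 2 - R 2 (Suc 0)) / 2)" (is ?p15)
    "F (matrix_unit (Suc 0) 0) $$ (Suc 0,Suc 0) = Complex (- R 0 (Suc 0) / 2) (R 0 2 / 2)" (is ?p16)
proof -
  define f where "f x y i j = F (matrix_unit x y) $$ (i,j)" for x y i j
  note c = channel_carrier[OF F]
  have u: "(1/2) \<cdot>\<^sub>m 1\<^sub>m 2 \<in> carrier_mat 2 2" "(1/2) \<cdot>\<^sub>m (1\<^sub>m 2 + pauli b) \<in> carrier_mat 2 2" for b
    by (auto intro!: carrier_matI)
  have e0: "F ((1/2) \<cdot>\<^sub>m 1\<^sub>m 2) $$ (i,j) = (f 0 0 i j + f (Suc 0) (Suc 0) i j) / 2" if "i < 2" "j < 2" for i j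
    using that by (simp add: channel_entry[OF F u(1)] f_def algebra_simps)
  have ez: "F ((1/2) \<cdot>\<^sub>m (1\<^sub>m 2 + pauli 0)) $$ (i,j) = f 0 0 i j" if "i < 2" "j < 2" for i j
    using that by (simp add: channel_entry[OF F u(2)] f_def algebra_simps)
  have ex: "F ((1/2) \<cdot>\<^sub>m (1\<^sub>m 2 + pauli (Suc 0))) $$ (i,j) = (f 0 0 i j + f (Suc 0) (Suc 0) i j + f 0 (Suc 0) i j + f (Suc 0) 0 i j) / 2" if "i < 2" "j < 2" for i j
    using that by (simp add: channel_entry[OF F u(2)] f_def add_divide_distrib)
  have ey: "F ((1/2) \<cdot>\<^sub>m (1\<^sub>m 2 + pauli 2)) $$ (i,j) = (f 0 0 i j + f (Suc 0) (Suc 0) i j - \<i> * f 0 (Suc 0) i j + \<i> * f (Suc 0) 0 i j) / 2" if "i < 2" "j < 2" for i j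
    using that by (simp add: channel_entry[OF F u(2)] f_def add_divide_distrib diff_divide_distrib)
  have h: "f x y i j = cnj (f y x j i)" if "x < 2" "y < 2" "i < 2" "j < 2" for x y i j
    unfolding f_def using that by (intro channel_hermitian[OF F])
  have tr: "f x y 0 0 + f x y (Suc 0) (Suc 0) = (if x = y then 1 else 0)" if "x < 2" "y < 2" for x y
  proof -
    have "f x y 0 0 + f x y (Suc 0) (Suc 0) = mtrace (F (matrix_unit x y))"
      using mtrace_2[OF c[OF matrix_unit_carrier]] by (simp add: f_def)
    also have "\<dots> = (if x = y then 1 else 0)"
      using that by (auto simp: channel_mtrace[OF F] mtrace_2 matrix_unit_def less_2_cases_iff)
    finally show ?thesis .
  qed
  have T: "t a = bloch (F ((1/2) \<cdot>\<^sub>m 1\<^sub>m 2)) a" for a by (simp add: t_def stokes_t_def)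
  have R: "R a b = bloch (F ((1/2) \<cdot>\<^sub>m (1\<^sub>m 2 + pauli b))) a - t a" if "a < 3" "b < 3" for a b
    using that by (simp add: R_def stokes_R_def t_def)
  note b0 = bloch_eqs[OF c[OF u(1)]] and b1 = bloch_eqs[OF c[OF u(2)]]
  note eqs = complex_eq_iff T R b0 b1 e0 ez ex ey
  have hs: "Im (f x x i i) = 0" if "x < 2" "i < 2" for x i
    using h[of x x i i] that by (simp add: complex_eq_iff)
  have hx: "Re (f x x (Suc 0) 0) = Re (f x x 0 (Suc 0))" "Im (f x x (Suc 0) 0) = - Im (f x x 0 (Suc 0))" if "x < 2" for x
    using h[of x x "Suc 0" 0] that by (auto simp: complex_eq_iff)
  have ho: "Re (f (Suc 0) 0 i j) = Re (f 0 (Suc 0) j i)" "Im (f (Suc 0) 0 i j) = - Im (f 0 (Suc 0) j i)" if "i < 2" "j < 2" for i j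
    using h[of "Suc 0" 0 i j] that by (auto simp: complex_eq_iff)
  have tz: "Re (f x x (Suc 0) (Suc 0)) = 1 - Re (f x x 0 0)" if "x < 2" for x
    using tr[of x x] that by (simp add: complex_eq_iff)
  have to: "Re (f 0 (Suc 0) (Suc 0) (Suc 0)) = - Re (f 0 (Suc 0) 0 0)" "Im (f 0 (Suc 0) (Suc 0) (Suc 0)) = - Im (f 0 (Suc 0) 0 0)"
    using tr[of 0 "Suc 0"] by (auto simp: complex_eq_iff)
  show
    ?p1 ?p2 ?p3 ?p4 ?p5 ?p6 ?p7 ?p8 ?p9 ?p10 ?p11 ?p12 ?p13 ?p14 ?p15 ?p16
    unfolding f_def[symmetric]
    by (simp_all add: eqs hs hx ho tz to field_simps)
qed

section \<open>Bounds on the key rate\<close>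

text \<open>The left side is \<open>eta a + a * log 2 b\<close>; apply the tangent bound at
  \<open>m * b\<close>, where \<open>m\<close> plays the role of a guessed conditional probability
  a/b.\<close>

lemma conditional_term_bound:
  fixes a b m :: real
  assumes "0 \<le> a" "a \<le> b" "0 < m"
  shows "- a * log 2 (a / b) \<le> - a * log 2 m + (m * b - a) / ln 2"
proof (cases "a = 0")
  case False
  then have a: "0 < a" and b: "0 < b" using assms by auto
  have "- a * log 2 (a / b) = eta a + a * log 2 b"
    using a b by (simp add: eta_def log_divide algebra_simps)
  also have "\<dots> \<le> - a * log 2 (m * b) + (m * b - a) / ln 2 + a * log 2 b"
    using eta_tangent(1)[of a "m * b"] a b assms(3) by simp
  also have "\<dots> = - a * log 2 m + (m * b - a) / ln 2"
    using b assms(3) by (simp add: log_mult algebra_simps)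
  finally show ?thesis .
qed (use assms in auto)

text \<open>Conditioning on Y lowers entropy, for one event: \<open>a\<close>, \<open>c\<close> are
  its joint weights with the two values of Y and \<open>b\<close>, \<open>d\<close> the marginals.
  Guessing the unconditional probability \<open>a + c\<close> makes the linear slack cancel, since
  \<open>b + d = 1\<close>.\<close>

lemma conditional_entropy_pair_bound:
  fixes a b c d :: real
  assumes "0 \<le> a" "a \<le> b" "0 \<le> c" "c \<le> d" "b + d = 1"
  shows "- a * log 2 (a / b) - c * log 2 (c / d) \<le> eta (a + c)"
proof (cases "a + c = 0")
  case True
  then have "a = 0" "c = 0" using assms by auto
  then show ?thesis by simp
next
  case False
  then have m: "0 < a + c" using assms by auto
  have "- a * log 2 (a / b) - c * log 2 (c / d)
    \<le> (- a * log 2 (a + c) + ((a + c) * b - a) / ln 2) + (- c * log 2 (a + c) + ((a + c) * d - c) / ln 2)"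
    using conditional_term_bound[OF assms(1,2) m] conditional_term_bound[OF assms(3,4) m] by simp
  also have "\<dots> = eta (a + c) + ((a + c) * (b + d) - (a + c)) / ln 2"
    by (simp add: eta_def algebra_simps add_divide_distrib diff_divide_distrib)
  also have "\<dots> = eta (a + c)" using assms(5) by simp
  finally show ?thesis .
qed

lemma binary_entropy_le_1:
  assumes "0 \<le> a" "0 \<le> b" "a + b = 1"
  shows "eta a + eta b \<le> 1"
proof -
  have l: "log 2 (1/2 :: real) = - 1" by (simp add: log_divide)
  have "eta a \<le> a + (1/2 - a) / ln 2" "eta b \<le> b + (1/2 - b) / ln 2"
    using eta_tangent(1)[of a "1/2"] eta_tangent(1)[of b "1/2"] assms by (simp_all add: l)
  then have "eta a + eta b \<le> (a + b) + (1 - (a + b)) / ln 2"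
    by (simp add: add_divide_distrib diff_divide_distrib)
  then show ?thesis using assms by simp
qed

lemma eta_half: "0 \<le> x \<Longrightarrow> eta (x / 2) = eta x / 2 + x / 2"
  by (cases "x = 0") (auto simp: eta_def log_divide algebra_simps)

lemma eta_diff_conditional: "0 \<le> a \<Longrightarrow> a \<le> b \<Longrightarrow> eta a + a * log 2 (a / b) = - a * log 2 b"
  by (cases "a = 0") (auto simp: eta_def log_divide algebra_simps)

text \<open>The inverse of the map from Pauli probabilities, in the order 1, z, x, y, to the Stokes
  diagonal: conjugation by a Pauli matrix fixes its own axis and flips the other two.\<close>

definition bell_prob :: "(nat \<Rightarrow> real) \<Rightarrow> nat \<Rightarrow> real" where
  "bell_prob \<gamma> k = (if k = 0 then 1 + \<gamma> 0 + \<gamma> (Suc 0) + \<gamma> 2 else if k = Suc 0 then 1 + \<gamma> 0 - \<gamma> (Suc 0) - \<gamma> 2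
     else if k = 2 then 1 - \<gamma> 0 + \<gamma> (Suc 0) - \<gamma> 2 else 1 - \<gamma> 0 - \<gamma> (Suc 0) + \<gamma> 2) / 4"

definition bell_entropy :: "(nat \<Rightarrow> real) \<Rightarrow> real" where
  "bell_entropy \<gamma> = (\<Sum>k<4. eta (bell_prob \<gamma> k))"

definition stokes_diag :: "(complex mat \<Rightarrow> complex mat) \<Rightarrow> nat \<Rightarrow> real" where
  "stokes_diag F j = stokes_R F $$ (j,j)"

lemma sum_upt_4: "(\<Sum>k\<in>{0..<4}. f k) = f 0 + f (Suc 0) + f 2 + f 3"
  using sum_lessThan_4[of f] by (simp add: atLeast0LessThan)

lemma less_4_cases: "(i::nat) < 4 \<longleftrightarrow> i = 0 \<or> i = Suc 0 \<or> i = 2 \<or> i = 3"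
  by auto

text \<open>Column $k$ is the normalised vectorisation of $1, \sigma_z, \sigma_x, \sigma_y$.\<close>

definition bell_basis :: "complex mat" where
  "bell_basis = mat 4 4 (\<lambda>(a,k). (if k < 2 then (if a = 0 then 1 else if a = 3 then (if k = 0 then 1 else -1) else 0)
     else (if a = 1 then (if k = 2 then 1 else \<i>) else if a = 2 then (if k = 2 then 1 else -\<i>) else 0))
     / complex_of_real (sqrt 2))"

lemma unitary_bell_basis: "unitary_mat 4 bell_basis"
  unfolding unitary_mat_def
proof
  show "dag bell_basis * bell_basis = 1\<^sub>m 4"
  proof (rule eq_matI)
    fix i j assume "i < dim_row (1\<^sub>m 4)" "j < dim_col (1\<^sub>m 4)"
    then have ij: "i < 4" "j < 4" by auto
    have "(dag bell_basis * bell_basis) $$ (i,j) = (\<Sum>a<4. cnj (bell_basis $$ (a,i)) * bell_basis $$ (a,j))"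
      using ij by (simp add: scalar_prod_def atLeast0LessThan bell_basis_def)
    also have "\<dots> = (1\<^sub>m 4) $$ (i,j)"
      using ij by (auto simp: sum_lessThan_4 bell_basis_def less_4_cases sqrt2_sqrt2)
    finally show "(dag bell_basis * bell_basis) $$ (i,j) = (1\<^sub>m 4) $$ (i,j)" .
  qed (auto simp: bell_basis_def)
qed (simp add: bell_basis_def)

lemma conj_entry_4:
  assumes "M \<in> carrier_mat 4 4" "A \<in> carrier_mat 4 4" "i < 4" "j < 4"
  shows "(dag M * A * M) $$ (i,j) = (\<Sum>b<4. (\<Sum>a<4. cnj (M $$ (a,i)) * A $$ (a,b)) * M $$ (b,j))"
proof -
  have "(N * M) $$ (i,j) = (\<Sum>b<4. N $$ (i,b) * M $$ (b,j))" if "N \<in> carrier_mat 4 4" for N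
    using that assms by (simp add: scalar_prod_def atLeast0LessThan)
  moreover have "dag M * A \<in> carrier_mat 4 4" using assms by (intro carrier_matI) auto
  ultimately have "(dag M * A * M) $$ (i,j) = (\<Sum>b<4. (dag M * A) $$ (i,b) * M $$ (b,j))" by blast
  also have "\<dots> = (\<Sum>b<4. (\<Sum>a<4. cnj (M $$ (a,i)) * A $$ (a,b)) * M $$ (b,j))"
    using assms by (intro sum.cong refl) (simp add: scalar_prod_def atLeast0LessThan)
  finally show ?thesis .
qed

lemma bell_diagonal:
  assumes A: "A \<in> carrier_mat 4 4"
  shows "(dag bell_basis * A * bell_basis) $$ (0,0) = (A $$ (0,0) + A $$ (0,3) + A $$ (3,0) + A $$ (3,3)) / 2" (is ?p1)
    "(dag bell_basis * A * bell_basis) $$ (Suc 0,Suc 0) = (A $$ (0,0) - A $$ (0,3) - A $$ (3,0) + A $$ (3,3)) / 2" (is ?p2)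
    "(dag bell_basis * A * bell_basis) $$ (2,2) = (A $$ (Suc 0,Suc 0) + A $$ (Suc 0,2) + A $$ (2,Suc 0) + A $$ (2,2)) / 2" (is ?p3)
    "(dag bell_basis * A * bell_basis) $$ (3,3) = (A $$ (Suc 0,Suc 0) - A $$ (Suc 0,2) - A $$ (2,Suc 0) + A $$ (2,2)) / 2" (is ?p4)
proof -
  have M: "bell_basis \<in> carrier_mat 4 4" by (simp add: bell_basis_def)
  have lt: "0 < (4::nat)" "Suc 0 < 4" "2 < (4::nat)" "3 < (4::nat)" by auto
  note idx = conj_entry_4[OF M A lt(1) lt(1)] conj_entry_4[OF M A lt(2) lt(2)]
    conj_entry_4[OF M A lt(3) lt(3)] conj_entry_4[OF M A lt(4) lt(4)]
  show ?p1 ?p2 ?p3 ?p4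
    unfolding idx by (simp_all add: sum_lessThan_4 bell_basis_def sqrt2_sqrt2 add_divide_distrib diff_divide_distrib algebra_simps)
qed

lemma choi_carrier [simp]: "choi F \<in> carrier_mat 4 4" "pinched_choi F \<in> carrier_mat 4 4"
  by (simp_all add: choi_def pinched_choi_def)

lemma choi_bell_diagonal:
  assumes F: "qubit_channel F" and "k < 4"
  shows "Re ((dag bell_basis * choi F * bell_basis) $$ (k,k)) = bell_prob (stokes_diag F) k"
  using assms(2) unfolding less_4_cases
  by (elim disjE; hypsubst) (simp_all add: bell_diagonal choi_def channel_tensor[OF F] bell_prob_def stokes_diag_def del: index_mult_mat, simp_all add: field_simps)

text \<open>Complete positivity: these numbers are diagonal entries of the Choi matrix in the Bell
  basis, hence squared row norms of a Gram factor.\<close>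

lemma bell_prob_nonneg:
  assumes F: "qubit_channel F" and k: "k < 4"
  shows "0 \<le> bell_prob (stokes_diag F) k"
proof -
  obtain d K where "kraus F d K" using F qubit_channel_iff_kraus by blast
  then have g: "choi F = kraus_cols d K * dag (kraus_cols d K)" by (rule choi_gram)
  have X: "kraus_cols d K \<in> carrier_mat 4 d" by (simp add: kraus_cols_def)
  have M: "bell_basis \<in> carrier_mat 4 4" by (simp add: bell_basis_def)
  let ?B = "dag bell_basis * kraus_cols d K"
  have "dag bell_basis * choi F * bell_basis = ?B * dag ?B"
    unfolding g using X M by (simp add: dag_mult mult_assoc_dim)
  moreover have "(?B * dag ?B) $$ (k,k) = complex_of_real (\<Sum>j<dim_col ?B. (cmod (?B $$ (k,j)))\<^sup>2)"
    using M k by (intro gram_entry) simp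
  ultimately have "bell_prob (stokes_diag F) k = (\<Sum>j<dim_col ?B. (cmod (?B $$ (k,j)))\<^sup>2)"
    using choi_bell_diagonal[OF F k] by (metis Re_complex_of_real)
  then show ?thesis by (simp only: sum_nonneg zero_le_power2)
qed

lemma joint_distribution:
  assumes F: "qubit_channel F"
  defines "t \<equiv> stokes_t F 0" and "z \<equiv> stokes_diag F 0"
  shows "P_XY F 0 0 = (1 + t + z) / 4" "P_XY F 0 (Suc 0) = (1 - t - z) / 4"
    "P_XY F (Suc 0) 0 = (1 + t - z) / 4" "P_XY F (Suc 0) (Suc 0) = (1 - t + z) / 4"
    "0 \<le> 1 + t + z" "0 \<le> 1 - t - z" "0 \<le> 1 + t - z" "0 \<le> 1 - t + z"
proof -
  show P: "P_XY F 0 0 = (1 + t + z) / 4" "P_XY F 0 (Suc 0) = (1 - t - z) / 4"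
    "P_XY F (Suc 0) 0 = (1 + t - z) / 4" "P_XY F (Suc 0) (Suc 0) = (1 - t + z) / 4"
    by (simp_all add: P_XY_def proj_z_matrix_unit channel_tensor[OF F] t_def z_def stokes_diag_def)
  have nn: "0 \<le> P_XY F x y" if xy: "x < 2" "y < 2" for x y
  proof -
    obtain d K where k: "kraus F d K" using F qubit_channel_iff_kraus by blast
    have "F (proj_z x) $$ (y,y) = complex_of_real (\<Sum>k<d. (cmod (K k $$ (y,x)))\<^sup>2)"
      using xy by (simp add: proj_z_matrix_unit kraus_tensor[OF k] mult_cnj_cmod)
    then show ?thesis by (simp add: P_XY_def sum_nonneg)
  qed
  show "0 \<le> 1 + t + z" "0 \<le> 1 - t - z" "0 \<le> 1 + t - z" "0 \<le> 1 - t + z"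
    using nn[of 0 0] nn[of 0 "Suc 0"] nn[of "Suc 0" 0] nn[of "Suc 0" "Suc 0"] P by simp_all
qed

lemma H_XY_expand:
  "H_XY F = - P_XY F 0 0 * log 2 (P_XY F 0 0 / (P_XY F 0 0 + P_XY F (Suc 0) 0))
    - P_XY F 0 (Suc 0) * log 2 (P_XY F 0 (Suc 0) / (P_XY F 0 (Suc 0) + P_XY F (Suc 0) (Suc 0)))
    - P_XY F (Suc 0) 0 * log 2 (P_XY F (Suc 0) 0 / (P_XY F 0 0 + P_XY F (Suc 0) 0))
    - P_XY F (Suc 0) (Suc 0) * log 2 (P_XY F (Suc 0) (Suc 0) / (P_XY F 0 (Suc 0) + P_XY F (Suc 0) (Suc 0)))"
  by (simp add: H_XY_def sum_lessThan_2)

text \<open>Given Y, the bit X is equivalent to the error bit X + Y, so H(X|Y) is at most the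
  entropy of that bit. The agreeing and disagreeing outcomes are bounded as separate events; the
  translation t drops out.\<close>

lemma H_XY_le:
  assumes F: "qubit_channel F"
  defines "z \<equiv> stokes_diag F 0"
  shows "H_XY F \<le> eta ((1 + z) / 2) + eta ((1 - z) / 2)"
proof -
  define a where "a = P_XY F 0 0"
  define b where "b = P_XY F 0 (Suc 0)"
  define c where "c = P_XY F (Suc 0) 0"
  define d where "d = P_XY F (Suc 0) (Suc 0)"
  note j = joint_distribution[OF F, folded a_def b_def c_def d_def z_def]
  have nn: "0 \<le> a" "0 \<le> b" "0 \<le> c" "0 \<le> d" using j by simp_all
  have "- a * log 2 (a / (a + c)) - d * log 2 (d / (b + d)) \<le> eta (a + d)"
    using nn j by (intro conditional_entropy_pair_bound) (simp_all add: field_simps)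
  moreover have "- b * log 2 (b / (b + d)) - c * log 2 (c / (a + c)) \<le> eta (b + c)"
    using nn j by (intro conditional_entropy_pair_bound) (simp_all add: field_simps)
  moreover have "a + d = (1 + z) / 2" "b + c = (1 - z) / 2" using j by (simp_all add: field_simps)
  ultimately show ?thesis unfolding H_XY_expand a_def[symmetric] b_def[symmetric] c_def[symmetric] d_def[symmetric]
    by simp
qed

text \<open>The chain rule H(XY) - H(X|Y) = H(Y), with the marginal of Y read off from the
  translation \<open>t\<close>.\<close>

lemma joint_minus_conditional:
  assumes F: "qubit_channel F"
  defines "t \<equiv> stokes_t F 0"
  shows "eta (P_XY F 0 0) + eta (P_XY F 0 (Suc 0)) + eta (P_XY F (Suc 0) 0) + eta (P_XY F (Suc 0) (Suc 0)) - H_XY F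
    = eta ((1 + t) / 2) + eta ((1 - t) / 2)"
proof -
  define a where "a = P_XY F 0 0"
  define b where "b = P_XY F 0 (Suc 0)"
  define c where "c = P_XY F (Suc 0) 0"
  define d where "d = P_XY F (Suc 0) (Suc 0)"
  note j = joint_distribution[OF F, folded a_def b_def c_def d_def t_def]
  have nn: "0 \<le> a" "0 \<le> b" "0 \<le> c" "0 \<le> d" using j by simp_all
  have ac: "(1 + t) / 2 = a + c" "(1 - t) / 2 = b + d" using j by (simp_all add: field_simps)
  have "eta a + eta b + eta c + eta d - H_XY F
      = - a * log 2 (a + c) - c * log 2 (a + c) - b * log 2 (b + d) - d * log 2 (b + d)"
    unfolding H_XY_expand a_def[symmetric] b_def[symmetric] c_def[symmetric] d_def[symmetric]
    using eta_diff_conditional[of a "a + c"] eta_diff_conditional[of c "a + c"]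
      eta_diff_conditional[of b "b + d"] eta_diff_conditional[of d "b + d"] nn by simp
  moreover have "eta (a + c) + eta (b + d) = - a * log 2 (a + c) - c * log 2 (a + c) - b * log 2 (b + d) - d * log 2 (b + d)"
    by (simp add: eta_def algebra_simps)
  ultimately show ?thesis unfolding a_def[symmetric] b_def[symmetric] c_def[symmetric] d_def[symmetric] ac
    by simp
qed

lemma pinched_choi_diagonal:
  "Re (pinched_choi F $$ (0,0)) = P_XY F 0 0" "Re (pinched_choi F $$ (Suc 0,Suc 0)) = P_XY F 0 (Suc 0)"
  "Re (pinched_choi F $$ (2,2)) = P_XY F (Suc 0) 0" "Re (pinched_choi F $$ (3,3)) = P_XY F (Suc 0) (Suc 0)"
  by (simp_all add: pinched_choi_def choi_def P_XY_def proj_z_matrix_unit)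

lemma unitary_mat_one: "unitary_mat n (1\<^sub>m n)"
  by (simp add: unitary_mat_def)

text \<open>Dephasing the output as well can only raise the entropy of the pinched Choi matrix, up
  to H(XY); removing H(X|Y) leaves H(Y), at most one bit. A channel is optimal when both estimates
  are tight.\<close>

theorem Kkey_upper:
  assumes F: "qubit_channel F"
  shows "Kkey F \<le> 1 - vn_entropy (choi F)"
proof -
  obtain d K where k: "kraus F d K" using F qubit_channel_iff_kraus by blast
  have Y: "kraus_blocks d K \<in> carrier_mat 4 (2*d)" by (simp add: kraus_blocks_def)
  have c: "pinched_choi F \<in> carrier_mat 4 4" by simp
  have "vn_entropy (pinched_choi F) \<le> (\<Sum>i<4. eta (Re ((dag (1\<^sub>m 4) * pinched_choi F * 1\<^sub>m 4) $$ (i,i))))"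
    by (rule vn_entropy_le_diagonal(1)[OF Y pinched_choi_gram[OF k] unitary_mat_one])
  also have "dag (1\<^sub>m 4) * pinched_choi F * 1\<^sub>m 4 = pinched_choi F"
    unfolding dag_one left_mult_one_mat[OF c] right_mult_one_mat[OF c] ..
  finally have "vn_entropy (pinched_choi F) - H_XY F \<le> eta ((1 + stokes_t F 0) / 2) + eta ((1 - stokes_t F 0) / 2)"
    using joint_minus_conditional[OF F] by (simp add: sum_lessThan_4 pinched_choi_diagonal)
  also have "\<dots> \<le> 1"
    using joint_distribution(5-8)[OF F] by (intro binary_entropy_le_1) (simp_all add: field_simps)
  finally show ?thesis by (simp add: Kkey_def H_XE_eq[OF F])
qed

text \<open>Pinching averages the Choi matrix with its conjugate by \<open>Z\<close>, the operator
  \<sigma>_z on the input, so \<open>pinching_entropy_gain\<close> bounds H(X|E) from below by the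
  gain seen in the Bell basis.\<close>

theorem Kkey_lower:
  assumes F: "qubit_channel F"
  shows "1 - bell_entropy (stokes_diag F) \<le> Kkey F"
proof -
  obtain d K where k: "kraus F d K" using F qubit_channel_iff_kraus by blast
  have X: "kraus_cols d K \<in> carrier_mat 4 d" by (simp add: kraus_cols_def)
  have Y: "kraus_blocks d K \<in> carrier_mat 4 (2*d)" by (simp add: kraus_blocks_def)
  define g where "g a = (if a < 2 then 1 else -1 :: real)" for a :: nat
  define Z where "Z = diag_real 4 g"
  have Zc: "Z \<in> carrier_mat 4 4" by (simp add: Z_def)
  have Zd: "dag Z = Z" by (rule eq_matI) (auto simp: Z_def diag_real_def)
  have Ze: "(Z * A) $$ (a,b) = g a * A $$ (a,b)" if "A \<in> carrier_mat 4 4" "a < 4" "b < 4" for A a b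
    using that unfolding less_4_cases
    by (auto simp: Z_def diag_real_def scalar_prod_def sum_upt_4)
  have Ze': "(A * Z) $$ (a,b) = g b * A $$ (a,b)" if "A \<in> carrier_mat 4 4" "a < 4" "b < 4" for A a b
    using that unfolding less_4_cases
    by (auto simp: Z_def diag_real_def scalar_prod_def sum_upt_4)
  have ZAZ: "(Z * A * dag Z) $$ (a,b) = g a * g b * A $$ (a,b)" if A: "A \<in> carrier_mat 4 4" and ab: "a < 4" "b < 4" for A a b
  proof -
    have "Z * A \<in> carrier_mat 4 4" using Zc A by (intro carrier_matI) auto
    then show ?thesis using Ze[OF A ab] Ze'[of "Z * A" a b] ab by (simp add: Zd mult_ac)
  qed
  have Zu: "unitary_mat 4 Z"
  proof -
    have "Z * Z = 1\<^sub>m 4"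
    proof (rule eq_matI)
      fix i j assume "i < dim_row (1\<^sub>m 4 :: complex mat)" "j < dim_col (1\<^sub>m 4 :: complex mat)"
      then have ij: "i < 4" "j < 4" by auto
      show "(Z * Z) $$ (i,j) = (1\<^sub>m 4) $$ (i,j)"
        unfolding Ze[OF Zc ij] using ij by (simp add: Z_def diag_real_def g_def)
    qed (use Zc in auto)
    then show ?thesis using Zc by (simp add: unitary_mat_def Zd)
  qed
  have Rc: "Z * choi F * dag Z \<in> carrier_mat 4 4" using Zc by (intro carrier_matI) (auto simp: choi_def)
  have pin: "pinched_choi F = (1/2) \<cdot>\<^sub>m (choi F + Z * choi F * dag Z)"
  proof (rule eq_matI)
    fix a b assume "a < dim_row ((1/2) \<cdot>\<^sub>m (choi F + Z * choi F * dag Z))" "b < dim_col ((1/2) \<cdot>\<^sub>m (choi F + Z * choi F * dag Z))"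
    then have ab: "a < 4" "b < 4" using Rc by auto
    have "((1/2) \<cdot>\<^sub>m (choi F + Z * choi F * dag Z)) $$ (a,b) = (choi F $$ (a,b) + g a * g b * choi F $$ (a,b)) / 2"
      using ab carrier_matD[OF Rc] ZAZ[OF choi_carrier(1) ab, of F] by (simp del: index_mult_mat)
    also have "\<dots> = pinched_choi F $$ (a,b)"
      using ab unfolding less_4_cases by (auto simp: pinched_choi_def g_def)
    finally show "pinched_choi F $$ (a,b) = ((1/2) \<cdot>\<^sub>m (choi F + Z * choi F * dag Z)) $$ (a,b)" by simp
  qed (use Rc in \<open>auto simp: pinched_choi_def\<close>)
  let ?\<gamma> = "stokes_diag F"
  define p where "p i = Re ((dag bell_basis * choi F * bell_basis) $$ (i,i))" for i
  define p' where "p' i = Re ((dag bell_basis * (Z * choi F * dag Z) * bell_basis) $$ (i,i))" for i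
  have p: "p i = bell_prob ?\<gamma> i" if "i < 4" for i unfolding p_def by (rule choi_bell_diagonal[OF F that])
  \<comment> \<open>\<open>Z\<close> exchanges the Bell vectors of 1 and \<sigma>_z, and those of
    \<sigma>_x and \<sigma>_y, up to phases.\<close>
  have p': "p' 0 = p (Suc 0)" "p' (Suc 0) = p 0" "p' 2 = p 3" "p' 3 = p 2"
    unfolding p_def p'_def bell_diagonal[OF Rc] bell_diagonal[OF choi_carrier(1)]
    by (simp_all add: ZAZ g_def del: index_mult_mat)
  have "(\<Sum>i<4. eta ((p i + p' i) / 2)) - (\<Sum>i<4. eta (p i) + eta (p' i)) / 2
      \<le> vn_entropy (pinched_choi F) - vn_entropy (choi F)"
    unfolding p_def p'_def
    by (rule pinching_entropy_gain[OF X choi_gram[OF k] Zu Y pinched_choi_gram[OF k] pin unitary_bell_basis])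
  moreover have "(\<Sum>i<4. eta (p i) + eta (p' i)) / 2 = bell_entropy ?\<gamma>"
    by (simp add: sum_lessThan_4 p' bell_entropy_def p)
  \<comment> \<open>The averaged distribution takes each of the values (1 + \<gamma>_z)/4 and (1 -
    \<gamma>_z)/4 twice. Its entropy is one bit plus exactly the binary entropy by which
    \<open>H_XY_le\<close> bounds H(X|Y).\<close>
  moreover have "(\<Sum>i<4. eta ((p i + p' i) / 2)) = 1 + eta ((1 + ?\<gamma> 0) / 2) + eta ((1 - ?\<gamma> 0) / 2)"
  proof -
    have z: "0 \<le> (1 + ?\<gamma> 0) / 2" "0 \<le> (1 - ?\<gamma> 0) / 2"
      using joint_distribution(5-8)[OF F] by (simp_all add: field_simps)
    have e: "(p 0 + p' 0) / 2 = (1 + ?\<gamma> 0) / 2 / 2" "(p (Suc 0) + p' (Suc 0)) / 2 = (1 + ?\<gamma> 0) / 2 / 2"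
      "(p 2 + p' 2) / 2 = (1 - ?\<gamma> 0) / 2 / 2" "(p 3 + p' 3) / 2 = (1 - ?\<gamma> 0) / 2 / 2"
      by (simp_all add: p' p bell_prob_def add_divide_distrib diff_divide_distrib)
    show ?thesis unfolding sum_lessThan_4 e eta_half[OF z(1)] eta_half[OF z(2)] by (simp add: field_simps)
  qed
  ultimately show ?thesis using H_XY_le[OF F] by (simp add: Kkey_def H_XE_eq[OF F])
qed

section \<open>Pauli channels and unitary compensation\<close>

definition pauli4 :: "nat \<Rightarrow> complex mat" where
  "pauli4 k = (case k of 0 \<Rightarrow> 1\<^sub>m 2 | Suc a \<Rightarrow> pauli a)"

lemma pauli4_carrier [simp]: "pauli4 k \<in> carrier_mat 2 2"
  by (simp add: pauli4_def split: nat.splits)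

lemma pauli4_dims [simp]: "dim_row (pauli4 k) = 2" "dim_col (pauli4 k) = 2"
  using pauli4_carrier[of k] by blast+

lemma pauli4_simps [simp]: "pauli4 0 = 1\<^sub>m 2" "pauli4 (Suc 0) = pauli 0" "pauli4 2 = pauli (Suc 0)" "pauli4 3 = pauli 2"
  by (simp_all add: pauli4_def numeral_2_eq_2 numeral_3_eq_3)

definition pauli_channel :: "(nat \<Rightarrow> real) \<Rightarrow> complex mat \<Rightarrow> complex mat" where
  "pauli_channel p \<rho> = mat 2 2 (\<lambda>(i,j). \<Sum>k<4. complex_of_real (p k) * (pauli4 k * \<rho> * dag (pauli4 k)) $$ (i,j))"

lemma pauli_channel_entries:
  assumes "\<rho> \<in> carrier_mat 2 2"
  shows "pauli_channel p \<rho> $$ (0,0) = complex_of_real (p 0 + p (Suc 0)) * \<rho> $$ (0,0) + complex_of_real (p 2 + p 3) * \<rho> $$ (Suc 0,Suc 0)" (is ?p1)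
    "pauli_channel p \<rho> $$ (0,Suc 0) = complex_of_real (p 0 - p (Suc 0)) * \<rho> $$ (0,Suc 0) + complex_of_real (p 2 - p 3) * \<rho> $$ (Suc 0,0)" (is ?p2)
    "pauli_channel p \<rho> $$ (Suc 0,0) = complex_of_real (p 0 - p (Suc 0)) * \<rho> $$ (Suc 0,0) + complex_of_real (p 2 - p 3) * \<rho> $$ (0,Suc 0)" (is ?p3)
    "pauli_channel p \<rho> $$ (Suc 0,Suc 0) = complex_of_real (p 0 + p (Suc 0)) * \<rho> $$ (Suc 0,Suc 0) + complex_of_real (p 2 + p 3) * \<rho> $$ (0,0)" (is ?p4)
proof -
  have e: "pauli_channel p \<rho> $$ (i,j) = (\<Sum>k<4. complex_of_real (p k) *
      (\<Sum>x<2. \<Sum>y<2. pauli4 k $$ (i,x) * \<rho> $$ (x,y) * cnj (pauli4 k $$ (j,y))))" if "i < 2" "j < 2" for i j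
  proof -
    have "(pauli4 k * \<rho> * dag (pauli4 k)) $$ (i,j) = (\<Sum>x<2. \<Sum>y<2. pauli4 k $$ (i,x) * \<rho> $$ (x,y) * cnj (pauli4 k $$ (j,y)))" for k
      using that assms by (intro conj_entry_2[of _ 2 _ _ 2]) auto
    then show ?thesis using that by (simp add: pauli_channel_def del: index_mult_mat)
  qed
  show ?p1 ?p2 ?p3 ?p4
    by (simp_all add: e sum_lessThan_4 sum_lessThan_2 algebra_simps)
qed

lemma pauli_channel_carrier [simp]: "pauli_channel p \<rho> \<in> carrier_mat 2 2"
  by (simp add: pauli_channel_def)

lemma kraus_pauli_channel:
  assumes p: "\<And>k. k < 4 \<Longrightarrow> 0 \<le> p k" and p1: "p 0 + p (Suc 0) + p 2 + p 3 = 1"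
  shows "kraus (pauli_channel p) 4 (\<lambda>k. complex_of_real (sqrt (p k)) \<cdot>\<^sub>m pauli4 k)"
  unfolding kraus_def
proof (intro conjI allI ballI impI)
  fix \<rho> :: "complex mat" assume \<rho>: "\<rho> \<in> carrier_mat 2 2"
  have "complex_of_real (p 0 + p (Suc 0)) + complex_of_real (p 2 + p 3) = 1"
    using p1 by (simp only: of_real_add[symmetric] add.assoc of_real_1)
  moreover have "a * x + b * y + (a * y + b * x) = x + y" if "a + b = 1" for a b x y :: complex
  proof -
    have "a * x + b * y + (a * y + b * x) = (a + b) * (x + y)" by (simp add: algebra_simps)
    then show ?thesis using that by simp
  qed
  ultimately show "mtrace (pauli_channel p \<rho>) = mtrace \<rho>"
    using \<rho> by (simp only: mtrace_2 pauli_channel_carrier pauli_channel_entries)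
  fix i j :: nat assume ij: "i < 2" "j < 2"
  have "(complex_of_real (sqrt (p k)) \<cdot>\<^sub>m pauli4 k * \<rho> * dag (complex_of_real (sqrt (p k)) \<cdot>\<^sub>m pauli4 k)) $$ (i,j)
    = complex_of_real (p k) * (pauli4 k * \<rho> * dag (pauli4 k)) $$ (i,j)" if "k < 4" for k
  proof -
    have s: "complex_of_real (sqrt (p k)) * complex_of_real (sqrt (p k)) = p k"
      using p[OF that] by (metis of_real_mult real_sqrt_mult_self abs_of_nonneg)
    have c: "complex_of_real (sqrt (p k)) \<cdot>\<^sub>m pauli4 k \<in> carrier_mat 2 2" by simp
    have e: "(\<Sum>x<2. \<Sum>y<2. (complex_of_real (sqrt (p k)) \<cdot>\<^sub>m pauli4 k) $$ (i,x) * \<rho> $$ (x,y) * cnj ((complex_of_real (sqrt (p k)) \<cdot>\<^sub>m pauli4 k) $$ (j,y)))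
      = (\<Sum>x<2. \<Sum>y<2. (complex_of_real (sqrt (p k)) * complex_of_real (sqrt (p k))) * (pauli4 k $$ (i,x) * \<rho> $$ (x,y) * cnj (pauli4 k $$ (j,y))))"
      using ij by (intro sum.cong refl) simp
    show ?thesis
      unfolding conj_entry_2[OF c \<rho> c ij] conj_entry_2[OF pauli4_carrier \<rho> pauli4_carrier ij] e s
      by (simp only: sum_distrib_left)
  qed
  then show "pauli_channel p \<rho> $$ (i,j) = (\<Sum>k<4. (complex_of_real (sqrt (p k)) \<cdot>\<^sub>m pauli4 k * \<rho> * dag (complex_of_real (sqrt (p k)) \<cdot>\<^sub>m pauli4 k)) $$ (i,j))"
    using ij by (simp add: pauli_channel_def del: index_mult_mat)
qed auto

lemma stokes_diag_pauli_channel: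
  assumes "j < 3"
  shows "stokes_diag (pauli_channel (bell_prob \<gamma>)) j = \<gamma> j"
proof -
  have u: "(1/2) \<cdot>\<^sub>m 1\<^sub>m 2 \<in> carrier_mat 2 2" "(1/2) \<cdot>\<^sub>m (1\<^sub>m 2 + pauli b) \<in> carrier_mat 2 2" for b
    by (auto intro!: carrier_matI)
  from assms have "j = 0 \<or> j = Suc 0 \<or> j = 2" by auto
  then show ?thesis
    by (elim disjE; hypsubst)
      (simp_all add: stokes_diag_def stokes_R_def stokes_t_def bloch_eqs pauli_channel_entries u bell_prob_def add_divide_distrib diff_divide_distrib)
qed

lemma stokes_R_pauli_channel:
  assumes "a < 3" "b < 3" "a \<noteq> b"
  shows "stokes_R (pauli_channel p) $$ (a,b) = 0"
proof -
  have u: "(1/2) \<cdot>\<^sub>m 1\<^sub>m 2 \<in> carrier_mat 2 2" "(1/2) \<cdot>\<^sub>m (1\<^sub>m 2 + pauli b) \<in> carrier_mat 2 2" for b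
    by (auto intro!: carrier_matI)
  from assms have "a = 0 \<or> a = Suc 0 \<or> a = 2" "b = 0 \<or> b = Suc 0 \<or> b = 2" by auto
  then show ?thesis using \<open>a \<noteq> b\<close>
    by (elim disjE; hypsubst)
      (simp_all add: stokes_R_def stokes_t_def bloch_eqs pauli_channel_entries u)
qed

lemma stokes_t_pauli_channel: "a < 3 \<Longrightarrow> stokes_t (pauli_channel p) a = 0"
proof -
  have u: "(1/2) \<cdot>\<^sub>m 1\<^sub>m 2 \<in> carrier_mat 2 2" by (auto intro!: carrier_matI)
  assume "a < 3"
  then have "a = 0 \<or> a = Suc 0 \<or> a = 2" by auto
  then show ?thesis
    by (elim disjE; hypsubst) (simp_all add: stokes_t_def bloch_eqs pauli_channel_entries u)
qed

lemma bell_prob_sum: "bell_prob \<gamma> 0 + bell_prob \<gamma> (Suc 0) + bell_prob \<gamma> 2 + bell_prob \<gamma> 3 = 1"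
  by (simp add: bell_prob_def add_divide_distrib diff_divide_distrib)

text \<open>The Pauli matrices are orthogonal for the trace inner product, so the environment state
  for the maximally mixed input is already diagonal with entries \<open>p\<close>.\<close>

lemma vn_entropy_choi_pauli_channel:
  assumes p: "\<And>k. k < 4 \<Longrightarrow> 0 \<le> p k" and p1: "p 0 + p (Suc 0) + p 2 + p 3 = 1"
  shows "vn_entropy (choi (pauli_channel p)) = (\<Sum>k<4. eta (p k))"
proof -
  let ?K = "\<lambda>k. complex_of_real (sqrt (p k)) \<cdot>\<^sub>m pauli4 k"
  have "mat 4 4 (\<lambda>(k,l). mtrace (?K k * dag (?K l)) / 2) = diag_real 4 p"
  proof (rule eq_matI)
    fix k l assume "k < dim_row (diag_real 4 p)" "l < dim_col (diag_real 4 p)"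
    then have kl: "k < 4" "l < 4" by auto
    have s: "complex_of_real (sqrt (p k)) * complex_of_real (sqrt (p k)) = p k"
      using p[OF kl(1)] by (metis of_real_mult real_sqrt_mult_self abs_of_nonneg)
    have c: "?K k * dag (?K l) \<in> carrier_mat 2 2" by (intro carrier_matI) auto
    have "mtrace (?K k * dag (?K l)) = complex_of_real (sqrt (p k)) * complex_of_real (sqrt (p l)) *
      (pauli4 k $$ (0,0) * cnj (pauli4 l $$ (0,0)) + pauli4 k $$ (0,Suc 0) * cnj (pauli4 l $$ (0,Suc 0))
       + (pauli4 k $$ (Suc 0,0) * cnj (pauli4 l $$ (Suc 0,0)) + pauli4 k $$ (Suc 0,Suc 0) * cnj (pauli4 l $$ (Suc 0,Suc 0))))"
      by (simp add: mtrace_2[OF c] mult_mat_entry_2 algebra_simps del: index_mult_mat)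
    also have "\<dots> = (if k = l then 2 * p k else 0)"
      using kl s unfolding less_4_cases by (elim disjE; hypsubst) (simp_all add: algebra_simps)
    finally show "mat 4 4 (\<lambda>(k,l). mtrace (?K k * dag (?K l)) / 2) $$ (k,l) = diag_real 4 p $$ (k,l)"
      using kl by (simp add: diag_real_def)
  qed auto
  then show ?thesis
    using vn_entropy_choi[OF kraus_pauli_channel[of p]] p p1 by (simp add: vn_entropy_diag_real)
qed

lemma bell_entropy_cong: "(\<And>j. j < 3 \<Longrightarrow> \<gamma> j = \<gamma>' j) \<Longrightarrow> bell_entropy \<gamma> = bell_entropy \<gamma>'"
  by (simp add: bell_entropy_def sum_lessThan_4 bell_prob_def)

text \<open>The given \<open>F\<close> certifies that \<gamma> has nonnegative Bell probabilities,
  so the Pauli channel with these probabilities exists and lies in \<open>Ps \<gamma>\<close>. There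
  the general upper and lower bounds coincide, so the infimum is a minimum.\<close>

theorem worst_case_Kkey:
  assumes F: "qubit_channel F" and \<gamma>: "\<And>j. j < 3 \<Longrightarrow> stokes_R F $$ (j,j) = \<gamma> j"
  shows "(INF G \<in> Ps \<gamma>. Kkey G) = 1 - bell_entropy \<gamma>"
    and "\<And>G. G \<in> Ps \<gamma> \<Longrightarrow> 1 - bell_entropy \<gamma> \<le> Kkey G"
proof -
  have low: "1 - bell_entropy \<gamma> \<le> Kkey G" if "G \<in> Ps \<gamma>" for G
  proof -
    have "qubit_channel G" "\<And>j. j < 3 \<Longrightarrow> stokes_diag G j = \<gamma> j"
      using that by (auto simp: Ps_def stokes_diag_def)
    then show ?thesis using Kkey_lower[of G] bell_entropy_cong[of "stokes_diag G" \<gamma>] by simp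
  qed
  then show "\<And>G. G \<in> Ps \<gamma> \<Longrightarrow> 1 - bell_entropy \<gamma> \<le> Kkey G" .
  have bp: "bell_prob \<gamma> k = bell_prob (stokes_diag F) k" for k
    using \<gamma> by (simp add: bell_prob_def stokes_diag_def)
  have nn: "0 \<le> bell_prob \<gamma> k" if "k < 4" for k unfolding bp by (rule bell_prob_nonneg[OF F that])
  let ?G = "pauli_channel (bell_prob \<gamma>)"
  have G: "qubit_channel ?G"
    unfolding qubit_channel_iff_kraus using kraus_pauli_channel[OF nn bell_prob_sum] by blast
  have "vn_entropy (choi ?G) = bell_entropy \<gamma>"
    unfolding bell_entropy_def by (rule vn_entropy_choi_pauli_channel[OF nn bell_prob_sum])
  then have "Kkey ?G \<le> 1 - bell_entropy \<gamma>" using Kkey_upper[OF G] by simp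
  moreover have mem: "?G \<in> Ps \<gamma>" using G stokes_diag_pauli_channel by (auto simp: Ps_def stokes_diag_def)
  ultimately have "Kkey ?G = 1 - bell_entropy \<gamma>" using low by force
  then have "1 - bell_entropy \<gamma> \<in> Kkey ` Ps \<gamma>" using mem by (metis imageI)
  then show "(INF G \<in> Ps \<gamma>. Kkey G) = 1 - bell_entropy \<gamma>"
    by (rule cInf_eq_minimum) (use low in auto)
qed

section \<open>Composition with unitary channels\<close>

lemma unitary2_iff: "unitary2 U \<longleftrightarrow> unitary_mat 2 U"
  by (simp add: unitary2_def unitary_mat_def)

lemma mtrace_mult_comm:
  assumes "A \<in> carrier_mat 2 2" "B \<in> carrier_mat 2 2"
  shows "mtrace (A * B) = mtrace (B * A)"
proof -
  have c: "A * B \<in> carrier_mat 2 2" "B * A \<in> carrier_mat 2 2" using assms by (auto intro!: carrier_matI)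
  show ?thesis using assms
    by (simp add: mtrace_2[OF c(1)] mtrace_2[OF c(2)] mult_mat_entry_2 algebra_simps del: index_mult_mat)
qed

lemma mtrace_unitary_conj:
  assumes U: "unitary_mat 2 U" and M: "M \<in> carrier_mat 2 2"
  shows "mtrace (U * M * dag U) = mtrace M"
proof -
  have Uc: "U \<in> carrier_mat 2 2" using U by (rule unitary_mat_carrier)
  have "mtrace (U * M * dag U) = mtrace (U * (M * dag U))" using Uc M by (simp add: mult_assoc_dim)
  also have "\<dots> = mtrace (M * dag U * U)" using Uc M by (intro mtrace_mult_comm carrier_matI) auto
  also have "M * dag U * U = M * (dag U * U)" using Uc M by (simp add: mult_assoc_dim)
  also have "\<dots> = M" using unitary_mat_left[OF U] M by simp
  finally show ?thesis .
qed

lemma kraus_unitary_conj: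
  assumes k: "kraus F d K" and UA: "unitary_mat 2 UA" and UB: "unitary_mat 2 UB"
  shows "kraus (uchan UB \<circ> F \<circ> uchan UA) d (\<lambda>k. UB * K k * UA)"
  unfolding kraus_def
proof (intro conjI allI ballI impI)
  have Ac: "UA \<in> carrier_mat 2 2" and Bc: "UB \<in> carrier_mat 2 2" using UA UB by (auto simp: unitary_mat_def)
  have Kc: "K k \<in> carrier_mat 2 2" if "k < d" for k using k that by (auto simp: kraus_def)
  show "0 < d" using k by (simp add: kraus_def)
  show "UB * K k * UA \<in> carrier_mat 2 2" if "k < d" for k using Ac Bc Kc[OF that] by (intro carrier_matI) auto
  fix \<rho> :: "complex mat" assume \<rho>: "\<rho> \<in> carrier_mat 2 2"
  define \<rho>' where "\<rho>' = UA * \<rho> * dag UA"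
  have \<rho>': "\<rho>' \<in> carrier_mat 2 2" unfolding \<rho>'_def using Ac \<rho> by (intro carrier_matI) auto
  have F: "F \<rho>' \<in> carrier_mat 2 2" "mtrace (F \<rho>') = mtrace \<rho>'" using k \<rho>' by (auto simp: kraus_def)
  have G: "(uchan UB \<circ> F \<circ> uchan UA) \<rho> = UB * F \<rho>' * dag UB" by (simp add: uchan_def \<rho>'_def)
  show "(uchan UB \<circ> F \<circ> uchan UA) \<rho> \<in> carrier_mat 2 2" unfolding G using Bc F by (intro carrier_matI) auto
  show "mtrace ((uchan UB \<circ> F \<circ> uchan UA) \<rho>) = mtrace \<rho>"
    unfolding G mtrace_unitary_conj[OF UB F(1)] F(2) unfolding \<rho>'_def by (rule mtrace_unitary_conj[OF UA \<rho>])
  fix i j :: nat assume ij: "i < 2" "j < 2"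
  have Mc: "K k * \<rho>' * dag (K k) \<in> carrier_mat 2 2" if "k < d" for k
    using Kc[OF that] \<rho>' by (intro carrier_matI) auto
  have "(uchan UB \<circ> F \<circ> uchan UA) \<rho> $$ (i,j) = (\<Sum>x<2. \<Sum>y<2. UB $$ (i,x) * F \<rho>' $$ (x,y) * cnj (UB $$ (j,y)))"
    unfolding G by (rule conj_entry_2[OF Bc F(1) Bc ij])
  also have "\<dots> = (\<Sum>x<2. \<Sum>y<2. UB $$ (i,x) * (\<Sum>k<d. (K k * \<rho>' * dag (K k)) $$ (x,y)) * cnj (UB $$ (j,y)))"
    using k \<rho>' by (intro sum.cong refl) (auto simp: kraus_def)
  also have "\<dots> = (\<Sum>k<d. \<Sum>x<2. \<Sum>y<2. UB $$ (i,x) * (K k * \<rho>' * dag (K k)) $$ (x,y) * cnj (UB $$ (j,y)))"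
    by (simp add: sum_lessThan_2 sum.distrib sum_distrib_left sum_distrib_right del: index_mult_mat)
  also have "\<dots> = (\<Sum>k<d. (UB * (K k * \<rho>' * dag (K k)) * dag UB) $$ (i,j))"
    by (intro sum.cong refl conj_entry_2[OF Bc _ Bc ij, symmetric] Mc) auto
  also have "\<dots> = (\<Sum>k<d. (UB * K k * UA * \<rho> * dag (UB * K k * UA)) $$ (i,j))"
  proof (intro sum.cong refl arg_cong[where f = "\<lambda>M. M $$ (i,j)"])
    fix k assume "k \<in> {..<d}"
    then have "K k \<in> carrier_mat 2 2" using Kc by simp
    then show "UB * (K k * \<rho>' * dag (K k)) * dag UB = UB * K k * UA * \<rho> * dag (UB * K k * UA)"
      using Ac Bc \<rho> by (simp add: \<rho>'_def dag_mult mult_assoc_dim)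
  qed
  finally show "(uchan UB \<circ> F \<circ> uchan UA) \<rho> $$ (i,j) = (\<Sum>k<d. (UB * K k * UA * \<rho> * dag (UB * K k * UA)) $$ (i,j))" .
qed

lemma qubit_channel_unitary_conj:
  assumes "qubit_channel F" "unitary_mat 2 UA" "unitary_mat 2 UB"
  shows "qubit_channel (uchan UB \<circ> F \<circ> uchan UA)"
  using assms kraus_unitary_conj unfolding qubit_channel_iff_kraus by blast

text \<open>The traces of \<open>K k * dag (K l)\<close> do not change when the Kraus operators are
  multiplied by \<open>UB\<close> and \<open>UA\<close>, so the environment state for the maximally
  mixed input is literally the same.\<close>

lemma vn_entropy_choi_unitary_conj:
  assumes F: "qubit_channel F" and UA: "unitary_mat 2 UA" and UB: "unitary_mat 2 UB"
  shows "vn_entropy (choi (uchan UB \<circ> F \<circ> uchan UA)) = vn_entropy (choi F)"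
proof -
  obtain d K where k: "kraus F d K" using F qubit_channel_iff_kraus by blast
  have Ac: "UA \<in> carrier_mat 2 2" and Bc: "UB \<in> carrier_mat 2 2" using UA UB by (auto simp: unitary_mat_def)
  have Kc: "K k \<in> carrier_mat 2 2" if "k < d" for k using k that by (auto simp: kraus_def)
  have "mtrace (UB * K k * UA * dag (UB * K l * UA)) = mtrace (K k * dag (K l))" if "k < d" "l < d" for k l
  proof -
    have "UB * K k * UA * dag (UB * K l * UA) = UB * (K k * (UA * dag UA) * dag (K l)) * dag UB"
      using Ac Bc Kc[OF that(1)] Kc[OF that(2)] by (simp add: dag_mult mult_assoc_dim)
    also have "K k * (UA * dag UA) * dag (K l) = K k * dag (K l)"
      using unitary_mat_right[OF UA] Kc[OF that(1)] by simp
    finally have e: "UB * K k * UA * dag (UB * K l * UA) = UB * (K k * dag (K l)) * dag UB" .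
    show ?thesis unfolding e
      using Kc[OF that(1)] Kc[OF that(2)] by (intro mtrace_unitary_conj[OF UB] carrier_matI) auto
  qed
  then have "mat d d (\<lambda>(k,l). mtrace (UB * K k * UA * dag (UB * K l * UA)) / 2) = mat d d (\<lambda>(k,l). mtrace (K k * dag (K l)) / 2)"
    by (intro eq_matI) auto
  then show ?thesis
    unfolding vn_entropy_choi[OF k] vn_entropy_choi[OF kraus_unitary_conj[OF k UA UB]] by simp
qed

lemma uchan_one: "\<rho> \<in> carrier_mat 2 2 \<Longrightarrow> uchan (1\<^sub>m 2) \<rho> = \<rho>"
  by (simp add: uchan_def)

lemma qubit_channel_uchan:
  assumes U: "unitary_mat 2 U"
  shows "qubit_channel (uchan U)"
proof -
  have Uc: "U \<in> carrier_mat 2 2" using U by (rule unitary_mat_carrier)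
  have "kraus (uchan U) 1 (\<lambda>_. U)"
    unfolding kraus_def uchan_def using Uc mtrace_unitary_conj[OF U] by (auto intro!: carrier_matI simp del: index_mult_mat(1))
  then show ?thesis unfolding qubit_channel_iff_kraus by blast
qed

lemma less_3_cases: "(a::nat) < 3 \<longleftrightarrow> a = 0 \<or> a = Suc 0 \<or> a = 2"
  by auto

lemma sum_lessThan_3: "(\<Sum>i<3. f i) = f 0 + f (Suc 0) + f 2"
  by (simp add: eval_nat_numeral)

lemma hermitian_entries_2:
  assumes "\<rho> \<in> carrier_mat 2 2" "dag \<rho> = \<rho>"
  shows "\<rho> $$ (Suc 0,0) = cnj (\<rho> $$ (0,Suc 0))" "Im (\<rho> $$ (0,0)) = 0" "Im (\<rho> $$ (Suc 0,Suc 0)) = 0"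
proof -
  have h: "\<rho> $$ (i,j) = cnj (\<rho> $$ (j,i))" if "i < 2" "j < 2" for i j
    using dag_index[of i \<rho> j] assms that by simp
  show "\<rho> $$ (Suc 0,0) = cnj (\<rho> $$ (0,Suc 0))" by (rule h) simp_all
  show "Im (\<rho> $$ (0,0)) = 0" "Im (\<rho> $$ (Suc 0,Suc 0)) = 0"
    using h[of 0 0] h[of "Suc 0" "Suc 0"] unfolding complex_eq_iff by simp_all
qed

lemma bloch_channel:
  assumes F: "qubit_channel F" and \<rho>: "\<rho> \<in> carrier_mat 2 2" "dag \<rho> = \<rho>" and a: "a < 3"
  shows "bloch (F \<rho>) a = Re (mtrace \<rho>) * stokes_t F a + (\<Sum>b<3. stokes_R F $$ (a,b) * bloch \<rho> b)"
  using a unfolding less_3_cases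
  by (elim disjE; hypsubst)
    (simp_all add: bloch_eqs[OF channel_carrier[OF F \<rho>(1)]] bloch_eqs[OF \<rho>(1)] channel_entry[OF F \<rho>(1)]
      channel_tensor[OF F] hermitian_entries_2[OF \<rho>] mtrace_2[OF \<rho>(1)] sum_lessThan_3, simp_all add: field_simps)

lemma channel_dag:
  assumes F: "qubit_channel F" and \<rho>: "\<rho> \<in> carrier_mat 2 2" "dag \<rho> = \<rho>"
  shows "dag (F \<rho>) = F \<rho>"
proof (rule eq_matI)
  have c: "F \<rho> \<in> carrier_mat 2 2" by (rule channel_carrier[OF F \<rho>(1)])
  fix i j assume "i < dim_row (F \<rho>)" "j < dim_col (F \<rho>)"
  then have ij: "i < 2" "j < 2" using c by auto
  have re: "cnj (\<rho> $$ (0,0)) = \<rho> $$ (0,0)" "cnj (\<rho> $$ (Suc 0,Suc 0)) = \<rho> $$ (Suc 0,Suc 0)"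
    using hermitian_entries_2[OF \<rho>] by (simp_all add: complex_eq_iff)
  have "dag (F \<rho>) $$ (i,j) = cnj (F \<rho> $$ (j,i))" using ij c by simp
  also have "\<dots> = F \<rho> $$ (i,j)"
    unfolding channel_entry[OF F \<rho>(1) ij] channel_entry[OF F \<rho>(1) ij(2,1)]
    using ij by (simp add: channel_hermitian[OF F, of _ _ j i] re hermitian_entries_2(1)[OF \<rho>])
  finally show "dag (F \<rho>) $$ (i,j) = F \<rho> $$ (i,j)" .
qed (use channel_carrier[OF F \<rho>(1)] in auto)

lemma stokes_inputs:
  "(1/2) \<cdot>\<^sub>m 1\<^sub>m 2 \<in> carrier_mat 2 2" "dag ((1/2) \<cdot>\<^sub>m 1\<^sub>m 2) = (1/2) \<cdot>\<^sub>m 1\<^sub>m 2" "mtrace ((1/2) \<cdot>\<^sub>m 1\<^sub>m 2) = 1"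
  "(1/2) \<cdot>\<^sub>m (1\<^sub>m 2 + pauli b) \<in> carrier_mat 2 2"
  "b < 3 \<Longrightarrow> dag ((1/2) \<cdot>\<^sub>m (1\<^sub>m 2 + pauli b)) = (1/2) \<cdot>\<^sub>m (1\<^sub>m 2 + pauli b)"
  "b < 3 \<Longrightarrow> mtrace ((1/2) \<cdot>\<^sub>m (1\<^sub>m 2 + pauli b)) = 1"
proof -
  show c: "(1/2) \<cdot>\<^sub>m 1\<^sub>m 2 \<in> carrier_mat 2 2" "(1/2) \<cdot>\<^sub>m (1\<^sub>m 2 + pauli b) \<in> carrier_mat 2 2"
    by (auto intro!: carrier_matI)
  show "dag ((1/2) \<cdot>\<^sub>m 1\<^sub>m 2) = (1/2) \<cdot>\<^sub>m 1\<^sub>m 2" by (rule eq_matI) auto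
  show "mtrace ((1/2) \<cdot>\<^sub>m 1\<^sub>m 2) = 1" by (simp add: mtrace_2[OF c(1)])
  assume b: "b < 3"
  show "mtrace ((1/2) \<cdot>\<^sub>m (1\<^sub>m 2 + pauli b)) = 1"
    using b unfolding less_3_cases by (elim disjE; hypsubst) (simp_all add: mtrace_def sum_lessThan_2)
  show "dag ((1/2) \<cdot>\<^sub>m (1\<^sub>m 2 + pauli b)) = (1/2) \<cdot>\<^sub>m (1\<^sub>m 2 + pauli b)"
  proof (rule eq_matI)
    fix i j assume "i < dim_row ((1/2) \<cdot>\<^sub>m (1\<^sub>m 2 + pauli b))" "j < dim_col ((1/2) \<cdot>\<^sub>m (1\<^sub>m 2 + pauli b))"
    then have "i = 0 \<or> i = Suc 0" "j = 0 \<or> j = Suc 0" by auto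
    then show "dag ((1/2) \<cdot>\<^sub>m (1\<^sub>m 2 + pauli b)) $$ (i,j) = ((1/2) \<cdot>\<^sub>m (1\<^sub>m 2 + pauli b)) $$ (i,j)"
      using b unfolding less_3_cases by (elim disjE; hypsubst) simp_all
  qed auto
qed

lemma stokes_t_comp:
  assumes F: "qubit_channel F" and G: "qubit_channel G" and a: "a < 3"
  shows "stokes_t (G \<circ> F) a = stokes_t G a + (\<Sum>b<3. stokes_R G $$ (a,b) * stokes_t F b)"
  using bloch_channel[OF G channel_carrier[OF F stokes_inputs(1)] channel_dag[OF F stokes_inputs(1,2)] a]
  by (simp add: stokes_t_def channel_mtrace[OF F stokes_inputs(1)] stokes_inputs)

lemma stokes_R_carrier [simp]: "stokes_R F \<in> carrier_mat 3 3"
  by (simp add: stokes_R_def)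

text \<open>Affine maps compose, and subtracting the image of the maximally mixed state removes the
  translation parts.\<close>

lemma stokes_R_comp:
  assumes F: "qubit_channel F" and G: "qubit_channel G"
  shows "stokes_R (G \<circ> F) = stokes_R G * stokes_R F"
proof (rule eq_matI)
  fix a b assume "a < dim_row (stokes_R G * stokes_R F)" "b < dim_col (stokes_R G * stokes_R F)"
  then have ab: "a < 3" "b < 3" by (auto simp: stokes_R_def)
  let ?I = "(1/2) \<cdot>\<^sub>m (1\<^sub>m 2 + pauli b)"
  have "bloch ((G \<circ> F) ?I) a = stokes_t G a + (\<Sum>c<3. stokes_R G $$ (a,c) * bloch (F ?I) c)"
    using bloch_channel[OF G channel_carrier[OF F stokes_inputs(4)] channel_dag[OF F stokes_inputs(4) stokes_inputs(5)[OF ab(2)]] ab(1)]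
    by (simp add: channel_mtrace[OF F stokes_inputs(4)] stokes_inputs ab)
  then have "stokes_R (G \<circ> F) $$ (a,b) = (\<Sum>c<3. stokes_R G $$ (a,c) * bloch (F ?I) c) - (\<Sum>c<3. stokes_R G $$ (a,c) * stokes_t F c)"
    using ab stokes_t_comp[OF F G ab(1)] by (simp add: stokes_R_def[of "G \<circ> F"])
  also have "\<dots> = (\<Sum>c<3. stokes_R G $$ (a,c) * stokes_R F $$ (c,b))"
    using ab by (simp add: sum_subtractf[symmetric] right_diff_distrib[symmetric] stokes_R_def[of F])
  also have "\<dots> = (stokes_R G * stokes_R F) $$ (a,b)"
    using ab by (simp add: stokes_R_def scalar_prod_def atLeast0LessThan)
  finally show "stokes_R (G \<circ> F) $$ (a,b) = (stokes_R G * stokes_R F) $$ (a,b)" .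
qed (auto simp: stokes_R_def)

text \<open>Channels are total functions on matrices of every size, so
  \<open>uchan (1\<^sub>m 2)\<close> is the identity only on the 2 by 2 ones. This lets one-sided
  compensation be treated as two-sided compensation with a trivial factor.\<close>

lemma qubit_channel_cong:
  assumes "qubit_channel F" "\<And>\<rho>. \<rho> \<in> carrier_mat 2 2 \<Longrightarrow> G \<rho> = F \<rho>"
  shows "qubit_channel G"
  using assms unfolding qubit_channel_iff_kraus kraus_def by (simp cong: ball_cong)

lemma choi_cong: "(\<And>\<rho>. \<rho> \<in> carrier_mat 2 2 \<Longrightarrow> G \<rho> = F \<rho>) \<Longrightarrow> choi G = choi F"
  by (simp add: choi_def)

lemma uchan_carrier: "unitary_mat 2 U \<Longrightarrow> \<rho> \<in> carrier_mat 2 2 \<Longrightarrow> uchan U \<rho> \<in> carrier_mat 2 2"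
  using channel_carrier qubit_channel_uchan by blast

lemma left_unitary_channel:
  assumes F: "qubit_channel F" and U: "unitary_mat 2 U"
  shows "qubit_channel (uchan U \<circ> F)" "vn_entropy (choi (uchan U \<circ> F)) = vn_entropy (choi F)"
proof -
  have e: "(uchan U \<circ> F) \<rho> = (uchan U \<circ> F \<circ> uchan (1\<^sub>m 2)) \<rho>" if "\<rho> \<in> carrier_mat 2 2" for \<rho>
    using that by (simp add: uchan_one)
  show "qubit_channel (uchan U \<circ> F)"
    using qubit_channel_cong[OF qubit_channel_unitary_conj[OF F unitary_mat_one U]] e by blast
  show "vn_entropy (choi (uchan U \<circ> F)) = vn_entropy (choi F)"
    using choi_cong[of "uchan U \<circ> F" "uchan U \<circ> F \<circ> uchan (1\<^sub>m 2)", OF e]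
      vn_entropy_choi_unitary_conj[OF F unitary_mat_one U] by simp
qed

lemma right_unitary_channel:
  assumes F: "qubit_channel F" and U: "unitary_mat 2 U"
  shows "qubit_channel (F \<circ> uchan U)"
proof -
  have "(F \<circ> uchan U) \<rho> = (uchan (1\<^sub>m 2) \<circ> F \<circ> uchan U) \<rho>" if "\<rho> \<in> carrier_mat 2 2" for \<rho>
    using uchan_one[OF channel_carrier[OF F uchan_carrier[OF U that]]] by simp
  then show ?thesis
    using qubit_channel_cong[OF qubit_channel_unitary_conj[OF F U unitary_mat_one]] by blast
qed

lemma stokes_t_uchan:
  assumes U: "unitary_mat 2 U" and a: "a < 3"
  shows "stokes_t (uchan U) a = 0"
proof -
  have Uc: "U \<in> carrier_mat 2 2" using U by (rule unitary_mat_carrier)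
  have "U * ((1/2) \<cdot>\<^sub>m 1\<^sub>m 2) = (1/2) \<cdot>\<^sub>m (U * 1\<^sub>m 2)" using Uc by (rule mult_smult_distrib[of _ _ _ _ 2]) simp
  also have "\<dots> = (1/2) \<cdot>\<^sub>m U" using Uc by simp
  also have "(1/2) \<cdot>\<^sub>m U * dag U = (1/2) \<cdot>\<^sub>m (U * dag U)" using Uc by (rule mult_smult_assoc_mat[of _ _ _ _ 2]) (use Uc in simp)
  finally have "uchan U ((1/2) \<cdot>\<^sub>m 1\<^sub>m 2) = (1/2) \<cdot>\<^sub>m 1\<^sub>m 2" using unitary_mat_right[OF U] by (simp add: uchan_def)
  then show ?thesis using a unfolding less_3_cases stokes_t_def
    by (elim disjE; hypsubst) (simp_all add: bloch_eqs[OF stokes_inputs(1)])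
qed

lemma unital_left_unitary:
  assumes F: "qubit_channel F" "unital F" and U: "unitary_mat 2 U"
  shows "unital (uchan U \<circ> F)"
  using F stokes_t_comp[OF F(1) qubit_channel_uchan[OF U]] stokes_t_uchan[OF U] by (simp add: unital_def)

lemma unital_right_unitary:
  assumes F: "qubit_channel F" "unital F" and U: "unitary_mat 2 U"
  shows "unital (F \<circ> uchan U)"
  using F stokes_t_comp[OF qubit_channel_uchan[OF U] F(1)] stokes_t_uchan[OF U] by (simp add: unital_def)

text \<open>By \<open>channel_tensor\<close> the Choi matrix is a function of the Stokes parameters.
  With zero translation and diagonal Stokes matrix it is that of a Pauli channel.\<close>

lemma vn_entropy_choi_pauli_diagonal:
  assumes F: "qubit_channel F" "unital F"
    and diag: "\<And>a b. a < 3 \<Longrightarrow> b < 3 \<Longrightarrow> a \<noteq> b \<Longrightarrow> stokes_R F $$ (a,b) = 0"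
  shows "vn_entropy (choi F) = bell_entropy (stokes_diag F)"
proof -
  let ?p = "bell_prob (stokes_diag F)"
  have P: "qubit_channel (pauli_channel ?p)"
    unfolding qubit_channel_iff_kraus
    using kraus_pauli_channel[OF bell_prob_nonneg[OF F(1)] bell_prob_sum] by blast
  have t: "stokes_t F a = 0" if "a < 3" for a using F(2) that by (simp add: unital_def)
  have d: "stokes_R (pauli_channel ?p) $$ (j,j) = stokes_R F $$ (j,j)" if "j < 3" for j
    using stokes_diag_pauli_channel[OF that] by (simp add: stokes_diag_def)
  have "choi F = choi (pauli_channel ?p)"
  proof (rule eq_matI)
    fix a b assume "a < dim_row (choi (pauli_channel ?p))" "b < dim_col (choi (pauli_channel ?p))"
    then have ab: "a < 4" "b < 4" by (auto simp: choi_def)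
    then show "choi F $$ (a,b) = choi (pauli_channel ?p) $$ (a,b)"
      unfolding less_4_cases
      by (elim disjE; hypsubst) (simp_all add: choi_def channel_tensor[OF F(1)] channel_tensor[OF P] t diag d
          stokes_t_pauli_channel stokes_R_pauli_channel)
  qed (auto simp: choi_def)
  then show ?thesis
    using vn_entropy_choi_pauli_channel[OF bell_prob_nonneg[OF F(1)] bell_prob_sum] by (simp add: bell_entropy_def)
qed

section \<open>Values of the optima for unital channels\<close>

text \<open>Both estimates behind \<open>Kkey_upper\<close> become tight. If \<open>U\<close>
  diagonalises the image of |0_z>, unitality makes the image of |1_z> diagonal too, so the pinched
  Choi matrix is diagonal; and zero translation makes Y uniform.\<close>

theorem unital_Kkey_optimal:
  assumes E: "qubit_channel E" "unital E"
  obtains U where "unitary_mat 2 U" "Kkey (uchan U \<circ> E) = 1 - vn_entropy (choi E)"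
proof -
  let ?P = "matrix_unit 0 0"
  have "dag ?P = ?P" by (rule eq_matI) (auto simp: matrix_unit_def)
  then obtain W r where W: "unitary_mat 2 W" and EP: "E ?P = W * diag_real 2 r * dag W"
    using hermitian_diagonalization[OF channel_carrier[OF E(1) matrix_unit_carrier] channel_dag[OF E(1) matrix_unit_carrier]] by blast
  have Wc: "W \<in> carrier_mat 2 2" using W by (rule unitary_mat_carrier)
  define U where "U = dag W"
  have U: "unitary_mat 2 U" unfolding U_def by (rule unitary_mat_dag[OF W])
  define G where "G = uchan U \<circ> E"
  have G: "qubit_channel G" unfolding G_def by (rule left_unitary_channel(1)[OF E(1) U])
  have t: "stokes_t G a = 0" if "a < 3" for a
    using unital_left_unitary[OF E U] that by (simp add: unital_def G_def)
  have "G ?P = (dag W * W) * diag_real 2 r * (dag W * W)"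
    unfolding G_def U_def comp_def uchan_def EP using Wc by (simp add: mult_assoc_dim)
  then have GP: "G ?P = diag_real 2 r" using unitary_mat_left[OF W] by simp
  have "G ?P $$ (0,Suc 0) = 0" unfolding GP by (simp add: diag_real_def)
  then have R0: "stokes_R G $$ (Suc 0,0) = 0" "stokes_R G $$ (2,0) = 0"
    using t[of "Suc 0"] t[of 2] by (simp_all add: channel_tensor[OF G] complex_eq_iff)
  have "pinched_choi G = diag_real 4 (\<lambda>a. P_XY G (a div 2) (a mod 2))"
  proof (rule eq_matI)
    fix a b assume "a < dim_row (diag_real 4 (\<lambda>a. P_XY G (a div 2) (a mod 2)))" "b < dim_col (diag_real 4 (\<lambda>a. P_XY G (a div 2) (a mod 2)))"
    then have ab: "a < 4" "b < 4" by auto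
    then show "pinched_choi G $$ (a,b) = diag_real 4 (\<lambda>a. P_XY G (a div 2) (a mod 2)) $$ (a,b)"
      unfolding less_4_cases
      by (elim disjE; hypsubst) (simp_all add: pinched_choi_def choi_def diag_real_def P_XY_def proj_z_matrix_unit
         channel_tensor[OF G] t R0 complex_eq_iff)
  qed (auto simp: pinched_choi_def)
  then have "vn_entropy (pinched_choi G) - H_XY G = eta ((1 + stokes_t G 0) / 2) + eta ((1 - stokes_t G 0) / 2)"
    using joint_minus_conditional[OF G] by (simp add: vn_entropy_diag_real sum_lessThan_4)
  also have "\<dots> = 1" using t[of 0] by (simp add: eta_def log_divide)
  finally have "Kkey G = 1 - vn_entropy (choi E)"
    using left_unitary_channel(2)[OF E(1) U, folded G_def] by (simp add: Kkey_def H_XE_eq[OF G])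
  then show ?thesis using that U by (simp add: G_def)
qed

lemma Kkey_conj_upper:
  assumes E: "qubit_channel E" and U: "unitary_mat 2 UA" "unitary_mat 2 UB"
  shows "Kkey (uchan UB \<circ> E \<circ> uchan UA) \<le> 1 - vn_entropy (choi E)"
    "Kkey (uchan UB \<circ> E) \<le> 1 - vn_entropy (choi E)"
  using Kkey_upper[OF qubit_channel_unitary_conj[OF E U]] vn_entropy_choi_unitary_conj[OF E U]
    Kkey_upper[OF left_unitary_channel(1)[OF E U(2)]] left_unitary_channel(2)[OF E U(2)] by simp_all

theorem F1_unital:
  assumes E: "qubit_channel E" "unital E"
  shows "F1 E = 1 - vn_entropy (choi E)"
proof -
  obtain U where "unitary_mat 2 U" "Kkey (uchan U \<circ> E) = 1 - vn_entropy (choi E)"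
    using unital_Kkey_optimal[OF E] by blast
  then show ?thesis unfolding F1_def unitary2_iff
    using Kkey_conj_upper(2)[OF E(1) unitary_mat_one]
    by (intro cSup_eq_maximum) (auto intro: image_eqI[of _ _ U])
qed

theorem F2_unital:
  assumes E: "qubit_channel E" "unital E"
  shows "F2 E = 1 - vn_entropy (choi E)"
proof -
  have E': "qubit_channel (E \<circ> uchan (1\<^sub>m 2))" "unital (E \<circ> uchan (1\<^sub>m 2))"
    using right_unitary_channel[OF E(1) unitary_mat_one] unital_right_unitary[OF E unitary_mat_one] by auto
  obtain U where U: "unitary_mat 2 U" "Kkey (uchan U \<circ> (E \<circ> uchan (1\<^sub>m 2))) = 1 - vn_entropy (choi (E \<circ> uchan (1\<^sub>m 2)))"
    using unital_Kkey_optimal[OF E'] by blast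
  moreover have "choi (E \<circ> uchan (1\<^sub>m 2)) = choi E" by (intro choi_cong) (simp add: uchan_one)
  ultimately have "Kkey (uchan U \<circ> E \<circ> uchan (1\<^sub>m 2)) = 1 - vn_entropy (choi E)" by (simp add: comp_assoc)
  then show ?thesis unfolding F2_def unitary2_iff
    using Kkey_conj_upper(1)[OF E(1)] U(1) unitary_mat_one[of 2]
    by (intro cSup_eq_maximum) (auto intro: image_eqI[of _ _ "(1\<^sub>m 2, U)"])
qed

lemma stokes_R_unitary_conj:
  assumes E: "qubit_channel E" and U: "unitary_mat 2 UA" "unitary_mat 2 UB"
  shows "stokes_R (uchan UB \<circ> E \<circ> uchan UA) = rot UB * stokes_R E * rot UA"
    "stokes_R (uchan UB \<circ> E) = rot UB * stokes_R E"
  unfolding rot_def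
  using stokes_R_comp[OF qubit_channel_uchan[OF U(1)] left_unitary_channel(1)[OF E U(2)]]
    stokes_R_comp[OF E qubit_channel_uchan[OF U(2)]] by simp_all

text \<open>The compensated channel itself belongs to the set over which the infimum is taken, so
  the worst case is at most its own K, which \<open>Kkey_conj_upper\<close> bounds.\<close>

lemma Ktilde_at_unitary:
  assumes E: "qubit_channel E" and U: "unitary_mat 2 UA" "unitary_mat 2 UB"
  shows "Ktilde_at E (rot UA) (rot UB) = 1 - bell_entropy (\<lambda>j. (rot UB * stokes_R E * rot UA) $$ (j,j))"
    "Ktilde_at E (rot UA) (rot UB) \<le> 1 - vn_entropy (choi E)"
proof -
  let ?G = "uchan UB \<circ> E \<circ> uchan UA" and ?\<gamma> = "\<lambda>j. (rot UB * stokes_R E * rot UA) $$ (j,j)"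
  have G: "qubit_channel ?G" by (rule qubit_channel_unitary_conj[OF E U])
  have d: "stokes_R ?G $$ (j,j) = ?\<gamma> j" for j unfolding stokes_R_unitary_conj(1)[OF E U] ..
  show 1: "Ktilde_at E (rot UA) (rot UB) = 1 - bell_entropy ?\<gamma>"
    unfolding Ktilde_at_def by (rule worst_case_Kkey(1)[OF G d])
  have "?G \<in> Ps ?\<gamma>" using G d by (simp add: Ps_def)
  then have "1 - bell_entropy ?\<gamma> \<le> Kkey ?G" by (rule worst_case_Kkey(2)[OF G d])
  also have "\<dots> \<le> 1 - vn_entropy (choi E)" by (rule Kkey_conj_upper(1)[OF E U])
  finally show "Ktilde_at E (rot UA) (rot UB) \<le> 1 - vn_entropy (choi E)" using 1 by simp
qed

lemma Ktilde_at_left_unitary: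
  assumes E: "qubit_channel E" and U: "unitary_mat 2 U"
  shows "Ktilde_at E (1\<^sub>m 3) (rot U) = 1 - bell_entropy (\<lambda>j. (rot U * stokes_R E) $$ (j,j))"
    "Ktilde_at E (1\<^sub>m 3) (rot U) \<le> 1 - vn_entropy (choi E)"
proof -
  let ?G = "uchan U \<circ> E" and ?\<gamma> = "\<lambda>j. (rot U * stokes_R E) $$ (j,j)"
  have G: "qubit_channel ?G" by (rule left_unitary_channel(1)[OF E U])
  have d: "stokes_R ?G $$ (j,j) = ?\<gamma> j" for j unfolding stokes_R_unitary_conj(2)[OF E U U] ..
  have "rot U * stokes_R E \<in> carrier_mat 3 3" unfolding rot_def by (intro carrier_matI) (auto simp: stokes_R_def)
  then have one: "rot U * stokes_R E * 1\<^sub>m 3 = rot U * stokes_R E" by (rule right_mult_one_mat)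
  show 1: "Ktilde_at E (1\<^sub>m 3) (rot U) = 1 - bell_entropy ?\<gamma>"
    unfolding Ktilde_at_def one by (rule worst_case_Kkey(1)[OF G d])
  have "?G \<in> Ps ?\<gamma>" using G d by (simp add: Ps_def)
  then have "1 - bell_entropy ?\<gamma> \<le> Kkey ?G" by (rule worst_case_Kkey(2)[OF G d])
  also have "\<dots> \<le> 1 - vn_entropy (choi E)" by (rule Kkey_conj_upper(2)[OF E U U])
  finally show "Ktilde_at E (1\<^sub>m 3) (rot U) \<le> 1 - vn_entropy (choi E)" using 1 by simp
qed

section \<open>Unitaries and rotations\<close>

text \<open>The matrix $a + \mathrm{i}\,(b\,\sigma_z + c\,\sigma_x + d\,\sigma_y)$.\<close>

definition quat_mat :: "real \<Rightarrow> real \<Rightarrow> real \<Rightarrow> real \<Rightarrow> complex mat" where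
  "quat_mat a b c d = mat 2 2 (\<lambda>(i,j). if i = 0 then (if j = 0 then Complex a b else Complex d c)
     else (if j = 0 then Complex (- d) c else Complex a (- b)))"

text \<open>The Euler-Rodrigues matrix of conjugation by \<open>quat_mat a b c d\<close>, with axes
  in the order z, x, y.\<close>

definition quat_rot :: "real \<Rightarrow> real \<Rightarrow> real \<Rightarrow> real \<Rightarrow> nat \<Rightarrow> nat \<Rightarrow> real" where
  "quat_rot a b c d i j =
    (if i = 0 then (if j = 0 then a\<^sup>2 + b\<^sup>2 - c\<^sup>2 - d\<^sup>2 else if j = 1 then 2 * b * c + 2 * a * d else 2 * b * d - 2 * a * c)
     else if i = 1 then (if j = 0 then 2 * b * c - 2 * a * d else if j = 1 then a\<^sup>2 - b\<^sup>2 + c\<^sup>2 - d\<^sup>2 else 2 * c * d + 2 * a * b)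
     else (if j = 0 then 2 * b * d + 2 * a * c else if j = 1 then 2 * c * d - 2 * a * b else a\<^sup>2 - b\<^sup>2 - c\<^sup>2 + d\<^sup>2))"

lemma quat_mat_carrier [simp]: "quat_mat a b c d \<in> carrier_mat 2 2"
  by (simp add: quat_mat_def)

lemma quat_mat_entries:
  "quat_mat a b c d $$ (0,0) = Complex a b" "quat_mat a b c d $$ (0,Suc 0) = Complex d c"
  "quat_mat a b c d $$ (Suc 0,0) = Complex (- d) c" "quat_mat a b c d $$ (Suc 0,Suc 0) = Complex a (- b)"
  by (simp_all add: quat_mat_def)

lemma quat_mat_unitary:
  assumes "a\<^sup>2 + b\<^sup>2 + c\<^sup>2 + d\<^sup>2 = 1"
  shows "unitary_mat 2 (quat_mat a b c d)"
  unfolding unitary_mat_def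
proof
  show "dag (quat_mat a b c d) * quat_mat a b c d = 1\<^sub>m 2"
  proof (rule eq_matI)
    fix i j assume "i < dim_row (1\<^sub>m 2 :: complex mat)" "j < dim_col (1\<^sub>m 2 :: complex mat)"
    then have ij: "i < 2" "j < 2" by auto
    have "(dag (quat_mat a b c d) * quat_mat a b c d) $$ (i,j)
        = dag (quat_mat a b c d) $$ (i,0) * quat_mat a b c d $$ (0,j) + dag (quat_mat a b c d) $$ (i,Suc 0) * quat_mat a b c d $$ (Suc 0,j)"
      using ij by (intro mult_mat_entry_2) (auto simp: quat_mat_def)
    also have "\<dots> = (1\<^sub>m 2) $$ (i,j)"
      using ij assms unfolding less_2_cases_iff
      by (elim disjE; hypsubst) (simp_all add: quat_mat_def complex_eq_iff power2_eq_square algebra_simps)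
    finally show "(dag (quat_mat a b c d) * quat_mat a b c d) $$ (i,j) = (1\<^sub>m 2) $$ (i,j)" .
  qed (auto simp: quat_mat_def)
qed simp

lemma rot_quat_mat:
  assumes q: "a\<^sup>2 + b\<^sup>2 + c\<^sup>2 + d\<^sup>2 = 1" and ij: "i < 3" "j < 3"
  shows "rot (quat_mat a b c d) $$ (i,j) = quat_rot a b c d i j"
proof -
  let ?U = "quat_mat a b c d"
  have U: "unitary_mat 2 ?U" by (rule quat_mat_unitary[OF q])
  have e: "uchan ?U \<rho> $$ (k,l) = (\<Sum>x<2. \<Sum>y<2. ?U $$ (k,x) * \<rho> $$ (x,y) * cnj (?U $$ (l,y)))"
    if "\<rho> \<in> carrier_mat 2 2" "k < 2" "l < 2" for \<rho> k l
    unfolding uchan_def using that by (intro conj_entry_2[of _ 2 _ _ 2]) auto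
  have "rot ?U $$ (i,j) = bloch (uchan ?U ((1/2) \<cdot>\<^sub>m (1\<^sub>m 2 + pauli j))) i"
    using ij stokes_t_uchan[OF U] by (simp add: rot_def stokes_R_def)
  also have "\<dots> = quat_rot a b c d i j"
    using ij unfolding less_3_cases
    by (elim disjE; hypsubst)
      (simp_all add: bloch_eqs[OF uchan_carrier[OF U stokes_inputs(4)]] e[OF stokes_inputs(4)] sum_lessThan_2
        quat_mat_entries quat_rot_def power2_eq_square, simp_all add: field_simps)
  finally show ?thesis .
qed

text \<open>Conjugation does not see a global phase: dividing by a square root of the determinant
  brings \<open>U\<close> into SU(2), whose elements are exactly the unit quaternions.\<close>

lemma unitary_quaternion:
  assumes U: "unitary_mat 2 U"
  obtains a b c d where "a\<^sup>2 + b\<^sup>2 + c\<^sup>2 + d\<^sup>2 = 1" "rot U = rot (quat_mat a b c d)"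
proof -
  have Uc: "U \<in> carrier_mat 2 2" using U by (rule unitary_mat_carrier)
  define u where "u = U $$ (0,0)"
  define v where "v = U $$ (0,Suc 0)"
  define w where "w = U $$ (Suc 0,0)"
  define z where "z = U $$ (Suc 0,Suc 0)"
  have o: "cnj u * u + cnj w * w = 1" "cnj u * v + cnj w * z = 0" "cnj v * v + cnj z * z = 1"
    using unitary_cols[OF U, of 0 0] unitary_cols[OF U, of 0 "Suc 0"] unitary_cols[OF U, of "Suc 0" "Suc 0"]
    by (simp_all add: sum_lessThan_2 u_def v_def w_def z_def)
  \<comment> \<open>\<open>\<delta>\<close> is the determinant; the next two facts say that the
    adjoint of \<open>U\<close> is its adjugate divided by \<open>\<delta>\<close>.\<close>
  define \<delta> where "\<delta> = u * z - v * w"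
  have z: "\<delta> * cnj u = z"
  proof -
    have "\<delta> * cnj u = z * (cnj u * u + cnj w * w) - w * (cnj u * v + cnj w * z)" by (simp add: \<delta>_def algebra_simps)
    then show ?thesis using o by simp
  qed
  have v: "- \<delta> * cnj w = v"
  proof -
    have "- \<delta> * cnj w = v * (cnj u * u + cnj w * w) - u * (cnj u * v + cnj w * z)" by (simp add: \<delta>_def algebra_simps)
    then show ?thesis using o by simp
  qed
  have \<delta>1: "\<delta> * cnj \<delta> = 1"
  proof -
    have "\<delta> * cnj \<delta> = (\<delta> * cnj u) * cnj z + (- \<delta> * cnj w) * cnj v" by (simp add: \<delta>_def algebra_simps)
    also have "\<dots> = cnj v * v + cnj z * z" unfolding z v by (simp add: mult.commute add.commute)
    finally show ?thesis using o(3) by simp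
  qed
  define l where "l = csqrt \<delta>"
  have l2: "l * l = \<delta>" by (simp add: l_def power2_eq_square[symmetric])
  have "(cmod \<delta>)\<^sup>2 = 1" using \<delta>1 by (metis complex_norm_square of_real_eq_1_iff)
  then have "cmod \<delta> = 1" by (simp add: power2_eq_1_iff) (smt (verit) norm_ge_zero)
  then have "(cmod l)\<^sup>2 = 1" using l2 by (metis norm_mult power2_eq_square)
  then have l1: "l * cnj l = 1" by (metis complex_norm_square of_real_1)
  define u' where "u' = cnj l * u"
  define w' where "w' = cnj l * w"
  have z': "cnj l * z = cnj u'"
  proof -
    have "cnj l * z = (l * cnj l) * (l * cnj u)" unfolding z[symmetric] l2[symmetric] by (simp add: mult_ac)
    then show ?thesis using l1 by (simp add: u'_def)
  qed
  have v': "cnj l * v = - cnj w'"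
  proof -
    have "cnj l * v = - ((l * cnj l) * (l * cnj w))" unfolding v[symmetric] l2[symmetric] by (simp add: mult_ac)
    then show ?thesis using l1 by (simp add: w'_def)
  qed
  define a where "a = Re u'"
  define b where "b = Im u'"
  define c where "c = Im w'"
  define d where "d = - Re w'"
  let ?Q = "quat_mat a b c d"
  have Q: "?Q $$ (i,j) = cnj l * U $$ (i,j)" if "i < 2" "j < 2" for i j
    using that u'_def w'_def z' v' unfolding less_2_cases_iff
    by (elim disjE; hypsubst)
      (simp_all add: quat_mat_def a_def b_def c_def d_def u_def[symmetric] v_def[symmetric] w_def[symmetric] z_def[symmetric] complex_eq_iff)
  have sq: "a\<^sup>2 + b\<^sup>2 + c\<^sup>2 + d\<^sup>2 = 1"
  proof -
    have "cnj u' * u' + cnj w' * w' = (l * cnj l) * (cnj u * u + cnj w * w)"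
      by (simp add: u'_def w'_def algebra_simps)
    then have "Re (cnj u' * u' + cnj w' * w') = 1" using l1 o(1) by simp
    then show ?thesis by (simp add: a_def b_def c_def d_def power2_eq_square)
  qed
  have "uchan U \<rho> = uchan ?Q \<rho>" if \<rho>: "\<rho> \<in> carrier_mat 2 2" for \<rho>
  proof (rule eq_matI)
    fix i j assume "i < dim_row (uchan ?Q \<rho>)" "j < dim_col (uchan ?Q \<rho>)"
    then have ij: "i < 2" "j < 2" by (auto simp: uchan_def quat_mat_def)
    have "uchan ?Q \<rho> $$ (i,j) = (\<Sum>x<2. \<Sum>y<2. ?Q $$ (i,x) * \<rho> $$ (x,y) * cnj (?Q $$ (j,y)))"
      unfolding uchan_def using \<rho> ij by (intro conj_entry_2[of _ 2 _ _ 2]) auto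
    also have "\<dots> = (\<Sum>x<2. \<Sum>y<2. (l * cnj l) * (U $$ (i,x) * \<rho> $$ (x,y) * cnj (U $$ (j,y))))"
      using ij by (intro sum.cong refl) (simp add: Q mult_ac)
    also have "\<dots> = (\<Sum>x<2. \<Sum>y<2. U $$ (i,x) * \<rho> $$ (x,y) * cnj (U $$ (j,y)))" by (simp only: l1 mult_1_left)
    also have "\<dots> = uchan U \<rho> $$ (i,j)"
      unfolding uchan_def using \<rho> ij Uc by (intro conj_entry_2[of _ 2 _ _ 2, symmetric]) auto
    finally show "uchan U \<rho> $$ (i,j) = uchan ?Q \<rho> $$ (i,j)" by simp
  qed (use Uc in \<open>auto simp: uchan_def quat_mat_def\<close>)
  then have "rot U = rot ?Q" unfolding rot_def stokes_R_def stokes_t_def by (simp add: stokes_inputs)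
  then show ?thesis using that sq by blast
qed

lemma rot_carrier [simp]: "rot U \<in> carrier_mat 3 3"
  by (simp add: rot_def)

lemma rot_orthogonal:
  assumes U: "unitary_mat 2 U"
  shows "transpose_mat (rot U) * rot U = 1\<^sub>m 3"
proof -
  obtain a b c d where q: "a\<^sup>2 + b\<^sup>2 + c\<^sup>2 + d\<^sup>2 = 1" and r: "rot U = rot (quat_mat a b c d)"
    using unitary_quaternion[OF U] by blast
  show ?thesis
  proof (rule eq_matI)
    fix i j assume "i < dim_row (1\<^sub>m 3 :: real mat)" "j < dim_col (1\<^sub>m 3 :: real mat)"
    then have ij: "i < 3" "j < 3" by auto
    have "(transpose_mat (rot U) * rot U) $$ (i,j) = (\<Sum>k<3. rot U $$ (k,i) * rot U $$ (k,j))"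
      using ij carrier_matD[OF rot_carrier[of U]] by (simp add: scalar_prod_def atLeast0LessThan)
    also have "\<dots> = (\<Sum>k<3. quat_rot a b c d k i * quat_rot a b c d k j)"
      unfolding r using ij by (intro sum.cong refl) (simp add: rot_quat_mat[OF q])
    also have "\<dots> = (if i = j then (a\<^sup>2 + b\<^sup>2 + c\<^sup>2 + d\<^sup>2)\<^sup>2 else 0)"
      using ij unfolding less_3_cases
      by (elim disjE; hypsubst) (simp_all add: sum_lessThan_3 quat_rot_def power2_eq_square algebra_simps)
    also have "\<dots> = (1\<^sub>m 3) $$ (i,j)" using ij q by simp
    finally show "(transpose_mat (rot U) * rot U) $$ (i,j) = (1\<^sub>m 3) $$ (i,j)" .
  qed (use carrier_matD[OF rot_carrier[of U]] in auto)
qed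

text \<open>
  The entries of a $3 \times 3$ matrix, row by row: orthonormal columns, orthonormal rows, and every entry equal to
  its cofactor.
\<close>

definition rotation9 :: "real \<Rightarrow> real \<Rightarrow> real \<Rightarrow> real \<Rightarrow> real \<Rightarrow> real \<Rightarrow> real \<Rightarrow> real \<Rightarrow> real \<Rightarrow> bool" where
  "rotation9 x y z u v w p q r \<longleftrightarrow>
     x*x + u*u + p*p = 1 \<and> y*y + v*v + q*q = 1 \<and> z*z + w*w + r*r = 1 \<and>
     x*y + u*v + p*q = 0 \<and> x*z + u*w + p*r = 0 \<and> y*z + v*w + q*r = 0 \<and>
     x*x + y*y + z*z = 1 \<and> u*u + v*v + w*w = 1 \<and> p*p + q*q + r*r = 1 \<and>
     x*u + y*v + z*w = 0 \<and> x*p + y*q + z*r = 0 \<and> u*p + v*q + w*r = 0 \<and>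
     x = v*r - w*q \<and> y = w*p - u*r \<and> z = u*q - v*p \<and>
     u = q*z - r*y \<and> v = r*x - p*z \<and> w = p*y - q*x \<and>
     p = y*w - z*v \<and> q = z*u - x*w \<and> r = x*v - y*u"

definition quat_param :: "real \<Rightarrow> real \<Rightarrow> real \<Rightarrow> real \<Rightarrow> real \<Rightarrow> real \<Rightarrow> real \<Rightarrow> real \<Rightarrow> real \<Rightarrow> bool" where
  "quat_param x y z u v w p q r \<longleftrightarrow> (\<exists>a b c d. a\<^sup>2 + b\<^sup>2 + c\<^sup>2 + d\<^sup>2 = 1 \<and>
     x = a\<^sup>2 + b\<^sup>2 - c\<^sup>2 - d\<^sup>2 \<and> y = 2 * b * c + 2 * a * d \<and> z = 2 * b * d - 2 * a * c \<and>
     u = 2 * b * c - 2 * a * d \<and> v = a\<^sup>2 - b\<^sup>2 + c\<^sup>2 - d\<^sup>2 \<and> w = 2 * c * d + 2 * a * b \<and>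
     p = 2 * b * d + 2 * a * c \<and> q = 2 * c * d - 2 * a * b \<and> r = a\<^sup>2 - b\<^sup>2 - c\<^sup>2 + d\<^sup>2)"

text \<open>For a rotation given by a quaternion, the four factors of the form 1 +- x +- v +- r are
  4 a a, 4 b b, 4 c c, 4 d d, the differences w - q, p - z, y - u are 4ab, 4ac, 4ad, and the sums y
  + u, z + p, w + q are 4bc, 4bd, 4cd. The identities are the resulting relations between these
  products.\<close>

lemma rotation9_identities:
  assumes "rotation9 x y z u v w p q r"
  shows "(1 + x + v + r) * (1 + x - v - r) = (w - q)\<^sup>2" "(1 + x + v + r) * (1 - x + v - r) = (p - z)\<^sup>2"
    "(1 + x + v + r) * (1 - x - v + r) = (y - u)\<^sup>2"
    "(w - q) * (p - z) = (1 + x + v + r) * (y + u)" "(w - q) * (y - u) = (1 + x + v + r) * (z + p)"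
    "(p - z) * (y - u) = (1 + x + v + r) * (w + q)"
proof -
  have o: "x*x + u*u + p*p = 1" "y*y + v*v + q*q = 1" "z*z + w*w + r*r = 1"
     "x*y + u*v + p*q = 0" "x*z + u*w + p*r = 0" "y*z + v*w + q*r = 0"
     "x*x + y*y + z*z = 1" "u*u + v*v + w*w = 1" "p*p + q*q + r*r = 1"
     "x*u + y*v + z*w = 0" "x*p + y*q + z*r = 0" "u*p + v*q + w*r = 0"
     "x = v*r - w*q" "y = w*p - u*r" "z = u*q - v*p"
     "u = q*z - r*y" "v = r*x - p*z" "w = p*y - q*x"
     "p = y*w - z*v" "q = z*u - x*w" "r = x*v - y*u"
    using assms unfolding rotation9_def by blast+
  have e: "(1 + x + v + r) * (1 + x - v - r) = 1 + 2*x + x*x - v*v - r*r - 2*(v*r)"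
    "(1 + x + v + r) * (1 - x + v - r) = 1 + 2*v + v*v - x*x - r*r - 2*(r*x)"
    "(1 + x + v + r) * (1 - x - v + r) = 1 + 2*r + r*r - x*x - v*v - 2*(x*v)"
    "(w - q)\<^sup>2 = w*w + q*q - 2*(w*q)" "(p - z)\<^sup>2 = p*p + z*z - 2*(p*z)" "(y - u)\<^sup>2 = y*y + u*u - 2*(y*u)"
    "(w - q) * (p - z) = w*p - z*w - p*q + q*z" "(w - q) * (y - u) = y*w - u*w - y*q + u*q"
    "(p - z) * (y - u) = p*y - u*p - y*z + z*u"
    "(1 + x + v + r) * (y + u) = y + u + x*y + x*u + y*v + u*v + r*y + u*r"
    "(1 + x + v + r) * (z + p) = z + p + x*z + x*p + v*z + v*p + z*r + p*r"
    "(1 + x + v + r) * (w + q) = w + q + x*w + q*x + v*w + v*q + w*r + q*r"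
    by (simp_all add: power2_eq_square algebra_simps)
  have c: "z*v = v*z" by (simp add: mult.commute)
  show "(1 + x + v + r) * (1 + x - v - r) = (w - q)\<^sup>2" unfolding e using o(1-3,7-9,13) by linarith
  show "(1 + x + v + r) * (1 - x + v - r) = (p - z)\<^sup>2" unfolding e using o(1-3,7-9,17) by linarith
  show "(1 + x + v + r) * (1 - x - v + r) = (y - u)\<^sup>2" unfolding e using o(1-3,7-9,21) by linarith
  show "(w - q) * (p - z) = (1 + x + v + r) * (y + u)" unfolding e using o(4,10,14,16) by linarith
  show "(w - q) * (y - u) = (1 + x + v + r) * (z + p)" unfolding e using o(5,11,15,19) c by linarith
  show "(p - z) * (y - u) = (1 + x + v + r) * (w + q)" unfolding e using o(6,12,18,20) by linarith
qed

text \<open>When 1 + trace, which must be 4 a a, is nonzero, its root determines \<open>a\<close>,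
  and the antisymmetric part of the matrix gives \<open>b\<close>, \<open>c\<close>,
  \<open>d\<close> by division.\<close>

lemma quat_param_generic:
  assumes R: "rotation9 x y z u v w p q r" and pos: "1 + x + v + r \<noteq> 0"
  shows "quat_param x y z u v w p q r"
proof -
  note I = rotation9_identities[OF R]
  define X where "X = 1 + x + v + r"
  \<comment> \<open>The four factors sum to 4, and \<open>X\<close> times each of them is a square,
    which makes \<open>X\<close> nonnegative.\<close>
  have "4 * X = X * X + X * (1 + x - v - r) + X * (1 - x + v - r) + X * (1 - x - v + r)"
    by (simp add: X_def algebra_simps)
  also have "\<dots> \<ge> 0" unfolding X_def I by simp
  finally have X: "0 < X" using pos by (simp add: X_def)
  define a where "a = sqrt X / 2"
  have a: "a \<noteq> 0" "4 * a\<^sup>2 = X" using X by (simp_all add: a_def power_divide)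
  define b where "b = (w - q) / (4 * a)"
  define c where "c = (p - z) / (4 * a)"
  define d where "d = (y - u) / (4 * a)"
  have ab: "4 * (a * b) = w - q" "4 * (a * c) = p - z" "4 * (a * d) = y - u"
    using a by (simp_all add: b_def c_def d_def)
  have can: "s = t" if "X * s = X * t" for s t using that X by simp
  have sq: "4 * b\<^sup>2 = 1 + x - v - r" "4 * c\<^sup>2 = 1 - x + v - r" "4 * d\<^sup>2 = 1 - x - v + r"
  proof -
    have s: "X * (4 * t\<^sup>2) = (4 * (a * t))\<^sup>2" for t unfolding a(2)[symmetric] by (simp add: power2_eq_square)
    show "4 * b\<^sup>2 = 1 + x - v - r" by (rule can) (simp only: s ab, simp only: X_def I)
    show "4 * c\<^sup>2 = 1 - x + v - r" by (rule can) (simp only: s ab, simp only: X_def I)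
    show "4 * d\<^sup>2 = 1 - x - v + r" by (rule can) (simp only: s ab, simp only: X_def I)
  qed
  have pr: "4 * (b * c) = y + u" "4 * (b * d) = z + p" "4 * (c * d) = w + q"
  proof -
    have s: "X * (4 * (t * t')) = (4 * (a * t)) * (4 * (a * t'))" for t t' unfolding a(2)[symmetric] by (simp add: power2_eq_square)
    show "4 * (b * c) = y + u" by (rule can) (simp only: s ab, simp only: X_def I)
    show "4 * (b * d) = z + p" by (rule can) (simp only: s ab, simp only: X_def I)
    show "4 * (c * d) = w + q" by (rule can) (simp only: s ab, simp only: X_def I)
  qed
  show ?thesis unfolding quat_param_def
    by (intro exI[of _ a] exI[of _ b] exI[of _ c] exI[of _ d])
      (use a(2) sq pr ab in \<open>simp add: X_def mult.assoc\<close>)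
qed

lemma rotation9_flip:
  "rotation9 x y z u v w p q r \<Longrightarrow> rotation9 x (-y) (-z) u (-v) (-w) p (-q) (-r)"
  "rotation9 x y z u v w p q r \<Longrightarrow> rotation9 (-x) y (-z) (-u) v (-w) (-p) q (-r)"
  "rotation9 x y z u v w p q r \<Longrightarrow> rotation9 (-x) (-y) z (-u) (-v) w (-p) (-q) r"
  unfolding rotation9_def
  by (elim conjE, intro conjI; (simp (no_asm) only: mult_minus_left mult_minus_right minus_minus)?; linarith)+

text \<open>Right multiplication of the quaternion by one of the three imaginary units.\<close>

lemma quat_param_flip:
  "quat_param x (-y) (-z) u (-v) (-w) p (-q) (-r) \<Longrightarrow> quat_param x y z u v w p q r"
  "quat_param (-x) y (-z) (-u) v (-w) (-p) q (-r) \<Longrightarrow> quat_param x y z u v w p q r"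
  "quat_param (-x) (-y) z (-u) (-v) w (-p) (-q) r \<Longrightarrow> quat_param x y z u v w p q r"
proof -
  assume "quat_param x (-y) (-z) u (-v) (-w) p (-q) (-r)"
  then obtain a b c d where h: "a\<^sup>2 + b\<^sup>2 + c\<^sup>2 + d\<^sup>2 = 1" 
     "x = a\<^sup>2 + b\<^sup>2 - c\<^sup>2 - d\<^sup>2" "- y = 2 * b * c + 2 * a * d" "- z = 2 * b * d - 2 * a * c"
     "u = 2 * b * c - 2 * a * d" "- v = a\<^sup>2 - b\<^sup>2 + c\<^sup>2 - d\<^sup>2" "- w = 2 * c * d + 2 * a * b"
     "p = 2 * b * d + 2 * a * c" "- q = 2 * c * d - 2 * a * b" "- r = a\<^sup>2 - b\<^sup>2 - c\<^sup>2 + d\<^sup>2"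
    unfolding quat_param_def by blast
  show "quat_param x y z u v w p q r" unfolding quat_param_def
    by (rule exI[of _ "-b"], rule exI[of _ a], rule exI[of _ "-d"], rule exI[of _ c])
      (use h in \<open>simp add: algebra_simps\<close>)
next
  assume "quat_param (-x) y (-z) (-u) v (-w) (-p) q (-r)"
  then obtain a b c d where h: "a\<^sup>2 + b\<^sup>2 + c\<^sup>2 + d\<^sup>2 = 1" 
     "- x = a\<^sup>2 + b\<^sup>2 - c\<^sup>2 - d\<^sup>2" "y = 2 * b * c + 2 * a * d" "- z = 2 * b * d - 2 * a * c"
     "- u = 2 * b * c - 2 * a * d" "v = a\<^sup>2 - b\<^sup>2 + c\<^sup>2 - d\<^sup>2" "- w = 2 * c * d + 2 * a * b"
     "- p = 2 * b * d + 2 * a * c" "q = 2 * c * d - 2 * a * b" "- r = a\<^sup>2 - b\<^sup>2 - c\<^sup>2 + d\<^sup>2"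
    unfolding quat_param_def by blast
  show "quat_param x y z u v w p q r" unfolding quat_param_def
    by (rule exI[of _ "-c"], rule exI[of _ d], rule exI[of _ a], rule exI[of _ "-b"])
      (use h in \<open>simp add: algebra_simps\<close>)
next
  assume "quat_param (-x) (-y) z (-u) (-v) w (-p) (-q) r"
  then obtain a b c d where h: "a\<^sup>2 + b\<^sup>2 + c\<^sup>2 + d\<^sup>2 = 1" 
     "- x = a\<^sup>2 + b\<^sup>2 - c\<^sup>2 - d\<^sup>2" "- y = 2 * b * c + 2 * a * d" "z = 2 * b * d - 2 * a * c"
     "- u = 2 * b * c - 2 * a * d" "- v = a\<^sup>2 - b\<^sup>2 + c\<^sup>2 - d\<^sup>2" "w = 2 * c * d + 2 * a * b"
     "- p = 2 * b * d + 2 * a * c" "- q = 2 * c * d - 2 * a * b" "r = a\<^sup>2 - b\<^sup>2 - c\<^sup>2 + d\<^sup>2"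
    unfolding quat_param_def by blast
  show "quat_param x y z u v w p q r" unfolding quat_param_def
    by (rule exI[of _ "-d"], rule exI[of _ "-c"], rule exI[of _ b], rule exI[of _ a])
      (use h in \<open>simp add: algebra_simps\<close>)
qed

lemma rotation9_quat_param:
  assumes R: "rotation9 x y z u v w p q r"
  shows "quat_param x y z u v w p q r"
proof -
  \<comment> \<open>The four expressions sum to 4, so they cannot all vanish: the rotation or one of
    its three half-turn variants is generic.\<close>
  consider "1 + x + v + r \<noteq> 0" | "1 + x + (-v) + (-r) \<noteq> 0" | "1 + (-x) + v + (-r) \<noteq> 0" | "1 + (-x) + (-v) + r \<noteq> 0"
    by linarith
  then show ?thesis
    using quat_param_generic[OF R] quat_param_flip(1)[OF quat_param_generic[OF rotation9_flip(1)[OF R]]]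
      quat_param_flip(2)[OF quat_param_generic[OF rotation9_flip(2)[OF R]]]
      quat_param_flip(3)[OF quat_param_generic[OF rotation9_flip(3)[OF R]]] by cases
qed

lemma det_2:
  assumes "(A :: 'a :: comm_ring_1 mat) \<in> carrier_mat 2 2"
  shows "det A = A $$ (0,0) * A $$ (Suc 0,Suc 0) - A $$ (0,Suc 0) * A $$ (Suc 0,0)"
proof -
  have d: "det (mat_delete A i 0) = A $$ (if i = 0 then Suc 0 else 0, Suc 0)" if "i < 2" for i
    using assms that by (subst det_single) (auto simp: mat_delete_def)
  show ?thesis
    by (subst laplace_expansion_column[OF assms, of 0]) (simp_all add: sum_lessThan_2 cofactor_def d)
qed

lemma det_3:
  assumes A: "(A :: 'a :: comm_ring_1 mat) \<in> carrier_mat 3 3"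
  shows "det A = A $$ (0,0) * (A $$ (Suc 0,Suc 0) * A $$ (2,2) - A $$ (Suc 0,2) * A $$ (2,Suc 0))
    - A $$ (Suc 0,0) * (A $$ (0,Suc 0) * A $$ (2,2) - A $$ (0,2) * A $$ (2,Suc 0))
    + A $$ (2,0) * (A $$ (0,Suc 0) * A $$ (Suc 0,2) - A $$ (0,2) * A $$ (Suc 0,Suc 0))"
proof -
  have c: "mat_delete A i 0 \<in> carrier_mat 2 2" for i using A by (intro carrier_matI) auto
  have e: "mat_delete A i 0 $$ (k,l) = A $$ (if k < i then k else Suc k, Suc l)" if "k < 2" "l < 2" for i k l
    using A that by (simp add: mat_delete_def)
  have s: "Suc (Suc 0) = 2" by simp
  show ?thesis
    by (subst laplace_expansion_column[OF A, of 0])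
      (simp_all add: sum_lessThan_3 cofactor_def det_2[OF c] e s algebra_simps)
qed

lemma SO3_transpose:
  assumes "SO3 Q" shows "SO3 (transpose_mat Q)"
proof -
  have Q: "Q \<in> carrier_mat 3 3" "transpose_mat Q * Q = 1\<^sub>m 3" "det Q = 1" using assms by (auto simp: SO3_def)
  have "Q * transpose_mat Q = 1\<^sub>m 3" using mat_mult_left_right_inverse[of "transpose_mat Q" 3 Q] Q by simp
  then show ?thesis using Q det_transpose[OF Q(1)] by (simp add: SO3_def)
qed

text \<open>Lagrange's identity: the squared distance between the first column and the cross product
  of the other two is 1 - 2 det + 1 = 0.\<close>

lemma orthonormal_cross:
  fixes x y z u v w p q r :: real
  assumes "x*x + u*u + p*p = 1" "y*y + v*v + q*q = 1" "z*z + w*w + r*r = 1" "y*z + v*w + q*r = 0"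
    and "x * (v*r - w*q) + u * (q*z - r*y) + p * (y*w - z*v) = 1"
  shows "x = v*r - w*q" "u = q*z - r*y" "p = y*w - z*v"
proof -
  have "(x - (v*r - w*q))\<^sup>2 + (u - (q*z - r*y))\<^sup>2 + (p - (y*w - z*v))\<^sup>2
    = (x*x + u*u + p*p) - 2 * (x * (v*r - w*q) + u * (q*z - r*y) + p * (y*w - z*v))
      + ((y*y + v*v + q*q) * (z*z + w*w + r*r) - (y*z + v*w + q*r)\<^sup>2)"
    by (simp add: power2_eq_square algebra_simps)
  also have "\<dots> = 0" unfolding assms by simp
  finally have s: "(x - (v*r - w*q))\<^sup>2 + (u - (q*z - r*y))\<^sup>2 + (p - (y*w - z*v))\<^sup>2 = 0" .
  then have "(x - (v*r - w*q))\<^sup>2 = 0" "(u - (q*z - r*y))\<^sup>2 = 0" "(p - (y*w - z*v))\<^sup>2 = 0"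
    using zero_le_power2[of "x - (v*r - w*q)"] zero_le_power2[of "u - (q*z - r*y)"] zero_le_power2[of "p - (y*w - z*v)"]
    by linarith+
  then show "x = v*r - w*q" "u = q*z - r*y" "p = y*w - z*v" by simp_all
qed

lemma transpose_mult_entry_3:
  assumes "(M :: real mat) \<in> carrier_mat 3 3" "i < 3" "j < 3"
  shows "(transpose_mat M * M) $$ (i,j) = M $$ (0,i) * M $$ (0,j) + M $$ (Suc 0,i) * M $$ (Suc 0,j) + M $$ (2,i) * M $$ (2,j)"
proof -
  have "(transpose_mat M * M) $$ (i,j) = (\<Sum>k<3. M $$ (k,i) * M $$ (k,j))"
    using assms by (simp add: scalar_prod_def atLeast0LessThan)
  then show ?thesis by (simp only: sum_lessThan_3)
qed

lemma SO3_rotation9: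
  assumes "SO3 Q"
  shows "rotation9 (Q $$ (0,0)) (Q $$ (0,Suc 0)) (Q $$ (0,2)) (Q $$ (Suc 0,0)) (Q $$ (Suc 0,Suc 0)) (Q $$ (Suc 0,2))
    (Q $$ (2,0)) (Q $$ (2,Suc 0)) (Q $$ (2,2))"
proof -
  have Q: "Q \<in> carrier_mat 3 3" "transpose_mat Q * Q = 1\<^sub>m 3" "det Q = 1" using assms by (auto simp: SO3_def)
  have T: "transpose_mat Q \<in> carrier_mat 3 3" "Q * transpose_mat Q = 1\<^sub>m 3"
    using SO3_transpose[OF assms] by (auto simp: SO3_def)
  define x y z u v w p q r where e: "x = Q $$ (0,0)" "y = Q $$ (0,Suc 0)" "z = Q $$ (0,2)"
    "u = Q $$ (Suc 0,0)" "v = Q $$ (Suc 0,Suc 0)" "w = Q $$ (Suc 0,2)"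
    "p = Q $$ (2,0)" "q = Q $$ (2,Suc 0)" "r = Q $$ (2,2)"
  have c: "Q $$ (0,i) * Q $$ (0,j) + Q $$ (Suc 0,i) * Q $$ (Suc 0,j) + Q $$ (2,i) * Q $$ (2,j) = (if i = j then 1 else 0)"
    if "i < 3" "j < 3" for i j using transpose_mult_entry_3[OF Q(1) that] Q(2) that by simp
  have rr: "Q $$ (i,0) * Q $$ (j,0) + Q $$ (i,Suc 0) * Q $$ (j,Suc 0) + Q $$ (i,2) * Q $$ (j,2) = (if i = j then 1 else 0)"
    if "i < 3" "j < 3" for i j using transpose_mult_entry_3[OF T(1) that] T(2) that Q(1) by simp
  have co: "x*x + u*u + p*p = 1" "y*y + v*v + q*q = 1" "z*z + w*w + r*r = 1"
     "x*y + u*v + p*q = 0" "x*z + u*w + p*r = 0" "y*z + v*w + q*r = 0"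
    using c[of 0 0] c[of "Suc 0" "Suc 0"] c[of 2 2] c[of 0 "Suc 0"] c[of 0 2] c[of "Suc 0" 2] by (simp_all add: e)
  have ro: "x*x + y*y + z*z = 1" "u*u + v*v + w*w = 1" "p*p + q*q + r*r = 1"
     "x*u + y*v + z*w = 0" "x*p + y*q + z*r = 0" "u*p + v*q + w*r = 0"
    using rr[of 0 0] rr[of "Suc 0" "Suc 0"] rr[of 2 2] rr[of 0 "Suc 0"] rr[of 0 2] rr[of "Suc 0" 2] by (simp_all add: e)
  have det: "x * (v*r - w*q) - u * (y*r - z*q) + p * (y*w - z*v) = 1"
    using det_3[OF Q(1)] Q(3) by (simp add: e)
  have x: "x = v*r - w*q" "u = q*z - r*y" "p = y*w - z*v"
    by (rule orthonormal_cross[OF co(1,2,3,6)]; use det in \<open>simp add: algebra_simps\<close>)+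
  have "z*x + w*u + r*p = 0" using co(5) by (simp add: mult.commute)
  moreover have "y * (w*p - u*r) + v * (r*x - p*z) + q * (z*u - x*w) = 1" using det by (simp add: algebra_simps)
  ultimately have y: "y = w*p - u*r" "v = r*x - p*z" "q = z*u - x*w"
    by (rule orthonormal_cross[OF co(2,3,1)])+
  have "z * (u*q - v*p) + w * (p*y - q*x) + r * (x*v - y*u) = 1" using det by (simp add: algebra_simps)
  then have z: "z = u*q - v*p" "w = p*y - q*x" "r = x*v - y*u"
    by (rule orthonormal_cross[OF co(3,1,2,4)])+
  show ?thesis unfolding e[symmetric] rotation9_def
    by (intro conjI co ro x y z)
qed

text \<open>Surjectivity of the map from SU(2) to SO(3). The suprema range over unitaries while the
  claimed optimisers are rotation matrices, so each of these has to be induced by some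
  unitary.\<close>

theorem rot_surj:
  assumes "SO3 Q"
  obtains U where "unitary_mat 2 U" "rot U = Q"
proof -
  have Q: "Q \<in> carrier_mat 3 3" using assms by (auto simp: SO3_def)
  obtain a b c d where q: "a\<^sup>2 + b\<^sup>2 + c\<^sup>2 + d\<^sup>2 = 1"
    and e: "Q $$ (0,0) = a\<^sup>2 + b\<^sup>2 - c\<^sup>2 - d\<^sup>2" "Q $$ (0,Suc 0) = 2 * b * c + 2 * a * d" "Q $$ (0,2) = 2 * b * d - 2 * a * c"
     "Q $$ (Suc 0,0) = 2 * b * c - 2 * a * d" "Q $$ (Suc 0,Suc 0) = a\<^sup>2 - b\<^sup>2 + c\<^sup>2 - d\<^sup>2" "Q $$ (Suc 0,2) = 2 * c * d + 2 * a * b"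
     "Q $$ (2,0) = 2 * b * d + 2 * a * c" "Q $$ (2,Suc 0) = 2 * c * d - 2 * a * b" "Q $$ (2,2) = a\<^sup>2 - b\<^sup>2 - c\<^sup>2 + d\<^sup>2"
    using rotation9_quat_param[OF SO3_rotation9[OF assms]] unfolding quat_param_def by blast
  have "rot (quat_mat a b c d) = Q"
  proof (rule eq_matI)
    fix i j assume "i < dim_row Q" "j < dim_col Q"
    then have ij: "i < 3" "j < 3" using Q by auto
    then show "rot (quat_mat a b c d) $$ (i,j) = Q $$ (i,j)"
      unfolding rot_quat_mat[OF q ij] unfolding less_3_cases
      by (elim disjE; hypsubst) (simp_all add: quat_rot_def e)
  qed (use Q carrier_matD[OF rot_carrier] in auto)
  then show ?thesis using that quat_mat_unitary[OF q] by blast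
qed

section \<open>The one-sided optimum\<close>

lemma continuous_on_eta: "continuous_on {0..} eta"
  unfolding continuous_on_def
proof
  fix x :: real assume x: "x \<in> {0..}"
  show "(eta \<longlongrightarrow> eta x) (at x within {0..})"
  proof (cases "x = 0")
    case True
    have "((\<lambda>x. - x * log 2 x) \<longlongrightarrow> 0) (at_right (0::real))" by real_asymp
    then show ?thesis unfolding True eta_0 at_within_Ici_at_right by (simp add: eta_def[abs_def])
  next
    case False
    then have "isCont eta x" unfolding eta_def[abs_def] using x by (intro continuous_intros) auto
    then show ?thesis by (meson isCont_def tendsto_within_subset subset_UNIV)
  qed
qed

lemma left_rotation_diag:
  assumes q: "a\<^sup>2 + b\<^sup>2 + c\<^sup>2 + d\<^sup>2 = 1" and j: "j < 3" and R: "R \<in> carrier_mat 3 3"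
  shows "(rot (quat_mat a b c d) * R) $$ (j,j) = (\<Sum>m<3. quat_rot a b c d j m * R $$ (m,j))"
proof -
  have "(rot (quat_mat a b c d) * R) $$ (j,j) = (\<Sum>m<3. rot (quat_mat a b c d) $$ (j,m) * R $$ (m,j))"
    using j R carrier_matD[OF rot_carrier[of "quat_mat a b c d"]] by (simp add: scalar_prod_def atLeast0LessThan)
  also have "\<dots> = (\<Sum>m<3. quat_rot a b c d j m * R $$ (m,j))"
    using j by (intro sum.cong refl) (simp add: rot_quat_mat[OF q])
  finally show ?thesis .
qed

lemma unit_quaternions_compact: "compact {(a,b,c,d). a\<^sup>2 + b\<^sup>2 + c\<^sup>2 + d\<^sup>2 = (1::real)}" (is "compact ?S")
proof -
  let ?B = "{-1..1} \<times> {-1..1} \<times> {-1..1} \<times> {-1..1::real}"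
  have "?S \<subseteq> ?B"
  proof
    fix q assume "q \<in> ?S"
    then obtain a b c d where qe: "q = (a,b,c,d)" and h: "a\<^sup>2 + b\<^sup>2 + c\<^sup>2 + d\<^sup>2 = 1" by auto
    have "a\<^sup>2 \<le> 1" "b\<^sup>2 \<le> 1" "c\<^sup>2 \<le> 1" "d\<^sup>2 \<le> 1"
      using h zero_le_power2[of a] zero_le_power2[of b] zero_le_power2[of c] zero_le_power2[of d] by linarith+
    then have "\<bar>a\<bar> \<le> 1" "\<bar>b\<bar> \<le> 1" "\<bar>c\<bar> \<le> 1" "\<bar>d\<bar> \<le> 1" by (simp_all add: abs_square_le_1)
    then show "q \<in> ?B" unfolding qe by (simp add: abs_le_iff)
  qed
  then have "?S = ?B \<inter> {q. (fst q)\<^sup>2 + (fst (snd q))\<^sup>2 + (fst (snd (snd q)))\<^sup>2 + (snd (snd (snd q)))\<^sup>2 = 1}"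
    by auto
  also have "compact \<dots>"
    by (intro compact_Int_closed compact_Times compact_Icc closed_Collect_eq continuous_intros)
  finally show ?thesis .
qed

text \<open>An equality of suprema says something about a single rotation only if the supremum is
  attained. Pulled back to unit quaternions, the objective is continuous on a compact set: the Bell
  probabilities are polynomials there.\<close>

theorem F1tilde_attained:
  assumes E: "qubit_channel E"
  obtains U where "unitary_mat 2 U" "F1tilde E = Ktilde_at E (1\<^sub>m 3) (rot U)"
proof -
  let ?S = "{(a,b,c,d). a\<^sup>2 + b\<^sup>2 + c\<^sup>2 + d\<^sup>2 = (1::real)}"
  define g where "g q j = (\<Sum>m<3. quat_rot (fst q) (fst (snd q)) (fst (snd (snd q))) (snd (snd (snd q))) j m * stokes_R E $$ (m,j))"
    for q :: "real \<times> real \<times> real \<times> real" and j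
  have diag: "(rot (quat_mat a b c d) * stokes_R E) $$ (j,j) = g (a,b,c,d) j" if "(a,b,c,d) \<in> ?S" "j < 3" for a b c d j
    using left_rotation_diag[OF _ that(2) stokes_R_carrier] that(1) by (simp add: g_def)
  have K: "Ktilde_at E (1\<^sub>m 3) (rot (quat_mat a b c d)) = 1 - bell_entropy (g (a,b,c,d))" if q: "(a,b,c,d) \<in> ?S" for a b c d
  proof -
    have "bell_entropy (\<lambda>j. (rot (quat_mat a b c d) * stokes_R E) $$ (j,j)) = bell_entropy (g (a,b,c,d))"
      by (rule bell_entropy_cong) (rule diag[OF q])
    then show ?thesis using Ktilde_at_left_unitary(1)[OF E quat_mat_unitary] q by simp
  qed
  \<comment> \<open>\<open>eta\<close> is known to be continuous only on the nonnegative reals, so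
    the Bell probabilities must be kept in that range; they come from an actual channel.\<close>
  have nn: "0 \<le> bell_prob (g q) k" if q: "q \<in> ?S" and k: "k < 4" for q k
  proof -
    obtain a b c d where qe: "q = (a,b,c,d)" by (cases q) auto
    have U: "unitary_mat 2 (quat_mat a b c d)" using q quat_mat_unitary by (simp add: qe)
    have "stokes_diag (uchan (quat_mat a b c d) \<circ> E) j = g q j" if "j < 3" for j
      using diag[of a b c d j] q that unfolding qe stokes_diag_def stokes_R_unitary_conj(2)[OF E U U] by simp
    then have "bell_prob (stokes_diag (uchan (quat_mat a b c d) \<circ> E)) k = bell_prob (g q) k"
      by (simp add: bell_prob_def)
    then show ?thesis using bell_prob_nonneg[OF left_unitary_channel(1)[OF E U] k] by simp
  qed
  have cg: "continuous_on ?S (\<lambda>q. g q j)" for j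
  proof -
    have "continuous_on ?S (\<lambda>q. quat_rot (fst q) (fst (snd q)) (fst (snd (snd q))) (snd (snd (snd q))) j m)" for m
      unfolding quat_rot_def
      by (cases "j = 0"; cases "j = 1"; cases "m = 0"; cases "m = 1"; simp; intro continuous_intros)
    then show ?thesis unfolding g_def by (intro continuous_intros)
  qed
  have cb: "continuous_on ?S (\<lambda>q. bell_prob (g q) k)" for k
    unfolding bell_prob_def
    by (cases "k = 0"; cases "k = Suc 0"; cases "k = 2"; simp; intro continuous_intros cg; simp)
  have "continuous_on ?S (\<lambda>q. bell_entropy (g q))"
    unfolding bell_entropy_def
    by (intro continuous_on_sum continuous_on_compose2[OF continuous_on_eta cb]) (use nn in auto)
  moreover have "(1,0,0,0) \<in> ?S" by simp
  ultimately obtain q where q: "q \<in> ?S" and min: "\<And>q'. q' \<in> ?S \<Longrightarrow> bell_entropy (g q) \<le> bell_entropy (g q')"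
    using continuous_attains_inf[OF unit_quaternions_compact] by blast
  obtain a b c d where qe: "q = (a,b,c,d)" by (cases q) auto
  have U: "unitary_mat 2 (quat_mat a b c d)" using q quat_mat_unitary by (simp add: qe)
  have "Ktilde_at E (1\<^sub>m 3) (rot V) \<le> Ktilde_at E (1\<^sub>m 3) (rot (quat_mat a b c d))" if V: "unitary_mat 2 V" for V
  proof -
    obtain a' b' c' d' where q': "a'\<^sup>2 + b'\<^sup>2 + c'\<^sup>2 + d'\<^sup>2 = 1" and r: "rot V = rot (quat_mat a' b' c' d')"
      using unitary_quaternion[OF V] by blast
    then have "(a',b',c',d') \<in> ?S" by simp
    then show ?thesis unfolding r using K min[of "(a',b',c',d')"] q by (simp add: qe)
  qed
  then have "F1tilde E = Ktilde_at E (1\<^sub>m 3) (rot (quat_mat a b c d))"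
    unfolding F1tilde_def unitary2_iff using U by (intro cSup_eq_maximum) auto
  then show ?thesis using that U by blast
qed

text \<open>
  Equality in the entropy bound forces the squared Bell probabilities to sum to the squared Frobenius norm of the Choi
  matrix, leaving nothing for the off-diagonal Stokes parameters.
\<close>

lemma bell_entropy_equality:
  assumes F: "qubit_channel F" "unital F" and eq: "vn_entropy (choi F) = bell_entropy (stokes_diag F)"
    and ab: "a < 3" "b < 3" "a \<noteq> b"
  shows "stokes_R F $$ (a,b) = 0"
proof -
  obtain d K where k: "kraus F d K" using F(1) qubit_channel_iff_kraus by blast
  have X: "kraus_cols d K \<in> carrier_mat 4 d" by (simp add: kraus_cols_def)
  let ?R = "\<lambda>a b. stokes_R F $$ (a,b)"
  have t: "stokes_t F a = 0" if "a < 3" for a using F(2) that by (simp add: unital_def)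
  have "vn_entropy (choi F) = (\<Sum>i<4. eta (Re ((dag bell_basis * choi F * bell_basis) $$ (i,i))))"
    unfolding eq bell_entropy_def by (intro sum.cong refl) (simp only: choi_bell_diagonal[OF F(1)] lessThan_iff)
  from vn_entropy_le_diagonal(2)[OF X choi_gram[OF k] unitary_bell_basis this]
  have "(\<Sum>i<4. (Re ((dag bell_basis * choi F * bell_basis) $$ (i,i)))\<^sup>2) = (\<Sum>i<4. \<Sum>j<4. (cmod (choi F $$ (i,j)))\<^sup>2)" .
  moreover have "(\<Sum>i<4. (Re ((dag bell_basis * choi F * bell_basis) $$ (i,i)))\<^sup>2) = (\<Sum>i<4. (bell_prob (stokes_diag F) i)\<^sup>2)"
    by (intro sum.cong refl) (simp only: choi_bell_diagonal[OF F(1)] lessThan_iff)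
  moreover have "(\<Sum>i<4. (bell_prob (stokes_diag F) i)\<^sup>2) = (1 + (?R 0 0)\<^sup>2 + (?R (Suc 0) (Suc 0))\<^sup>2 + (?R 2 2)\<^sup>2) / 4"
    by (simp add: sum_lessThan_4 bell_prob_def stokes_diag_def power2_eq_square field_simps)
  \<comment> \<open>All nine Stokes entries contribute here, only the three diagonal ones to the sum
    of squared Bell probabilities; equality forces the six squares in between to vanish.\<close>
  moreover have "(\<Sum>i<4. \<Sum>j<4. (cmod (choi F $$ (i,j)))\<^sup>2) = (1 + (\<Sum>a<3. \<Sum>b<3. (?R a b)\<^sup>2)) / 4"
    by (simp add: sum_lessThan_4 sum_lessThan_3 choi_def channel_tensor[OF F(1)] t norm_divide power_divide cmod_power2)
      (simp add: power2_eq_square field_simps)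
  ultimately have s: "(?R 0 (Suc 0))\<^sup>2 + (?R 0 2)\<^sup>2 + (?R (Suc 0) 0)\<^sup>2 + (?R (Suc 0) 2)\<^sup>2 + (?R 2 0)\<^sup>2 + (?R 2 (Suc 0))\<^sup>2 = 0"
    by (simp add: sum_lessThan_3)
  have "(?R 0 (Suc 0))\<^sup>2 = 0" "(?R 0 2)\<^sup>2 = 0" "(?R (Suc 0) 0)\<^sup>2 = 0" "(?R (Suc 0) 2)\<^sup>2 = 0" "(?R 2 0)\<^sup>2 = 0" "(?R 2 (Suc 0))\<^sup>2 = 0"
    using s zero_le_power2[of "?R 0 (Suc 0)"] zero_le_power2[of "?R 0 2"] zero_le_power2[of "?R (Suc 0) 0"]
      zero_le_power2[of "?R (Suc 0) 2"] zero_le_power2[of "?R 2 0"] zero_le_power2[of "?R 2 (Suc 0)"] by linarith+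
  then show ?thesis using ab unfolding less_3_cases by auto
qed

section \<open>Rotations with prescribed row directions\<close>

type_synonym triple = "real \<times> real \<times> real"

fun dot3 :: "triple \<Rightarrow> triple \<Rightarrow> real" where
  "dot3 (a,b,c) (x,y,z) = a * x + b * y + c * z"

fun scale3 :: "real \<Rightarrow> triple \<Rightarrow> triple" where
  "scale3 k (x,y,z) = (k * x, k * y, k * z)"

fun cross :: "triple \<Rightarrow> triple \<Rightarrow> triple" where
  "cross (a,b,c) (x,y,z) = (b * z - c * y, c * x - a * z, a * y - b * x)"

lemma dot3_commute: "dot3 v w = dot3 w v"
  by (cases v; cases w) (simp add: mult.commute)

lemma dot3_scale: "dot3 (scale3 k v) w = k * dot3 v w" "dot3 v (scale3 k w) = k * dot3 v w"
  by (cases v; cases w; simp add: algebra_simps)+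

lemma dot3_self_nonneg: "0 \<le> dot3 v v"
  by (cases v) simp

lemma dot3_self_eq_0: "dot3 v v = 0 \<longleftrightarrow> v = (0,0,0)"
proof (cases v)
  case (fields a b c)
  have "a * a + b * b + c * c = 0 \<longleftrightarrow> a = 0 \<and> b = 0 \<and> c = 0"
    by (smt (verit) mult_eq_0_iff zero_le_square)
  then show ?thesis by (simp add: fields)
qed

lemma normalize3:
  assumes "v \<noteq> (0,0,0)"
  obtains u k where "dot3 u u = 1" "v = scale3 k u" "k \<noteq> 0"
proof -
  define k where "k = sqrt (dot3 v v)"
  have k: "k \<noteq> 0" "k * k = dot3 v v" using assms dot3_self_nonneg[of v] dot3_self_eq_0[of v] by (simp_all add: k_def)
  have "dot3 (scale3 (1 / k) v) (scale3 (1 / k) v) = 1" using k(1) by (simp add: dot3_scale k(2)[symmetric])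
  moreover have "v = scale3 k (scale3 (1 / k) v)" using k by (cases v) simp
  ultimately show ?thesis using that k by blast
qed

lemma perpendicular3: "\<exists>w. dot3 w w = 1 \<and> dot3 u w = 0"
proof (cases u)
  case (fields a b c)
  show ?thesis
  proof (cases "a = 0 \<and> b = 0")
    case True
    then show ?thesis by (intro exI[of _ "(1,0,0)"]) (simp add: fields)
  next
    case False
    then have "(- b, a, 0) \<noteq> (0,0,0)" by auto
    then obtain w k where w: "dot3 w w = 1" "(- b, a, 0) = scale3 k w" "k \<noteq> 0" by (rule normalize3)
    have "k * dot3 u w = dot3 u (- b, a, 0)" by (simp add: w(2) dot3_scale)
    then have "dot3 u w = 0" using w(3) by (simp add: fields)
    then show ?thesis using w by blast
  qed
qed

text \<open>A zero vector has no direction of its own: it receives an arbitrary unit vector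
  perpendicular to the other one, with coefficient 0.\<close>

lemma orthonormal_pair:
  assumes "dot3 v w = 0"
  obtains u u' k k' where "dot3 u u = 1" "dot3 u' u' = 1" "dot3 u u' = 0" "v = scale3 k u" "w = scale3 k' u'"
proof -
  have z: "(0,0,0) = scale3 0 u" for u by (cases u) simp
  consider "v = (0,0,0)" "w = (0,0,0)" | "v \<noteq> (0,0,0)" "w = (0,0,0)" | "v = (0,0,0)" "w \<noteq> (0,0,0)" | "v \<noteq> (0,0,0)" "w \<noteq> (0,0,0)"
    by blast
  then show ?thesis
  proof cases
    case 1
    then show ?thesis using that[of "(1,0,0)" "(0,1,0)" 0 0] by simp
  next
    case 2
    obtain u k where u: "dot3 u u = 1" "v = scale3 k u" using normalize3[OF 2(1)] by metis
    obtain u' where "dot3 u' u' = 1" "dot3 u u' = 0" using perpendicular3 by blast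
    then show ?thesis using that[of u u' k 0] u z[of u'] 2(2) by simp
  next
    case 3
    obtain u' k where u: "dot3 u' u' = 1" "w = scale3 k u'" using normalize3[OF 3(2)] by metis
    obtain u where "dot3 u u = 1" "dot3 u' u = 0" using perpendicular3 by blast
    then show ?thesis using that[of u u' 0 k] u z[of u] 3(1) dot3_commute[of u u'] by simp
  next
    case 4
    obtain u k where u: "dot3 u u = 1" "v = scale3 k u" "k \<noteq> 0" using normalize3[OF 4(1)] by metis
    obtain u' k' where u': "dot3 u' u' = 1" "w = scale3 k' u'" "k' \<noteq> 0" using normalize3[OF 4(2)] by metis
    have "dot3 u u' = 0" using assms u u' by (simp add: dot3_scale)
    then show ?thesis using that u u' by blast
  qed
qed

lemma cross_facts:
  "dot3 (cross u v) u = 0" "dot3 (cross u v) v = 0"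
  "dot3 (cross u v) (cross u v) = dot3 u u * dot3 v v - (dot3 u v)\<^sup>2"
  "dot3 u (cross v w) = dot3 v (cross w u)"
  by (cases u; cases v; cases w; simp add: power2_eq_square algebra_simps)+

lemma parallel_cross:
  assumes "dot3 u u = 1" "dot3 v v = 1" "dot3 u v = 0" "dot3 w u = 0" "dot3 w v = 0"
  shows "w = scale3 (dot3 w (cross u v)) (cross u v)"
proof -
  obtain a b c where u: "u = (a,b,c)" by (cases u)
  obtain x y z where v: "v = (x,y,z)" by (cases v)
  obtain p q r where w: "w = (p,q,r)" by (cases w)
  define l m n where lmn: "l = b * z - c * y" "m = c * x - a * z" "n = a * y - b * x"
  have one: "l * l + m * m + n * n = 1"
    using cross_facts(3)[of u v] assms(1-3) by (simp add: u v lmn)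
  have h: "p * a + q * b + r * c = 0" "p * x + q * y + r * z = 0" using assms(4,5) by (simp_all add: u v w)
  \<comment> \<open>$w \times (u \times v) = (w \cdot v)\,u - (w \cdot u)\,v = 0$\<close>
  have cr: "q * n - r * m = 0" "r * l - p * n = 0" "p * m - q * l = 0"
  proof -
    have "q * n - r * m = (p * x + q * y + r * z) * a - (p * a + q * b + r * c) * x"
      "r * l - p * n = (p * x + q * y + r * z) * b - (p * a + q * b + r * c) * y"
      "p * m - q * l = (p * x + q * y + r * z) * c - (p * a + q * b + r * c) * z"
      by (simp_all add: lmn algebra_simps)
    then show "q * n - r * m = 0" "r * l - p * n = 0" "p * m - q * l = 0" unfolding h by simp_all
  qed
  have "p = p * (l * l + m * m + n * n)" "q = q * (l * l + m * m + n * n)" "r = r * (l * l + m * m + n * n)"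
    unfolding one by simp_all
  moreover have "p * (l * l + m * m + n * n) = (p * l + q * m + r * n) * l + m * (p * m - q * l) - n * (r * l - p * n)"
    "q * (l * l + m * m + n * n) = (p * l + q * m + r * n) * m + n * (q * n - r * m) - l * (p * m - q * l)"
    "r * (l * l + m * m + n * n) = (p * l + q * m + r * n) * n + l * (r * l - p * n) - m * (q * n - r * m)"
    by (simp_all add: algebra_simps)
  ultimately have "p = (p * l + q * m + r * n) * l" "q = (p * l + q * m + r * n) * m" "r = (p * l + q * m + r * n) * n"
    unfolding cr by simp_all
  then show ?thesis by (simp add: u v w lmn)
qed

lemma orthonormal_pair_extend:
  assumes "dot3 u u = 1" "dot3 v v = 1" "dot3 u v = 0"
  shows "dot3 (cross u v) (cross u v) = 1" "dot3 u (cross u v) = 0" "dot3 v (cross u v) = 0"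
    "dot3 u (cross v (cross u v)) = 1"
proof -
  show 1: "dot3 (cross u v) (cross u v) = 1" using cross_facts(3)[of u v] assms by simp
  show "dot3 u (cross u v) = 0" "dot3 v (cross u v) = 0"
    using cross_facts(1,2)[of u v] dot3_commute by metis+
  show "dot3 u (cross v (cross u v)) = 1"
    using cross_facts(4)[of u v "cross u v"] cross_facts(4)[of v "cross u v" u] 1 by simp
qed

text \<open>The frame must be positively oriented. A zero vector \<open>v0\<close> or
  \<open>v1\<close> leaves its slot free for the cross product of the other two; if both are
  nonzero, \<open>v2\<close> is parallel to their cross product and \<open>k2\<close> absorbs its
  length and sign.\<close>

lemma orthonormal_triple:
  assumes o: "dot3 v0 v1 = 0" "dot3 v0 v2 = 0" "dot3 v1 v2 = 0"
  obtains u0 u1 u2 k0 k1 k2 where "dot3 u0 u0 = 1" "dot3 u1 u1 = 1" "dot3 u2 u2 = 1"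
    "dot3 u0 u1 = 0" "dot3 u0 u2 = 0" "dot3 u1 u2 = 0" "dot3 u0 (cross u1 u2) = 1"
    "v0 = scale3 k0 u0" "v1 = scale3 k1 u1" "v2 = scale3 k2 u2"
proof -
  have z: "(0,0,0) = scale3 0 u" for u by (cases u) simp
  consider "v0 = (0,0,0)" | "v1 = (0,0,0)" | "v0 \<noteq> (0,0,0)" "v1 \<noteq> (0,0,0)" by blast
  then show ?thesis
  proof cases
    case 1
    obtain u1 u2 k1 k2 where u: "dot3 u1 u1 = 1" "dot3 u2 u2 = 1" "dot3 u1 u2 = 0" "v1 = scale3 k1 u1" "v2 = scale3 k2 u2"
      using orthonormal_pair[OF o(3)] by blast
    note e = orthonormal_pair_extend[OF u(1-3)]
    have "dot3 (cross u1 u2) (cross u1 u2) = 1" "dot3 (cross u1 u2) u1 = 0" "dot3 (cross u1 u2) u2 = 0"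
      using e dot3_commute by metis+
    then show ?thesis using that[of "cross u1 u2" u1 u2 0 k1 k2] u 1 z by simp
  next
    case 2
    \<comment> \<open>The pair is taken in the order \<open>v2\<close>, \<open>v0\<close>, so that
      its cross product completes a positively oriented frame when placed in the middle
      slot.\<close>
    have "dot3 v2 v0 = 0" using o(2) dot3_commute by metis
    then obtain u2 u0 k2 k0 where u: "dot3 u2 u2 = 1" "dot3 u0 u0 = 1" "dot3 u2 u0 = 0" "v2 = scale3 k2 u2" "v0 = scale3 k0 u0"
      using orthonormal_pair by blast
    note e = orthonormal_pair_extend[OF u(1-3)]
    have "dot3 u0 (cross (cross u2 u0) u2) = 1"
      using e(4) cross_facts(4)[of u2 u0 "cross u2 u0"] by simp
    moreover have "dot3 u0 (cross u2 u0) = 0" "dot3 (cross u2 u0) u2 = 0" "dot3 u0 u2 = 0"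
      using e u(3) dot3_commute by metis+
    ultimately show ?thesis using that[of u0 "cross u2 u0" u2 k0 0 k2] u 2 z e(1) by simp
  next
    case 3
    obtain u0 u1 k0 k1 where u: "dot3 u0 u0 = 1" "dot3 u1 u1 = 1" "dot3 u0 u1 = 0" "v0 = scale3 k0 u0" "v1 = scale3 k1 u1"
      using orthonormal_pair[OF o(1)] by blast
    have "k0 \<noteq> 0" "k1 \<noteq> 0" using 3 u z by metis+
    then have "dot3 v2 u0 = 0" "dot3 v2 u1 = 0"
      using o(2,3) u(4,5) dot3_commute[of v2 u0] dot3_commute[of v2 u1] by (simp_all add: dot3_scale)
    from parallel_cross[OF u(1-3) this]
    show ?thesis using that[of u0 u1 "cross u0 u1" k0 k1 "dot3 v2 (cross u0 u1)"] u orthonormal_pair_extend[OF u(1-3)] by simp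
  qed
qed

lemma scalar_prod_3: "dim_vec w = 3 \<Longrightarrow> v \<bullet> w = v $ 0 * w $ 0 + v $ Suc 0 * w $ Suc 0 + v $ 2 * w $ 2"
  by (simp add: scalar_prod_def atLeast0LessThan sum_lessThan_3)

text \<open>Normalised columns of \<open>R\<close> become the rows of \<open>Q\<close>. Writing each
  column as a multiple of a row, rather than conversely, also covers vanishing columns.\<close>

lemma orthogonal_columns_rotation:
  assumes R: "(R :: real mat) \<in> carrier_mat 3 3" and o: "\<forall>i<3. \<forall>j<3. i \<noteq> j \<longrightarrow> col R i \<bullet> col R j = 0"
  obtains Q where "SO3 Q" "\<forall>j<3. \<exists>c. col R j = c \<cdot>\<^sub>v row Q j"
proof -
  define v where "v j = (R $$ (0,j), R $$ (Suc 0,j), R $$ (2,j))" for j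
  have d: "dot3 (v i) (v j) = col R i \<bullet> col R j" if "i < 3" "j < 3" for i j
    using that R by (simp add: v_def scalar_prod_3)
  have "dot3 (v 0) (v (Suc 0)) = 0" "dot3 (v 0) (v 2) = 0" "dot3 (v (Suc 0)) (v 2) = 0"
    using o by (simp_all add: d)
  then obtain u0 u1 u2 k0 k1 k2 where u: "dot3 u0 u0 = 1" "dot3 u1 u1 = 1" "dot3 u2 u2 = 1"
    "dot3 u0 u1 = 0" "dot3 u0 u2 = 0" "dot3 u1 u2 = 0" "dot3 u0 (cross u1 u2) = 1"
    "v 0 = scale3 k0 u0" "v (Suc 0) = scale3 k1 u1" "v 2 = scale3 k2 u2"
    by (rule orthonormal_triple)
  obtain a b c where u0: "u0 = (a,b,c)" by (cases u0)
  obtain x y z where u1: "u1 = (x,y,z)" by (cases u1)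
  obtain p q r where u2: "u2 = (p,q,r)" by (cases u2)
  define Q where "Q = mat 3 3 (\<lambda>(i,j). [[a,b,c],[x,y,z],[p,q,r]] ! i ! j)"
  have Qc: "Q \<in> carrier_mat 3 3" by (simp add: Q_def)
  have Qe: "Q $$ (0,0) = a" "Q $$ (0,Suc 0) = b" "Q $$ (0,2) = c" "Q $$ (Suc 0,0) = x" "Q $$ (Suc 0,Suc 0) = y" "Q $$ (Suc 0,2) = z"
    "Q $$ (2,0) = p" "Q $$ (2,Suc 0) = q" "Q $$ (2,2) = r"
    by (simp_all add: Q_def)
  have Tc: "transpose_mat Q \<in> carrier_mat 3 3" using Qc by simp
  have "Q * transpose_mat Q = 1\<^sub>m 3"
  proof (rule eq_matI)
    fix i j assume "i < dim_row (1\<^sub>m 3 :: real mat)" "j < dim_col (1\<^sub>m 3 :: real mat)"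
    then have ij: "i < 3" "j < 3" by auto
    have "(Q * transpose_mat Q) $$ (i,j) = Q $$ (i,0) * Q $$ (j,0) + Q $$ (i,Suc 0) * Q $$ (j,Suc 0) + Q $$ (i,2) * Q $$ (j,2)"
      using transpose_mult_entry_3[OF Tc ij] ij Qc by simp
    also have "\<dots> = (1\<^sub>m 3) $$ (i,j)"
      using ij u(1-6) unfolding less_3_cases
      by (elim disjE; hypsubst) (simp_all add: Qe u0 u1 u2 mult.commute)
    finally show "(Q * transpose_mat Q) $$ (i,j) = (1\<^sub>m 3) $$ (i,j)" .
  qed (use Qc in auto)
  then have "transpose_mat Q * Q = 1\<^sub>m 3" using mat_mult_left_right_inverse[OF Qc Tc] by simp
  moreover have "det Q = 1" using u(7) unfolding det_3[OF Qc] Qe by (simp add: u0 u1 u2 algebra_simps)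
  ultimately have "SO3 Q" using Qc by (simp add: SO3_def)
  moreover have "\<exists>c. col R j = c \<cdot>\<^sub>v row Q j" if "j < 3" for j
  proof -
    have "col R 0 = k0 \<cdot>\<^sub>v row Q 0" "col R (Suc 0) = k1 \<cdot>\<^sub>v row Q (Suc 0)" "col R 2 = k2 \<cdot>\<^sub>v row Q 2"
      using R Qc u(8-10) by (auto simp: v_def u0 u1 u2 Qe less_3_cases intro!: eq_vecI)
    then show ?thesis using that unfolding less_3_cases by auto
  qed
  ultimately show ?thesis using that by blast
qed

lemma gram_entry_cols:
  assumes "(M :: real mat) \<in> carrier_mat 3 3" "i < 3" "j < 3"
  shows "(transpose_mat M * M) $$ (i,j) = col M i \<bullet> col M j"
  using assms by simp

text \<open>Left rotations preserve the Gram matrix of the columns. The orthogonality condition can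
  thus be read on \<open>diag3 e * A\<close>, on the Stokes matrix, or on any output-compensated
  Stokes matrix.\<close>

lemma orthogonal_preserves_gram:
  assumes Q: "(Q :: real mat) \<in> carrier_mat 3 3" "transpose_mat Q * Q = 1\<^sub>m 3" and M: "M \<in> carrier_mat 3 3" and ij: "i < 3" "j < 3"
  shows "col (Q * M) i \<bullet> col (Q * M) j = col M i \<bullet> col M j"
proof -
  have QM: "Q * M \<in> carrier_mat 3 3" using Q M by (intro carrier_matI) auto
  have "transpose_mat (Q * M) * (Q * M) = transpose_mat M * (transpose_mat Q * Q) * M"
    using Q(1) M by (simp add: transpose_mult[of Q 3 3 M 3] mult_assoc_dim)
  also have "\<dots> = transpose_mat M * M" unfolding Q(2) using M by simp
  finally show ?thesis using gram_entry_cols[OF QM ij] gram_entry_cols[OF M ij] by simp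
qed

section \<open>Two-sided and one-sided compensation\<close>

theorem theorem2:
  fixes E :: "complex mat \<Rightarrow> complex mat" and A B :: "real mat" and e :: "nat \<Rightarrow> real"
  assumes "qubit_channel E" and "unital E"
    and "SO3 A" and "SO3 B"
    and "stokes_R E = B * diag3 e * A"
  shows "F2 E = F2tilde E \<and> F2tilde E = Ktilde_at E (transpose_mat A) (transpose_mat B)
    \<and> (F1 E = F1tilde E \<longleftrightarrow>
         (\<forall>i<3. \<forall>j<3. i \<noteq> j \<longrightarrow> col (diag3 e * A) i \<bullet> col (diag3 e * A) j = 0))
    \<and> ((\<forall>i<3. \<forall>j<3. i \<noteq> j \<longrightarrow> col (diag3 e * A) i \<bullet> col (diag3 e * A) j = 0) \<longrightarrow>
         (\<exists>OB. SO3 OB \<and> (\<forall>j<3. \<exists>c::real. col (stokes_R E) j = c \<cdot>\<^sub>v row OB j)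
               \<and> Ktilde_at E (1\<^sub>m 3) OB = F1tilde E))"
proof -
  note E = assms(1,2)
  define R where "R = stokes_R E"
  define S where "S = vn_entropy (choi E)"
  have Rc: "R \<in> carrier_mat 3 3" by (simp add: R_def)
  have A: "A \<in> carrier_mat 3 3" "transpose_mat A * A = 1\<^sub>m 3" and B: "B \<in> carrier_mat 3 3" "transpose_mat B * B = 1\<^sub>m 3"
    using assms(3,4) by (auto simp: SO3_def)
  have D: "diag3 e \<in> carrier_mat 3 3" by (simp add: diag3_def)
  have AA: "A * transpose_mat A = 1\<^sub>m 3" using SO3_transpose[OF assms(3)] by (simp add: SO3_def)
  have DA: "diag3 e * A \<in> carrier_mat 3 3" using A D by (intro carrier_matI) auto
  have RB: "R = B * (diag3 e * A)" unfolding R_def assms(5) using A B D by (simp add: mult_assoc_dim)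
  have orth: "col (diag3 e * A) i \<bullet> col (diag3 e * A) j = col R i \<bullet> col R j" if "i < 3" "j < 3" for i j
    unfolding RB using orthogonal_preserves_gram[OF B DA that] by simp
  obtain UA where UA: "unitary_mat 2 UA" "rot UA = transpose_mat A" using rot_surj[OF SO3_transpose[OF assms(3)]] by blast
  obtain UB where UB: "unitary_mat 2 UB" "rot UB = transpose_mat B" using rot_surj[OF SO3_transpose[OF assms(4)]] by blast
  have bound2: "Ktilde_at E (rot VA) (rot VB) \<le> 1 - S" if "unitary_mat 2 VA" "unitary_mat 2 VB" for VA VB
    unfolding S_def using Ktilde_at_unitary(2)[OF E(1) that] .
  have bound1: "Ktilde_at E (1\<^sub>m 3) (rot V) \<le> 1 - S" if "unitary_mat 2 V" for V
    unfolding S_def using Ktilde_at_left_unitary(2)[OF E(1) that] .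
  \<comment> \<open>Undoing both rotations leaves \<open>diag3 e\<close>, so the compensated channel
    has the Choi matrix of a Pauli channel, whose Bell entropy is its von Neumann entropy.\<close>
  have opt2: "Ktilde_at E (rot UA) (rot UB) = 1 - S"
  proof -
    let ?G = "uchan UB \<circ> E \<circ> uchan UA"
    have "rot UB * stokes_R E * rot UA = (transpose_mat B * B) * diag3 e * (A * transpose_mat A)"
      unfolding UA UB assms(5) using A(1) B(1) D by (simp add: mult_assoc_dim)
    also have "\<dots> = diag3 e" unfolding B(2) AA using D by simp
    finally have RG: "stokes_R ?G = diag3 e" using stokes_R_unitary_conj(1)[OF E(1) UA(1) UB(1)] by simp
    have G: "qubit_channel ?G" by (rule qubit_channel_unitary_conj[OF E(1) UA(1) UB(1)])
    have "unital ?G"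
      using unital_right_unitary[OF left_unitary_channel(1)[OF E(1) UB(1)] unital_left_unitary[OF E UB(1)] UA(1)] .
    then have "vn_entropy (choi ?G) = bell_entropy (stokes_diag ?G)"
      by (rule vn_entropy_choi_pauli_diagonal[OF G]) (simp add: RG diag3_def)
    then have "S = bell_entropy (stokes_diag ?G)"
      using vn_entropy_choi_unitary_conj[OF E(1) UA(1) UB(1)] by (simp add: S_def)
    then show ?thesis
      unfolding Ktilde_at_unitary(1)[OF E(1) UA(1) UB(1)] stokes_R_unitary_conj(1)[OF E(1) UA(1) UB(1), symmetric]
      by (simp add: stokes_diag_def[abs_def])
  qed
  have F2t: "F2tilde E = 1 - S"
    unfolding F2tilde_def unitary2_iff
    by (rule cSup_eq_maximum) (use opt2 bound2 UA(1) UB(1) in \<open>force+\<close>)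
  have F1t: "F1tilde E \<le> 1 - S"
    unfolding F1tilde_def unitary2_iff by (rule cSUP_least) (use bound1 UB(1) in auto)
  have bdd: "bdd_above ((\<lambda>V. Ktilde_at E (1\<^sub>m 3) (rot V)) ` {U. unitary_mat 2 U})"
    using bound1 by (intro bdd_aboveI2) auto
  have optimal_rotation: "\<exists>OB. SO3 OB \<and> (\<forall>j<3. \<exists>c. col R j = c \<cdot>\<^sub>v row OB j) \<and> Ktilde_at E (1\<^sub>m 3) OB = 1 - S \<and> F1tilde E = 1 - S"
    if ortho: "\<forall>i<3. \<forall>j<3. i \<noteq> j \<longrightarrow> col R i \<bullet> col R j = 0"
  proof -
    obtain Q where Q: "SO3 Q" "\<forall>j<3. \<exists>c. col R j = c \<cdot>\<^sub>v row Q j"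
      using orthogonal_columns_rotation[OF Rc ortho] by blast
    obtain U where U: "unitary_mat 2 U" "rot U = Q" using rot_surj[OF Q(1)] by blast
    have Qc: "Q \<in> carrier_mat 3 3" "transpose_mat Q \<in> carrier_mat 3 3" "Q * transpose_mat Q = 1\<^sub>m 3"
      using SO3_transpose[OF Q(1)] Q(1) by (auto simp: SO3_def)
    let ?G = "uchan U \<circ> E"
    have RG: "stokes_R ?G = Q * R" using stokes_R_unitary_conj(2)[OF E(1) U(1) U(1)] by (simp add: U R_def)
    \<comment> \<open>Column \<open>b\<close> of \<open>R\<close> is a multiple of row
      \<open>b\<close> of \<open>Q\<close>, so each off-diagonal entry of \<open>Q * R\<close> is a
      multiple of the inner product of two distinct orthonormal rows.\<close>
    have off: "stokes_R ?G $$ (a,b) = 0" if ab: "a < 3" "b < 3" "a \<noteq> b" for a b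
    proof -
      obtain c where c: "col R b = c \<cdot>\<^sub>v row Q b" using Q(2) ab by blast
      have "stokes_R ?G $$ (a,b) = row Q a \<bullet> col R b" unfolding RG using Qc Rc ab by simp
      also have "\<dots> = c * (row Q a \<bullet> row Q b)" unfolding c using Qc ab by (intro scalar_prod_smult_distrib[of _ 3]) auto
      also have "row Q a \<bullet> row Q b = (Q * transpose_mat Q) $$ (a,b)" using Qc(1) ab by simp
      also have "\<dots> = 0" unfolding Qc(3) using ab by simp
      finally show ?thesis by (simp only: mult_zero_right)
    qed
    have "vn_entropy (choi ?G) = bell_entropy (stokes_diag ?G)"
      by (rule vn_entropy_choi_pauli_diagonal[OF left_unitary_channel(1)[OF E(1) U(1)] unital_left_unitary[OF E U(1)] off])
    then have "S = bell_entropy (stokes_diag ?G)" using left_unitary_channel(2)[OF E(1) U(1)] by (simp add: S_def)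
    then have K: "Ktilde_at E (1\<^sub>m 3) Q = 1 - S"
      unfolding U(2)[symmetric] Ktilde_at_left_unitary(1)[OF E(1) U(1)] stokes_R_unitary_conj(2)[OF E(1) U(1) U(1), symmetric]
      by (simp add: stokes_diag_def[abs_def])
    have "Ktilde_at E (1\<^sub>m 3) (rot U) \<le> F1tilde E"
      unfolding F1tilde_def unitary2_iff by (rule cSUP_upper[OF _ bdd]) (simp add: U)
    then have "F1tilde E = 1 - S" using K U(2) F1t by simp
    then show ?thesis using Q K by blast
  qed
  have orthogonal: "col R i \<bullet> col R j = 0" if eq: "F1tilde E = 1 - S" and ij: "i < 3" "j < 3" "i \<noteq> j" for i j
  proof -
    \<comment> \<open>At an attaining rotation the Bell entropy of the compensated channel equals
      \<open>S\<close>, so the equality case applies to this one channel.\<close>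
    obtain U where U: "unitary_mat 2 U" "F1tilde E = Ktilde_at E (1\<^sub>m 3) (rot U)" using F1tilde_attained[OF E(1)] by blast
    let ?G = "uchan U \<circ> E"
    have RG: "stokes_R ?G = rot U * R" using stokes_R_unitary_conj(2)[OF E(1) U(1) U(1)] by (simp add: R_def)
    have "S = bell_entropy (stokes_diag ?G)"
      using U(2) eq Ktilde_at_left_unitary(1)[OF E(1) U(1)] stokes_R_unitary_conj(2)[OF E(1) U(1) U(1)]
      by (simp add: stokes_diag_def[abs_def])
    then have "vn_entropy (choi ?G) = bell_entropy (stokes_diag ?G)"
      using left_unitary_channel(2)[OF E(1) U(1)] by (simp add: S_def)
    note off = bell_entropy_equality[OF left_unitary_channel(1)[OF E(1) U(1)] unital_left_unitary[OF E U(1)] this]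
    have "col R i \<bullet> col R j = col (rot U * R) i \<bullet> col (rot U * R) j"
      using orthogonal_preserves_gram[OF rot_carrier rot_orthogonal[OF U(1)] Rc ij(1,2)] by simp
    also have "\<dots> = (transpose_mat (stokes_R ?G) * stokes_R ?G) $$ (i,j)"
      unfolding RG[symmetric] by (rule gram_entry_cols[symmetric]) (use ij in simp_all)
    \<comment> \<open>The compensated Stokes matrix is diagonal, so each summand of an off-diagonal
      Gram entry contains a vanishing factor.\<close>
    also have "\<dots> = 0"
      unfolding transpose_mult_entry_3[OF stokes_R_carrier ij(1,2)] using ij off unfolding less_3_cases by auto
    finally show ?thesis .
  qed
  have cond: "(\<forall>i<3. \<forall>j<3. i \<noteq> j \<longrightarrow> col (diag3 e * A) i \<bullet> col (diag3 e * A) j = 0)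
      \<longleftrightarrow> (\<forall>i<3. \<forall>j<3. i \<noteq> j \<longrightarrow> col R i \<bullet> col R j = 0)"
    using orth by auto
  have F: "F1 E = 1 - S" "F2 E = 1 - S" using F1_unital[OF E] F2_unital[OF E] by (simp_all add: S_def)
  have K: "Ktilde_at E (transpose_mat A) (transpose_mat B) = 1 - S" using opt2 UA UB by simp
  have iff: "F1 E = F1tilde E \<longleftrightarrow> (\<forall>i<3. \<forall>j<3. i \<noteq> j \<longrightarrow> col R i \<bullet> col R j = 0)"
    unfolding F using orthogonal optimal_rotation by metis
  show ?thesis unfolding cond F2t F(2) K iff unfolding R_def[symmetric] using optimal_rotation by metis
qed

end
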